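(* Let $G$ be a countable group, $S \subset G$ a finite nonempty set, $\mathcal{C}$ an $S$-UCP convexoid on $G$, $A$ a finite nonempty alphabet, $k \geq 1$, let $\mathcal{T} \subset A^S$ have $k$-TEP (with respect to $\mathcal{C}$), and let $X = \{x \in A^G : \forall g \in G,\ (gx)|_S \in \mathcal{T}\}$ be the SFT with allowed patterns $\mathcal{T}$. Then there exists a unique Borel probability measure $\mu$ on $X$ such that for all $C \in \mathcal{C}$ the marginal distribution $\mu|_C$ is uniform on $X|_C = \{x|_C : x \in X\}$. If $\mathcal{C}$ is invariant (i.e. $C \in \mathcal{C} \implies gC \in \mathcal{C}$ for all $g \in G$), then $\mu$ is invariant under the $G$-action. If $G$ has a decidable word problem and $\mathcal{C}$ is recursively enumerable, then this measure is computable uniformly in the description of $\mathcal{T}$ and can be sampled perfectly.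
   Context: Action: $(gx)_h = x_{g^{-1}h}$ for $x \in A^G$. The marginal $\mu|_C$ is the measure on $A^C$ with $\mu|_C(P) = \mu(\{x \in X : x|_C = P\})$. Convexoid: a family $\mathcal{C}$ of finite subsets of $G$ such that $\emptyset \in \mathcal{C}$, every finite subset of $G$ is contained in some element of $\mathcal{C}$, and whenever $C, D \in \mathcal{C}$ with $C \subsetneq D$ there is $a \in D \setminus C$ with $C \cup \{a\} \in \mathcal{C}$. For finite $B \subset G$ put $\overline{B} = \bigcap\{C \in \mathcal{C} : B \subset C\}$; the lax corners of $B$ are $\angle B = \{a \in B : a \notin \overline{B \setminus \{a\}}\}$. The convexoid is $S$-UCP if for all $C \in \mathcal{C}$ and $a \in \angle C$ there is at most one $g \in G$ with $a \in gS \subset C$. $k$-TEP: for $\emptyset \neq E \subset S$, $\mathcal{T} \subset A^S$ has $k$-uniform $E$-extensions if for every $s \in E$ and every $P \in A^{S \setminus \{s\}}$ there are exactly $k$ symbols $a \in A$ such that the extension of $P$ to $S$ with value $a$ at $s$ lies in $\mathcal{T}$. $\mathcal{T}$ has $k$-TEP if for every $g \in G$ it has $k$-uniform $(g^{-1}\angle(gS))$-extensions. Computability: an encoded group is a group together with a bijection with a subset of the words over a finite alphabet; "$G$ has decidable word problem" means that $G$ is considered with an encoding for which the set of codes is decidable and product and inversion are computable. Finite subsets of $G$ and finite patterns are encoded as words in the standard way. The measure $\mu$ is computable if $X$ has decidable language (the set of finite patterns $P \in A^C$ with $P = x|_C$ for some $x \in X$) and, given a finite pattern $P$ in the language and a rational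 $\epsilon > 0$, one can compute a rational number in $[\mu([P]) - \epsilon, \mu([P]) + \epsilon]$, where $[P] = \{x \in X : x|_C = P\}$. It can be sampled perfectly if there is an algorithm which, given access to a source of (independent uniform) random bits, enumerates a configuration so that the resulting configuration is distributed according to $\mu$. *)

theory Defs
  imports "HOL-Probability.Probability" "HOL-Algebra.Coset" "HOL-Library.Nat_Bijection"
begin

text \<open>
  Elements of \<open>A\<^sup>C\<close> for \<open>C \<subseteq> carrier G\<close> are the extensional functions in \<^term>\<open>C \<rightarrow>\<^sub>E A\<close>,
  and \<open>x|\<^sub>C\<close> is \<^term>\<open>restrict x C\<close>.
\<close>

definition shift_action :: "('g, 'm) monoid_scheme \<Rightarrow> 'g \<Rightarrow> ('g \<Rightarrow> 'a) \<Rightarrow> 'g \<Rightarrow> 'a" where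
  "shift_action G g x = (\<lambda>h\<in>carrier G. x (inv\<^bsub>G\<^esub> g \<otimes>\<^bsub>G\<^esub> h))"

definition sft ::
    "('g, 'm) monoid_scheme \<Rightarrow> 'g set \<Rightarrow> 'a set \<Rightarrow> ('g \<Rightarrow> 'a) set \<Rightarrow> ('g \<Rightarrow> 'a) set" where
  "sft G S A \<T> =
    {x \<in> carrier G \<rightarrow>\<^sub>E A. \<forall>g\<in>carrier G. restrict (shift_action G g x) S \<in> \<T>}"

definition restrictions :: "('g \<Rightarrow> 'a) set \<Rightarrow> 'g set \<Rightarrow> ('g \<Rightarrow> 'a) set" where
  "restrictions X C = (\<lambda>x. restrict x C) ` X"

definition config_topology ::
    "('g, 'm) monoid_scheme \<Rightarrow> 'a set \<Rightarrow> ('g \<Rightarrow> 'a) set \<Rightarrow> ('g \<Rightarrow> 'a) topology" where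
  "config_topology G A X =
    subtopology (product_topology (\<lambda>_. discrete_topology A) (carrier G)) X"

definition borel_sigma :: "'b topology \<Rightarrow> 'b measure" where
  "borel_sigma \<tau> = sigma (topspace \<tau>) {U. openin \<tau> U}"

definition borel_prob_on ::
    "('g, 'm) monoid_scheme \<Rightarrow> 'a set \<Rightarrow> ('g \<Rightarrow> 'a) set \<Rightarrow> ('g \<Rightarrow> 'a) measure \<Rightarrow> bool" where
  "borel_prob_on G A X \<mu> \<longleftrightarrow>
    prob_space \<mu> \<and> space \<mu> = X \<and> sets \<mu> = sets (borel_sigma (config_topology G A X))"

definition marginal :: "('g \<Rightarrow> 'a) measure \<Rightarrow> 'g set \<Rightarrow> ('g \<Rightarrow> 'a) \<Rightarrow> real" where
  "marginal \<mu> C P = measure \<mu> {x \<in> space \<mu>. restrict x C = P}"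

definition uniform_marginals ::
    "'g set set \<Rightarrow> 'a set \<Rightarrow> ('g \<Rightarrow> 'a) set \<Rightarrow> ('g \<Rightarrow> 'a) measure \<Rightarrow> bool" where
  "uniform_marginals \<C> A X \<mu> \<longleftrightarrow>
    (\<forall>C\<in>\<C>. \<forall>P \<in> C \<rightarrow>\<^sub>E A.
      marginal \<mu> C P =
        (if P \<in> restrictions X C then 1 / real (card (restrictions X C)) else 0))"

definition shift_invariant :: "('g, 'm) monoid_scheme \<Rightarrow> ('g \<Rightarrow> 'a) measure \<Rightarrow> bool" where
  "shift_invariant G \<mu> \<longleftrightarrow>
    (\<forall>g\<in>carrier G. shift_action G g \<in> measurable \<mu> \<mu> \<and> distr \<mu> \<mu> (shift_action G g) = \<mu>)"

definition convexoid :: "('g, 'm) monoid_scheme \<Rightarrow> 'g set set \<Rightarrow> bool" where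
  "convexoid G \<C> \<longleftrightarrow>
    (\<forall>C\<in>\<C>. finite C \<and> C \<subseteq> carrier G) \<and>
    {} \<in> \<C> \<and>
    (\<forall>F. finite F \<and> F \<subseteq> carrier G \<longrightarrow> (\<exists>C\<in>\<C>. F \<subseteq> C)) \<and>
    (\<forall>C\<in>\<C>. \<forall>D\<in>\<C>. C \<subset> D \<longrightarrow> (\<exists>a\<in>D - C. insert a C \<in> \<C>))"

definition convex_closure :: "'g set set \<Rightarrow> 'g set \<Rightarrow> 'g set" where
  "convex_closure \<C> B = \<Inter>{C \<in> \<C>. B \<subseteq> C}"

definition lax_corners :: "'g set set \<Rightarrow> 'g set \<Rightarrow> 'g set" where
  "lax_corners \<C> B = {a \<in> B. a \<notin> convex_closure \<C> (B - {a})}"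

definition ucp :: "('g, 'm) monoid_scheme \<Rightarrow> 'g set \<Rightarrow> 'g set set \<Rightarrow> bool" where
  "ucp G S \<C> \<longleftrightarrow>
    (\<forall>C\<in>\<C>. \<forall>a\<in>lax_corners \<C> C. \<forall>g\<in>carrier G. \<forall>h\<in>carrier G.
      a \<in> g <#\<^bsub>G\<^esub> S \<and> g <#\<^bsub>G\<^esub> S \<subseteq> C \<and> a \<in> h <#\<^bsub>G\<^esub> S \<and> h <#\<^bsub>G\<^esub> S \<subseteq> C \<longrightarrow> g = h)"

definition invariant_convexoid :: "('g, 'm) monoid_scheme \<Rightarrow> 'g set set \<Rightarrow> bool" where
  "invariant_convexoid G \<C> \<longleftrightarrow> (\<forall>g\<in>carrier G. \<forall>C\<in>\<C>. g <#\<^bsub>G\<^esub> C \<in> \<C>)"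

definition uniform_extensions ::
    "'g set \<Rightarrow> 'a set \<Rightarrow> nat \<Rightarrow> ('g \<Rightarrow> 'a) set \<Rightarrow> 'g set \<Rightarrow> bool" where
  "uniform_extensions S A k \<T> E \<longleftrightarrow>
    E \<noteq> {} \<and> E \<subseteq> S \<and>
    (\<forall>s\<in>E. \<forall>P \<in> (S - {s}) \<rightarrow>\<^sub>E A. card {a \<in> A. P(s := a) \<in> \<T>} = k)"

definition tep ::
    "('g, 'm) monoid_scheme \<Rightarrow> 'g set set \<Rightarrow> 'g set \<Rightarrow> 'a set \<Rightarrow> nat \<Rightarrow> ('g \<Rightarrow> 'a) set \<Rightarrow> bool" where
  "tep G \<C> S A k \<T> \<longleftrightarrow>
    (\<forall>g\<in>carrier G.
      uniform_extensions S A k \<T> (inv\<^bsub>G\<^esub> g <#\<^bsub>G\<^esub> lax_corners \<C> (g <#\<^bsub>G\<^esub> S)))"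

definition tep_family ::
    "('g, 'm) monoid_scheme \<Rightarrow> 'g set set \<Rightarrow> 'g set \<Rightarrow> 'a set \<Rightarrow> nat \<Rightarrow> ('g \<Rightarrow> 'a) set \<Rightarrow> bool" where
  "tep_family G \<C> S A k \<T> \<longleftrightarrow>
    finite S \<and> S \<noteq> {} \<and> S \<subseteq> carrier G \<and> ucp G S \<C> \<and>
    finite A \<and> A \<noteq> {} \<and> 1 \<le> k \<and> \<T> \<subseteq> (S \<rightarrow>\<^sub>E A) \<and> tep G \<C> S A k \<T>"

definition tep_measure ::
    "('g, 'm) monoid_scheme \<Rightarrow> 'g set set \<Rightarrow> 'g set \<Rightarrow> 'a set \<Rightarrow> ('g \<Rightarrow> 'a) set \<Rightarrow>
      ('g \<Rightarrow> 'a) measure \<Rightarrow> bool" where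
  "tep_measure G \<C> S A \<T> \<mu> \<longleftrightarrow>
    borel_prob_on G A (sft G S A \<T>) \<mu> \<and> uniform_marginals \<C> A (sft G S A \<T>) \<mu>"

text \<open>
  Kleene's partial recursive functions in unary form, tuples being coded by \<^const>\<open>prod_encode\<close>.
  The predicate is relative to a set \<open>Q\<close> of basic functionals, whose first argument \<open>\<omega>\<close> is
  an external source of information: a program is built without knowledge of \<open>\<omega>\<close>, and reads
  \<open>\<omega>\<close> only through the functionals in \<open>Q\<close>. The value \<^const>\<open>None\<close> means divergence.
\<close>

definition minimize :: "(nat \<Rightarrow> nat option) \<Rightarrow> nat option" where
  "minimize h =
    (if \<exists>n. h n = Some 0 \<and> (\<forall>m<n. h m \<noteq> None) then Some (LEAST n. h n = Some 0) else None)"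

inductive partial_recursive_in ::
    "('w \<Rightarrow> nat \<Rightarrow> nat option) set \<Rightarrow> ('w \<Rightarrow> nat \<Rightarrow> nat option) \<Rightarrow> bool"
  for Q :: "('w \<Rightarrow> nat \<Rightarrow> nat option) set"
where
  basic: "F \<in> Q \<Longrightarrow> partial_recursive_in Q F"
| zero: "partial_recursive_in Q (\<lambda>\<omega> n. Some 0)"
| succ: "partial_recursive_in Q (\<lambda>\<omega> n. Some (Suc n))"
| left: "partial_recursive_in Q (\<lambda>\<omega> n. Some (fst (prod_decode n)))"
| right: "partial_recursive_in Q (\<lambda>\<omega> n. Some (snd (prod_decode n)))"
| pair: "partial_recursive_in Q F \<Longrightarrow> partial_recursive_in Q H \<Longrightarrow>
    partial_recursive_in Q (\<lambda>\<omega> n.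
      Option.bind (F \<omega> n) (\<lambda>a. Option.bind (H \<omega> n) (\<lambda>b. Some (prod_encode (a, b)))))"
| comp: "partial_recursive_in Q F \<Longrightarrow> partial_recursive_in Q H \<Longrightarrow>
    partial_recursive_in Q (\<lambda>\<omega> n. Option.bind (H \<omega> n) (F \<omega>))"
| prim_rec: "partial_recursive_in Q F \<Longrightarrow> partial_recursive_in Q H \<Longrightarrow>
    partial_recursive_in Q (\<lambda>\<omega> n. case prod_decode n of (a, m) \<Rightarrow>
      rec_nat (F \<omega> a)
        (\<lambda>y r. Option.bind r (\<lambda>i. H \<omega> (prod_encode (a, prod_encode (y, i))))) m)"
| mu: "partial_recursive_in Q F \<Longrightarrow>
    partial_recursive_in Q (\<lambda>\<omega> a. minimize (\<lambda>n. F \<omega> (prod_encode (a, n))))"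

definition partial_recursive :: "(nat \<Rightarrow> nat option) \<Rightarrow> bool" where
  "partial_recursive f \<longleftrightarrow> partial_recursive_in {} (\<lambda>_::unit. f)"

definition bit_recursive :: "((nat \<Rightarrow> bool) \<Rightarrow> nat \<Rightarrow> nat option) \<Rightarrow> bool" where
  "bit_recursive F \<longleftrightarrow> partial_recursive_in {\<lambda>\<omega> n. Some (if \<omega> n then 1 else 0)} F"

definition decides :: "(nat \<Rightarrow> nat option) \<Rightarrow> nat set \<Rightarrow> bool" where
  "decides f M \<longleftrightarrow> (\<forall>n. f n = Some (if n \<in> M then 1 else 0))"

definition decidable_set :: "nat set \<Rightarrow> bool" where
  "decidable_set M \<longleftrightarrow> (\<exists>f. partial_recursive f \<and> decides f M)"

definition re_set :: "nat set \<Rightarrow> bool" where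
  "re_set M \<longleftrightarrow> (\<exists>f. partial_recursive f \<and> M = ran f)"

text \<open>
  Words over the finite alphabet \<open>{0, \<dots>, b - 1}\<close> are lists over \<^term>\<open>{..<b::nat}\<close>, and are
  identified with natural numbers by \<^const>\<open>list_encode\<close>. Finite sets of objects with codes are
  coded by their canonical index \<^const>\<open>set_encode\<close>, finite patterns by the canonical index of
  their graph. The symbols of the alphabet are coded by an arbitrary numbering \<open>\<alpha>\<close>.
\<close>

definition encoded_group :: "('g, 'm) monoid_scheme \<Rightarrow> ('g \<Rightarrow> nat list) \<Rightarrow> bool" where
  "encoded_group G enc \<longleftrightarrow>
    group G \<and> inj_on enc (carrier G) \<and> (\<exists>b. enc ` carrier G \<subseteq> lists {..<b})"

definition elem_code :: "('g \<Rightarrow> nat list) \<Rightarrow> 'g \<Rightarrow> nat" where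
  "elem_code enc g = list_encode (enc g)"

definition decidable_word_problem :: "('g, 'm) monoid_scheme \<Rightarrow> ('g \<Rightarrow> nat list) \<Rightarrow> bool" where
  "decidable_word_problem G enc \<longleftrightarrow>
    decidable_set (elem_code enc ` carrier G) \<and>
    (\<exists>f. partial_recursive f \<and> (\<forall>g\<in>carrier G. \<forall>h\<in>carrier G.
      f (prod_encode (elem_code enc g, elem_code enc h)) = Some (elem_code enc (g \<otimes>\<^bsub>G\<^esub> h)))) \<and>
    (\<exists>f. partial_recursive f \<and> (\<forall>g\<in>carrier G.
      f (elem_code enc g) = Some (elem_code enc (inv\<^bsub>G\<^esub> g))))"

definition finset_code :: "('g \<Rightarrow> nat list) \<Rightarrow> 'g set \<Rightarrow> nat" where
  "finset_code enc B = set_encode (elem_code enc ` B)"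

definition cell_code :: "('g \<Rightarrow> nat list) \<Rightarrow> ('a \<Rightarrow> nat) \<Rightarrow> ('g \<Rightarrow> 'a) \<Rightarrow> 'g \<Rightarrow> nat" where
  "cell_code enc \<alpha> x g = prod_encode (elem_code enc g, \<alpha> (x g))"

definition pattern_code :: "('g \<Rightarrow> nat list) \<Rightarrow> ('a \<Rightarrow> nat) \<Rightarrow> 'g set \<Rightarrow> ('g \<Rightarrow> 'a) \<Rightarrow> nat" where
  "pattern_code enc \<alpha> C P = set_encode (cell_code enc \<alpha> P ` C)"

definition description ::
    "('g \<Rightarrow> nat list) \<Rightarrow> ('a \<Rightarrow> nat) \<Rightarrow> 'g set \<Rightarrow> 'a set \<Rightarrow> ('g \<Rightarrow> 'a) set \<Rightarrow> nat" where
  "description enc \<alpha> S A \<T> =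
    prod_encode (set_encode (\<alpha> ` A),
      prod_encode (finset_code enc S, set_encode (pattern_code enc \<alpha> S ` \<T>)))"

definition rat_of_code :: "nat \<Rightarrow> rat" where
  "rat_of_code n = (case prod_decode n of (p, q) \<Rightarrow> of_int (int_decode p) / of_nat (Suc q))"

definition re_convexoid :: "('g \<Rightarrow> nat list) \<Rightarrow> 'g set set \<Rightarrow> bool" where
  "re_convexoid enc \<C> \<longleftrightarrow> re_set (finset_code enc ` \<C>)"

definition language_codes ::
    "('g, 'm) monoid_scheme \<Rightarrow> ('g \<Rightarrow> nat list) \<Rightarrow> ('a \<Rightarrow> nat) \<Rightarrow> ('g \<Rightarrow> 'a) set \<Rightarrow> nat set" where
  "language_codes G enc \<alpha> X =
    {pattern_code enc \<alpha> C P | C P. finite C \<and> C \<subseteq> carrier G \<and> P \<in> restrictions X C}"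

definition approximates ::
    "('g, 'm) monoid_scheme \<Rightarrow> ('g \<Rightarrow> nat list) \<Rightarrow> ('a \<Rightarrow> nat) \<Rightarrow> ('g \<Rightarrow> 'a) set \<Rightarrow>
      ('g \<Rightarrow> 'a) measure \<Rightarrow> (nat \<Rightarrow> nat option) \<Rightarrow> bool" where
  "approximates G enc \<alpha> X \<mu> f \<longleftrightarrow>
    (\<forall>C P e. finite C \<and> C \<subseteq> carrier G \<and> P \<in> restrictions X C \<and> 0 < rat_of_code e \<longrightarrow>
      (\<exists>q. f (prod_encode (pattern_code enc \<alpha> C P, e)) = Some q \<and>
        \<bar>real_of_rat (rat_of_code q) - measure \<mu> {x \<in> X. restrict x C = P}\<bar>
          \<le> real_of_rat (rat_of_code e)))"

definition computes_measure ::
    "('g, 'm) monoid_scheme \<Rightarrow> ('g \<Rightarrow> nat list) \<Rightarrow> ('a \<Rightarrow> nat) \<Rightarrow> ('g \<Rightarrow> 'a) set \<Rightarrow>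
      ('g \<Rightarrow> 'a) measure \<Rightarrow> (nat \<Rightarrow> nat option) \<Rightarrow> (nat \<Rightarrow> nat option) \<Rightarrow> bool" where
  "computes_measure G enc \<alpha> X \<mu> l f \<longleftrightarrow>
    decides l (language_codes G enc \<alpha> X) \<and> approximates G enc \<alpha> X \<mu> f"

definition coin_space :: "(nat \<Rightarrow> bool) measure" where
  "coin_space = PiM UNIV (\<lambda>_. measure_pmf (bernoulli_pmf (1/2)))"

text \<open>
  A run on the bit sequence \<open>\<omega>\<close> enumerates a configuration by listing, in any order, its
  cells, that is the pairs of a group element and the symbol there. The configuration has to be
  produced for almost every \<open>\<omega>\<close>: with fair bits no algorithm with bounded reading can draw
  uniformly from, say, three symbols, so runs of probability zero may fail.
\<close>

definition sampled_perfectly ::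
    "('g, 'm) monoid_scheme \<Rightarrow> ('g \<Rightarrow> nat list) \<Rightarrow> ('a \<Rightarrow> nat) \<Rightarrow> ('g \<Rightarrow> 'a) measure \<Rightarrow> bool" where
  "sampled_perfectly G enc \<alpha> \<mu> \<longleftrightarrow>
    (\<exists>F \<xi>. bit_recursive F \<and> \<xi> \<in> measurable coin_space \<mu> \<and>
      (AE \<omega> in coin_space. ran (F \<omega>) = cell_code enc \<alpha> (\<xi> \<omega>) ` carrier G) \<and>
      distr coin_space \<mu> \<xi> = \<mu>)"

end

theory Submission
  imports Defs
begin

text \<open>
  Call the members of \<open>\<C>\<close> convex. The heart of the matter is a count. Let \<open>C\<close> and \<open>insert a C\<close> be
  convex with \<open>a \<notin> C\<close>, and call a pattern \<open>P\<close> valid if it violates no constraint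
  \<open>(\<lambda>s\<in>S. P (g \<otimes> s)) \<in> \<T>\<close> with \<open>g <# S\<close> inside its domain.
  By the unique corner property, adding \<open>a\<close> creates at most one new constraint, and \<open>a\<close> sits at a lax
  corner of its translate of \<open>S\<close>. So a valid pattern on \<open>C\<close> has \<open>k\<close> or \<open>card A\<close> valid extensions to
  \<open>insert a C\<close>, and which of the two does not depend on the pattern (\<open>card_one_point_extensions\<close>).
  Since convex sets are connected by chains of one-point extensions, all valid patterns on a convex
  set \<open>C\<close> have the same positive number of valid extensions to a larger convex set \<open>D\<close>
  (\<open>extensions_uniform\<close>).

  Now exhaust the group by convex sets \<open>D 0 \<subseteq> D 1 \<subseteq> \<dots>\<close> and extend a pattern step by step, each time
  choosing uniformly among the valid extensions to the next set. Because of the equal numbers of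
  extensions, the pattern on \<open>D j\<close> is then uniform among the valid ones (\<open>state_uniform\<close>), and so is
  its restriction to each convex set. The limit is a random configuration in the subshift. It shows that
  valid patterns on convex sets are exactly the restrictions of configurations, and its
  distribution has the required marginals (\<open>tep_measure_\<xi>\<close>).

  The cylinders over the sets of an exhaustion form an
  intersection stable generator of the Borel sets, on which the marginals prescribe the measure
  (\<open>tep_measure_unique\<close>). If the convexoid is invariant, then a translate of the measure has uniform
  marginals as well and is therefore the same measure (\<open>tep_measure_invariant\<close>).

  Validity of a pattern is decidable from the word problem and the description of the
  constraints, and a convex set covering a given finite set can be found by searching the
  enumeration of the convexoid. As the enumerating program may diverge, the search runs over its
  evaluations with bounded resources (\<open>fuel_bounded_evaluation\<close>). On a covering convex set \<open>D\<close>, a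
  pattern belongs to the language iff it has a valid extension to \<open>D\<close>, and its measure is the
  proportion of the valid patterns on \<open>D\<close> that extend it, a rational number obtained by counting.

  The random choices above are made by rejection sampling: fair coins are read as a
  number, which is accepted if it is the code of a valid extension and is drawn afresh otherwise.
  So the same random configuration serves for the existence of the measure and, along a computable
  exhaustion, for perfect sampling (\<open>sampled_perfectly_tep_measure\<close>).
\<close>

section \<open>Total recursive functions\<close>

abbreviation pfst :: "nat \<Rightarrow> nat" where "pfst n \<equiv> fst (prod_decode n)"
abbreviation psnd :: "nat \<Rightarrow> nat" where "psnd n \<equiv> snd (prod_decode n)"

text \<open>
  Algorithms are composed here from total functions wherever that is possible, so that divergence
  has to be considered only in the few places where a search may fail. A function of several
  arguments is a function of the number coding the tuple of its arguments.
\<close>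

definition recursive_in ::
    "('w \<Rightarrow> nat \<Rightarrow> nat option) set \<Rightarrow> ('w \<Rightarrow> nat \<Rightarrow> nat) \<Rightarrow> bool" where
  "recursive_in Q f \<longleftrightarrow> partial_recursive_in Q (\<lambda>\<omega> n. Some (f \<omega> n))"

definition decidable_in ::
    "('w \<Rightarrow> nat \<Rightarrow> nat option) set \<Rightarrow> ('w \<Rightarrow> nat \<Rightarrow> bool) \<Rightarrow> bool" where
  "decidable_in Q P \<longleftrightarrow> recursive_in Q (\<lambda>\<omega> n. of_bool (P \<omega> n))"

text \<open>
  Used backwards, these rules reduce the computability of an expression to that of its parts.
  An expression with a bound variable (of a recursion, a sum, a quantifier) becomes, in the premise
  of its rule, a function of a pair: the first component is the surrounding argument, the second
  one the bound variable.
\<close>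

named_theorems rec_intros

lemma recursive_compose:
  assumes "recursive_in Q f" "recursive_in Q g"
  shows "recursive_in Q (\<lambda>\<omega> n. f \<omega> (g \<omega> n))"
  using partial_recursive_in.comp[of Q "\<lambda>\<omega> n. Some (f \<omega> n)" "\<lambda>\<omega> n. Some (g \<omega> n)"] assms
  by (simp add: recursive_in_def)

lemma recursive_id [rec_intros]: "recursive_in Q (\<lambda>\<omega> n. n)"
  using partial_recursive_in.pair[OF partial_recursive_in.left partial_recursive_in.right, of Q]
  by (simp add: recursive_in_def)

lemma recursive_Suc [rec_intros]:
  "recursive_in Q f \<Longrightarrow> recursive_in Q (\<lambda>\<omega> n. Suc (f \<omega> n))"
  using recursive_compose[of Q "\<lambda>\<omega>. Suc"] partial_recursive_in.succ[of Q]
  by (simp add: recursive_in_def)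

lemma recursive_pfst [rec_intros]:
  "recursive_in Q f \<Longrightarrow> recursive_in Q (\<lambda>\<omega> n. pfst (f \<omega> n))"
  using recursive_compose[of Q "\<lambda>\<omega> n. pfst n"] partial_recursive_in.left[of Q]
  by (simp add: recursive_in_def)

lemma recursive_psnd [rec_intros]:
  "recursive_in Q f \<Longrightarrow> recursive_in Q (\<lambda>\<omega> n. psnd (f \<omega> n))"
  using recursive_compose[of Q "\<lambda>\<omega> n. psnd n"] partial_recursive_in.right[of Q]
  by (simp add: recursive_in_def)

lemma recursive_pair [rec_intros]:
  "recursive_in Q f \<Longrightarrow> recursive_in Q g \<Longrightarrow>
    recursive_in Q (\<lambda>\<omega> n. prod_encode (f \<omega> n, g \<omega> n))"
  using partial_recursive_in.pair[of Q "\<lambda>\<omega> n. Some (f \<omega> n)" "\<lambda>\<omega> n. Some (g \<omega> n)"]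
  by (simp add: recursive_in_def)

lemma recursive_const [rec_intros]: "recursive_in Q (\<lambda>\<omega> n. c)"
proof (induction c)
  case 0
  show ?case using partial_recursive_in.zero[of Q] by (simp add: recursive_in_def)
next
  case (Suc c)
  then show ?case by (rule recursive_Suc)
qed

lemma recursive_rec_nat [rec_intros]:
  assumes "recursive_in Q f"
    and "recursive_in Q (\<lambda>\<omega> p. h \<omega> (pfst p) (pfst (psnd p)) (psnd (psnd p)))"
    and "recursive_in Q b"
  shows "recursive_in Q (\<lambda>\<omega> n. rec_nat (f \<omega> n) (h \<omega> n) (b \<omega> n))"
proof -
  have total: "rec_nat (Some (f \<omega> a))
      (\<lambda>y r. Option.bind r (\<lambda>i. Some (h \<omega> a y i))) m = Some (rec_nat (f \<omega> a) (h \<omega> a) m)" for \<omega> a m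
    by (induction m) auto
  have "recursive_in Q (\<lambda>\<omega> p. rec_nat (f \<omega> (pfst p)) (h \<omega> (pfst p)) (psnd p))"
    using partial_recursive_in.prim_rec[OF assms(1,2)[unfolded recursive_in_def]]
    by (simp add: recursive_in_def case_prod_unfold total)
  then have "recursive_in Q (\<lambda>\<omega> n. (\<lambda>\<omega> p. rec_nat (f \<omega> (pfst p)) (h \<omega> (pfst p)) (psnd p)) \<omega>
      (prod_encode (n, b \<omega> n)))"
    by (rule recursive_compose) (intro rec_intros assms)
  then show ?thesis by simp
qed

lemma recursive_add [rec_intros]:
  assumes "recursive_in Q f" "recursive_in Q g"
  shows "recursive_in Q (\<lambda>\<omega> n. f \<omega> n + g \<omega> n)"
proof -
  have "rec_nat a (\<lambda>_ r. Suc r) b = a + b" for a b :: nat by (induction b) auto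
  moreover have "recursive_in Q (\<lambda>\<omega> n. rec_nat (f \<omega> n) (\<lambda>_ r. Suc r) (g \<omega> n))"
    by (intro rec_intros assms)
  ultimately show ?thesis by simp
qed

lemma recursive_diff [rec_intros]:
  assumes "recursive_in Q f" "recursive_in Q g"
  shows "recursive_in Q (\<lambda>\<omega> n. f \<omega> n - g \<omega> n)"
proof -
  have pred: "rec_nat 0 (\<lambda>y _. y) r = r - 1" for r :: nat by (cases r) auto
  have "rec_nat a (\<lambda>_ r. rec_nat 0 (\<lambda>y _. y) r) b = a - b" for a b :: nat
    by (induction b) (auto simp: pred)
  moreover have "recursive_in Q (\<lambda>\<omega> n. rec_nat (f \<omega> n) (\<lambda>_ r. rec_nat 0 (\<lambda>y _. y) r) (g \<omega> n))"
    by (intro rec_intros assms)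
  ultimately show ?thesis by simp
qed

lemma recursive_mult [rec_intros]:
  assumes "recursive_in Q f" "recursive_in Q g"
  shows "recursive_in Q (\<lambda>\<omega> n. f \<omega> n * g \<omega> n)"
proof -
  have "rec_nat 0 (\<lambda>_ r. r + a) b = a * b" for a b :: nat by (induction b) auto
  moreover have "recursive_in Q (\<lambda>\<omega> n. rec_nat 0 (\<lambda>_ r. r + f \<omega> n) (g \<omega> n))"
    by (intro rec_intros recursive_compose[OF assms(1)] assms)
  ultimately show ?thesis by simp
qed

lemma recursive_power [rec_intros]:
  assumes "recursive_in Q f" "recursive_in Q g"
  shows "recursive_in Q (\<lambda>\<omega> n. f \<omega> n ^ g \<omega> n)"
proof -
  have "rec_nat 1 (\<lambda>_ r. r * a) b = a ^ b" for a b :: nat by (induction b) auto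
  moreover have "recursive_in Q (\<lambda>\<omega> n. rec_nat 1 (\<lambda>_ r. r * f \<omega> n) (g \<omega> n))"
    by (intro rec_intros recursive_compose[OF assms(1)] assms)
  ultimately show ?thesis by simp
qed

lemma recursive_sum [rec_intros]:
  assumes "recursive_in Q (\<lambda>\<omega> p. f \<omega> (pfst p) (psnd p))" "recursive_in Q b"
  shows "recursive_in Q (\<lambda>\<omega> n. \<Sum>i<b \<omega> n. f \<omega> n i)"
proof -
  have "rec_nat 0 (\<lambda>y r. r + u y) m = (\<Sum>i<m. u i)" for u :: "nat \<Rightarrow> nat" and m
    by (induction m) auto
  moreover have "recursive_in Q (\<lambda>\<omega> p. f \<omega> (pfst p) (pfst (psnd p)))"
    using recursive_compose[OF assms(1), of "\<lambda>\<omega> p. prod_encode (pfst p, pfst (psnd p))"]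
    by (simp add: rec_intros)
  then have "recursive_in Q (\<lambda>\<omega> n. rec_nat 0 (\<lambda>y r. r + f \<omega> n y) (b \<omega> n))"
    by (intro rec_intros assms)
  ultimately show ?thesis by simp
qed

lemma decidable_conj [rec_intros]:
  assumes "decidable_in Q P" "decidable_in Q R"
  shows "decidable_in Q (\<lambda>\<omega> n. P \<omega> n \<and> R \<omega> n)"
  using assms unfolding decidable_in_def of_bool_conj by (intro rec_intros)

lemma decidable_not [rec_intros]:
  assumes "decidable_in Q P"
  shows "decidable_in Q (\<lambda>\<omega> n. \<not> P \<omega> n)"
proof -
  have "recursive_in Q (\<lambda>\<omega> n. 1 - of_bool (P \<omega> n))"
    using assms unfolding decidable_in_def by (intro rec_intros)
  moreover have "(of_bool (\<not> b) :: nat) = 1 - of_bool b" for b by simp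
  ultimately show ?thesis unfolding decidable_in_def by simp
qed

lemma decidable_disj [rec_intros]:
  assumes "decidable_in Q P" "decidable_in Q R"
  shows "decidable_in Q (\<lambda>\<omega> n. P \<omega> n \<or> R \<omega> n)"
proof -
  have "decidable_in Q (\<lambda>\<omega> n. \<not> (\<not> P \<omega> n \<and> \<not> R \<omega> n))"
    by (intro decidable_not decidable_conj assms)
  then show ?thesis by simp
qed

lemma decidable_imp [rec_intros]:
  assumes "decidable_in Q P" "decidable_in Q R"
  shows "decidable_in Q (\<lambda>\<omega> n. P \<omega> n \<longrightarrow> R \<omega> n)"
proof -
  have "decidable_in Q (\<lambda>\<omega> n. \<not> P \<omega> n \<or> R \<omega> n)"
    by (intro decidable_not decidable_disj assms)
  then show ?thesis by (simp only: imp_conv_disj)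
qed

lemma decidable_le [rec_intros]:
  assumes "recursive_in Q f" "recursive_in Q g"
  shows "decidable_in Q (\<lambda>\<omega> n. f \<omega> n \<le> g \<omega> n)"
proof -
  have "recursive_in Q (\<lambda>\<omega> n. 1 - (f \<omega> n - g \<omega> n))"
    by (intro rec_intros assms)
  moreover have "(of_bool (a \<le> b) :: nat) = 1 - (a - b)" for a b :: nat by simp
  ultimately show ?thesis unfolding decidable_in_def by presburger
qed

lemma decidable_less [rec_intros]:
  assumes "recursive_in Q f" "recursive_in Q g"
  shows "decidable_in Q (\<lambda>\<omega> n. f \<omega> n < g \<omega> n)"
  using decidable_not[OF decidable_le[OF assms(2,1)]] by (simp add: not_le)

lemma decidable_eq [rec_intros]:
  assumes "recursive_in Q f" "recursive_in Q g"
  shows "decidable_in Q (\<lambda>\<omega> n. f \<omega> n = g \<omega> n)"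
proof -
  have "decidable_in Q (\<lambda>\<omega> n. f \<omega> n \<le> g \<omega> n \<and> g \<omega> n \<le> f \<omega> n)"
    by (intro decidable_conj decidable_le assms)
  also have "(\<lambda>\<omega> n. f \<omega> n \<le> g \<omega> n \<and> g \<omega> n \<le> f \<omega> n) = (\<lambda>\<omega> n. f \<omega> n = g \<omega> n)"
    by (intro ext) linarith
  finally show ?thesis .
qed

lemma decidable_compose:
  assumes "decidable_in Q P" "recursive_in Q g"
  shows "decidable_in Q (\<lambda>\<omega> n. P \<omega> (g \<omega> n))"
  using recursive_compose[OF assms(1)[unfolded decidable_in_def] assms(2)]
  unfolding decidable_in_def .

lemma decidable_bex [rec_intros]:
  assumes "decidable_in Q (\<lambda>\<omega> p. P \<omega> (pfst p) (psnd p))" "recursive_in Q b"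
  shows "decidable_in Q (\<lambda>\<omega> n. \<exists>i<b \<omega> n. P \<omega> n i)"
proof -
  have "recursive_in Q (\<lambda>\<omega> n. \<Sum>i<b \<omega> n. of_bool (P \<omega> n i))"
    using assms unfolding decidable_in_def by (intro rec_intros)
  then have "decidable_in Q (\<lambda>\<omega> n. 0 < (\<Sum>i<b \<omega> n. of_bool (P \<omega> n i) :: nat))"
    by (intro decidable_less recursive_const)
  moreover have "0 < (\<Sum>i<m. of_bool (R i) :: nat) \<longleftrightarrow> (\<exists>i<m. R i)" for m :: nat and R
    by (induction m) (auto simp: less_Suc_eq)
  ultimately show ?thesis by simp
qed

lemma decidable_ball [rec_intros]:
  assumes "decidable_in Q (\<lambda>\<omega> p. P \<omega> (pfst p) (psnd p))" "recursive_in Q b"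
  shows "decidable_in Q (\<lambda>\<omega> n. \<forall>i<b \<omega> n. P \<omega> n i)"
proof -
  have "decidable_in Q (\<lambda>\<omega> n. \<not> (\<exists>i<b \<omega> n. \<not> P \<omega> n i))"
    by (intro decidable_not decidable_bex assms)
  then show ?thesis by simp
qed

lemma recursive_of_bool [rec_intros]:
  "decidable_in Q P \<Longrightarrow> recursive_in Q (\<lambda>\<omega> n. of_bool (P \<omega> n))"
  by (simp add: decidable_in_def)

lemma recursive_if [rec_intros]:
  assumes "decidable_in Q P" "recursive_in Q f" "recursive_in Q g"
  shows "recursive_in Q (\<lambda>\<omega> n. if P \<omega> n then f \<omega> n else g \<omega> n)"
proof -
  have "recursive_in Q (\<lambda>\<omega> n. of_bool (P \<omega> n) * f \<omega> n + of_bool (\<not> P \<omega> n) * g \<omega> n)"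
    by (intro rec_intros assms)
  moreover have "(if b then x else y) = of_bool b * x + of_bool (\<not> b) * y" for b and x y :: nat
    by simp
  ultimately show ?thesis by presburger
qed

text \<open>
  The binary digit \<open>i\<close> of \<open>s\<close> is the parity of \<open>s div 2 ^ i\<close>. The quotient is a bounded sum that
  counts the positive multiples of \<open>2 ^ i\<close> up to \<open>s\<close>, and the parity is a recursion that flips
  between 0 and 1.
\<close>

lemma decidable_elem_set_decode [rec_intros]:
  assumes "recursive_in Q f" "recursive_in Q g"
  shows "decidable_in Q (\<lambda>\<omega> n. f \<omega> n \<in> set_decode (g \<omega> n))"
proof -
  have count: "(\<Sum>i<x. of_bool (Suc i * y \<le> x)) = x div y" if "0 < y" for x y :: nat
  proof -
    have "(\<Sum>i<x. of_bool (Suc i * y \<le> x)) = card {i. i < x \<and> Suc i * y \<le> x}"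
      by (simp add: of_bool_def sum.If_cases Collect_conj_eq lessThan_def)
    also have "{i. i < x \<and> Suc i * y \<le> x} = {..<x div y}"
    proof -
      have "Suc i * y \<le> x \<longleftrightarrow> i < x div y" for i
        using less_eq_div_iff_mult_less_eq[OF that, of "Suc i" x] by (simp add: Suc_le_eq)
      moreover have "i < x" if "i < x div y" for i
        using that div_le_dividend[of x y] by linarith
      ultimately show ?thesis by auto
    qed
    finally show ?thesis by simp
  qed
  have parity: "rec_nat 0 (\<lambda>_ r. 1 - r) m = (of_bool (odd m) :: nat)" for m :: nat
    by (induction m) auto
  have "recursive_in Q (\<lambda>\<omega> n. rec_nat 0 (\<lambda>_ r. 1 - r)
      (\<Sum>i<g \<omega> n. of_bool (Suc i * 2 ^ f \<omega> n \<le> g \<omega> n)))"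
    by (intro rec_intros recursive_compose[OF assms(1)] recursive_compose[OF assms(2)] assms)
  then show ?thesis
    by (simp only: count[OF zero_less_power[OF zero_less_numeral]] parity decidable_in_def
        set_decode_def mem_Collect_eq)
qed

text \<open>
  This bound turns a quantifier over a coded finite set into a bounded quantifier.
\<close>

lemma elem_set_decode_less: "i \<in> set_decode s \<Longrightarrow> i < s"
proof -
  assume "i \<in> set_decode s"
  then have "2 ^ i \<le> s"
    unfolding set_decode_def by (cases "s < 2 ^ i") auto
  then show "i < s" using less_exp[of i] by linarith
qed

lemma Ball_set_decode: "(\<forall>i\<in>set_decode s. P i) \<longleftrightarrow> (\<forall>i<s. i \<in> set_decode s \<longrightarrow> P i)"
  using elem_set_decode_less by blast

lemma Bex_set_decode: "(\<exists>i\<in>set_decode s. P i) \<longleftrightarrow> (\<exists>i<s. i \<in> set_decode s \<and> P i)"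
  using elem_set_decode_less by blast

lemma decidable_Ball_set_decode [rec_intros]:
  assumes "decidable_in Q (\<lambda>\<omega> p. P \<omega> (pfst p) (psnd p))" "recursive_in Q b"
  shows "decidable_in Q (\<lambda>\<omega> n. \<forall>i\<in>set_decode (b \<omega> n). P \<omega> n i)"
  unfolding Ball_set_decode
  by (intro rec_intros recursive_compose[OF assms(2)] assms)

lemma decidable_Bex_set_decode [rec_intros]:
  assumes "decidable_in Q (\<lambda>\<omega> p. P \<omega> (pfst p) (psnd p))" "recursive_in Q b"
  shows "decidable_in Q (\<lambda>\<omega> n. \<exists>i\<in>set_decode (b \<omega> n). P \<omega> n i)"
  unfolding Bex_set_decode
  by (intro rec_intros recursive_compose[OF assms(2)] assms)

text \<open>
  Minimization looks for a zero, so it is applied to the characteristic function of the negation.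
\<close>

lemma partial_recursive_Least:
  assumes "decidable_in Q (\<lambda>\<omega> p. P \<omega> (pfst p) (psnd p))"
  shows "partial_recursive_in Q (\<lambda>\<omega> n. if \<exists>t. P \<omega> n t then Some (LEAST t. P \<omega> n t) else None)"
proof -
  have "recursive_in Q (\<lambda>\<omega> p. of_bool (\<not> P \<omega> (pfst p) (psnd p)))"
    by (intro rec_intros assms)
  then have "partial_recursive_in Q (\<lambda>\<omega> a. minimize
      (\<lambda>n. Some (of_bool (\<not> P \<omega> (pfst (prod_encode (a, n))) (psnd (prod_encode (a, n)))))))"
    unfolding recursive_in_def by (rule partial_recursive_in.mu)
  moreover have "(Some (of_bool (\<not> b) :: nat) = Some 0) = b" for b by simp
  then have "minimize (\<lambda>n. Some (of_bool (\<not> R n))) = (if \<exists>t. R t then Some (LEAST t. R t) else None)" for R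
    unfolding minimize_def by simp
  ultimately show ?thesis by simp
qed

lemma recursive_Least:
  assumes "decidable_in Q (\<lambda>\<omega> p. P \<omega> (pfst p) (psnd p))" "\<And>\<omega> n. \<exists>t. P \<omega> n t"
  shows "recursive_in Q (\<lambda>\<omega> n. LEAST t. P \<omega> n t)"
  using partial_recursive_Least[OF assms(1)] assms(2) unfolding recursive_in_def by simp

lemma partial_recursive_bind:
  assumes "partial_recursive_in Q F" "partial_recursive_in Q (\<lambda>\<omega> p. H \<omega> (pfst p) (psnd p))"
  shows "partial_recursive_in Q (\<lambda>\<omega> n. Option.bind (F \<omega> n) (H \<omega> n))"
proof -
  have "partial_recursive_in Q (\<lambda>\<omega> n. Some n)" using recursive_id unfolding recursive_in_def .
  from partial_recursive_in.comp[OF assms(2) partial_recursive_in.pair[OF this assms(1)]]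
  show ?thesis by (simp add: Option.bind_assoc)
qed

text \<open>
  A search for a \<open>t\<close> on which the condition does not depend diverges exactly when the condition
  fails.
\<close>

lemma partial_recursive_guard:
  assumes "decidable_in Q P" "recursive_in Q f"
  shows "partial_recursive_in Q (\<lambda>\<omega> n. if P \<omega> n then Some (f \<omega> n) else None)"
proof -
  have "partial_recursive_in Q (\<lambda>\<omega> n. if \<exists>t::nat. P \<omega> n then Some (LEAST t::nat. P \<omega> n) else None)"
    by (intro partial_recursive_Least decidable_compose[OF assms(1)] recursive_pfst recursive_id)
  moreover have "partial_recursive_in Q (\<lambda>\<omega> p. Some (f \<omega> (pfst p)))"
    using recursive_compose[OF assms(2) recursive_pfst[OF recursive_id]] unfolding recursive_in_def .
  ultimately have "partial_recursive_in Q (\<lambda>\<omega> n. Option.bind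
      (if \<exists>t::nat. P \<omega> n then Some (LEAST t::nat. P \<omega> n) else None) (\<lambda>_. Some (f \<omega> n)))"
    by (rule partial_recursive_bind)
  moreover have "Option.bind (if \<exists>t::nat. P \<omega> n then Some (LEAST t::nat. P \<omega> n) else None) (\<lambda>_. Some (f \<omega> n)) =
      (if P \<omega> n then Some (f \<omega> n) else None)" for \<omega> n
    by simp
  ultimately show ?thesis by simp
qed

text \<open>
  A program without queries runs unchanged in the presence of an external source. This moves the
  functions computed on codes of group elements into the sampling algorithm.
\<close>

lemma partial_recursive_in_lift:
  assumes "partial_recursive_in {} F"
  shows "partial_recursive_in Q (\<lambda>\<omega>. F ())"
  using assms by (induction rule: partial_recursive_in.induct) (auto intro: partial_recursive_in.intros)

lemma recursive_in_lift:
  assumes "partial_recursive (\<lambda>n. Some (f n))"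
  shows "recursive_in Q (\<lambda>\<omega>. f)"
  using partial_recursive_in_lift[of "\<lambda>_ n. Some (f n)"] assms
  by (simp add: recursive_in_def partial_recursive_def)

lemma decidable_set_lift:
  assumes "decidable_set M"
  shows "decidable_in Q (\<lambda>\<omega> n. n \<in> M)"
proof -
  obtain f where "partial_recursive f" "decides f M"
    using assms unfolding decidable_set_def by blast
  moreover from \<open>decides f M\<close> have "f = (\<lambda>n. Some (of_bool (n \<in> M)))"
    by (auto simp: decides_def fun_eq_iff)
  ultimately show ?thesis unfolding decidable_in_def
    using recursive_in_lift[of "\<lambda>n. of_bool (n \<in> M)"] by simp
qed

text \<open>
  The programs for the group operations may diverge on numbers that are not codes. Since a case
  distinction between two programs would run both of them, the case distinction is made on the
  argument: outside of \<open>P\<close> the program is run on the fixed argument \<open>m\<close> instead.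
\<close>

lemma total_extension:
  assumes f: "partial_recursive f" and M: "decidable_in {} (\<lambda>_::unit. P)" and "P m"
    and def: "\<And>n. P n \<Longrightarrow> f n = Some (v n)"
  obtains g where "partial_recursive (\<lambda>n. Some (g n))" "\<And>n. P n \<Longrightarrow> g n = v n"
proof
  let ?g = "\<lambda>n. v (if P n then n else m)"
  have "recursive_in {} (\<lambda>_::unit. \<lambda>n. if P n then n else m)"
    by (intro rec_intros) (rule M)
  then have "partial_recursive_in {} (\<lambda>\<omega>::unit. \<lambda>n. Option.bind (Some (if P n then n else m)) f)"
    using f partial_recursive_in.comp unfolding partial_recursive_def recursive_in_def by blast
  also have "(\<lambda>\<omega>::unit. \<lambda>n. Option.bind (Some (if P n then n else m)) f) = (\<lambda>_ n. Some (?g n))"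
    using def \<open>P m\<close> by (auto simp: fun_eq_iff)
  finally show "partial_recursive (\<lambda>n. Some (?g n))"
    by (simp add: partial_recursive_def)
qed simp

section \<open>Bounded evaluation of partial recursive functions\<close>

text \<open>
  Each partial recursive \<open>F\<close> is the limit of total approximations \<open>T n t\<close>: the fuel \<open>t\<close> bounds the
  range of every minimization in the program, the value \<open>0\<close> means that the fuel did not suffice,
  and \<open>Suc v\<close> that the result is \<open>v\<close>. The approximation is defined along the derivation of \<open>F\<close>, with
  the same \<open>t\<close> for all subprograms. Completeness for all large \<open>t\<close>, and not just for some \<open>t\<close>, is
  what allows the results of several subprograms to be combined.
\<close>

lemma fuel_bounded_evaluation:
  assumes "partial_recursive_in {} (F :: unit \<Rightarrow> nat \<Rightarrow> nat option)"
  shows "\<exists>T. recursive_in {} (\<lambda>_::unit. \<lambda>p. T (pfst p) (psnd p)) \<and>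
    (\<forall>n t v. T n t = Suc v \<longrightarrow> F () n = Some v) \<and>
    (\<forall>n v. F () n = Some v \<longrightarrow> (\<forall>\<^sub>F t in sequentially. T n t = Suc v))"
  using assms
proof (induction rule: partial_recursive_in.induct)
  case (basic F)
  then show ?case by simp
next
  case zero
  show ?case by (rule exI[of _ "\<lambda>n t. 1"]) (simp add: rec_intros)
next
  case succ
  show ?case by (rule exI[of _ "\<lambda>n t. Suc (Suc n)"]) (simp add: rec_intros)
next
  case left
  show ?case by (rule exI[of _ "\<lambda>n t. Suc (pfst n)"]) (simp add: rec_intros)
next
  case right
  show ?case by (rule exI[of _ "\<lambda>n t. Suc (psnd n)"]) (simp add: rec_intros)
next
  case (pair F H)
  from pair.IH obtain TF TH where T:
    "recursive_in {} (\<lambda>_::unit. \<lambda>p. TF (pfst p) (psnd p))"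
    "recursive_in {} (\<lambda>_::unit. \<lambda>p. TH (pfst p) (psnd p))"
    and sound: "\<And>n t v. TF n t = Suc v \<Longrightarrow> F () n = Some v" "\<And>n t v. TH n t = Suc v \<Longrightarrow> H () n = Some v"
    and complete: "\<And>n v. F () n = Some v \<Longrightarrow> \<forall>\<^sub>F t in sequentially. TF n t = Suc v"
      "\<And>n v. H () n = Some v \<Longrightarrow> \<forall>\<^sub>F t in sequentially. TH n t = Suc v"
    by blast
  let ?T = "\<lambda>n t. if TF n t = 0 \<or> TH n t = 0 then 0 else Suc (prod_encode (TF n t - 1, TH n t - 1))"
  show ?case
  proof (intro exI[of _ ?T] conjI allI impI)
    show "recursive_in {} (\<lambda>_::unit. \<lambda>p. ?T (pfst p) (psnd p))"
      by (intro rec_intros T)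
  next
    fix n t v assume *: "?T n t = Suc v"
    then obtain a b where "TF n t = Suc a" "TH n t = Suc b"
      by (auto simp: not0_implies_Suc gr0_conv_Suc split: if_splits)
    with * sound show "Option.bind (F () n) (\<lambda>a. Option.bind (H () n) (\<lambda>b. Some (prod_encode (a, b)))) = Some v"
      by auto
  next
    fix n v assume "Option.bind (F () n) (\<lambda>a. Option.bind (H () n) (\<lambda>b. Some (prod_encode (a, b)))) = Some v"
    then obtain a b where ab: "F () n = Some a" "H () n = Some b" "v = prod_encode (a, b)"
      by (auto simp: bind_eq_Some_conv)
    with eventually_conj[OF complete(1)[OF ab(1)] complete(2)[OF ab(2)]]
    show "\<forall>\<^sub>F t in sequentially. ?T n t = Suc v"
      by (auto elim!: eventually_mono)
  qed
next
  case (comp F H)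
  from comp.IH obtain TF TH where T:
    "recursive_in {} (\<lambda>_::unit. \<lambda>p. TF (pfst p) (psnd p))"
    "recursive_in {} (\<lambda>_::unit. \<lambda>p. TH (pfst p) (psnd p))"
    and sound: "\<And>n t v. TF n t = Suc v \<Longrightarrow> F () n = Some v" "\<And>n t v. TH n t = Suc v \<Longrightarrow> H () n = Some v"
    and complete: "\<And>n v. F () n = Some v \<Longrightarrow> \<forall>\<^sub>F t in sequentially. TF n t = Suc v"
      "\<And>n v. H () n = Some v \<Longrightarrow> \<forall>\<^sub>F t in sequentially. TH n t = Suc v"
    by blast
  let ?T = "\<lambda>n t. if TH n t = 0 then 0 else TF (TH n t - 1) t"
  show ?case
  proof (intro exI[of _ ?T] conjI allI impI)
    have "recursive_in {} (\<lambda>_::unit. \<lambda>p. TF (TH (pfst p) (psnd p) - 1) (psnd p))"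
      using recursive_compose[OF T(1), of "\<lambda>_ p. prod_encode (TH (pfst p) (psnd p) - 1, psnd p)"]
      by (simp add: rec_intros T)
    then show "recursive_in {} (\<lambda>_::unit. \<lambda>p. ?T (pfst p) (psnd p))"
      by (intro rec_intros T)
  next
    fix n t v assume *: "?T n t = Suc v"
    then obtain b where "TH n t = Suc b"
      by (auto simp: not0_implies_Suc gr0_conv_Suc split: if_splits)
    with * sound show "Option.bind (H () n) (F ()) = Some v"
      by auto
  next
    fix n v assume "Option.bind (H () n) (F ()) = Some v"
    then obtain b where b: "H () n = Some b" "F () b = Some v"
      by (auto simp: bind_eq_Some_conv)
    from eventually_conj[OF complete(2)[OF b(1)] complete(1)[OF b(2)]]
    show "\<forall>\<^sub>F t in sequentially. ?T n t = Suc v"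
      by (auto elim!: eventually_mono)
  qed
next
  case (prim_rec F H)
  from prim_rec.IH obtain TF TH where T:
    "recursive_in {} (\<lambda>_::unit. \<lambda>p. TF (pfst p) (psnd p))"
    "recursive_in {} (\<lambda>_::unit. \<lambda>p. TH (pfst p) (psnd p))"
    and sound: "\<And>n t v. TF n t = Suc v \<Longrightarrow> F () n = Some v" "\<And>n t v. TH n t = Suc v \<Longrightarrow> H () n = Some v"
    and complete: "\<And>n v. F () n = Some v \<Longrightarrow> \<forall>\<^sub>F t in sequentially. TF n t = Suc v"
      "\<And>n v. H () n = Some v \<Longrightarrow> \<forall>\<^sub>F t in sequentially. TH n t = Suc v"
    by blast
  let ?R = "\<lambda>a m. rec_nat (F () a) (\<lambda>y r. Option.bind r (\<lambda>i. H () (prod_encode (a, prod_encode (y, i))))) m"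
  let ?S = "\<lambda>a t m. rec_nat (TF a t)
    (\<lambda>y r. if r = 0 then 0 else TH (prod_encode (a, prod_encode (y, r - 1))) t) m"
  let ?T = "\<lambda>n t. ?S (pfst n) t (psnd n)"
  have snd: "?R a m = Some v" if "?S a t m = Suc v" for a t m v
    using that
  proof (induction m arbitrary: v)
    case 0
    then show ?case using sound by simp
  next
    case (Suc m)
    then obtain r where r: "?S a t m = Suc r"
      by (cases "?S a t m") auto
    with Suc sound show ?case by auto
  qed
  have compl: "\<forall>\<^sub>F t in sequentially. ?S a t m = Suc v" if "?R a m = Some v" for a m v
    using that
  proof (induction m arbitrary: v)
    case 0
    then show ?case using complete by simp
  next
    case (Suc m)
    then obtain i where i: "?R a m = Some i" "H () (prod_encode (a, prod_encode (m, i))) = Some v"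
      by (auto simp: bind_eq_Some_conv)
    from eventually_conj[OF Suc.IH[OF i(1)] complete(2)[OF i(2)]]
    show ?case by (auto elim!: eventually_mono)
  qed
  show ?case
  proof (intro exI[of _ ?T] conjI allI impI)
    have *: "recursive_in {} (\<lambda>_::unit. \<lambda>p. TF (pfst (pfst p)) (psnd p))"
      using recursive_compose[OF T(1), of "\<lambda>_ p. prod_encode (pfst (pfst p), psnd p)"]
      by (simp add: rec_intros T)
    have **: "recursive_in {} (\<lambda>_::unit. \<lambda>p. TH (prod_encode (pfst (pfst (pfst p)),
       prod_encode (pfst (psnd p), psnd (psnd p) - 1))) (psnd (pfst p)))"
      using recursive_compose[OF T(2), of "\<lambda>_ p. prod_encode (prod_encode (pfst (pfst (pfst p)),
       prod_encode (pfst (psnd p), psnd (psnd p) - 1)), psnd (pfst p))"]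
      by (simp add: rec_intros T)
    show "recursive_in {} (\<lambda>_::unit. \<lambda>p. ?T (pfst p) (psnd p))"
      by (intro rec_intros * **)
  next
    fix n t v assume *: "?T n t = Suc v"
    with snd[OF *] show "(case prod_decode n of (a, m) \<Rightarrow> ?R a m) = Some v"
      by (simp add: case_prod_unfold)
  next
    fix n v assume "(case prod_decode n of (a, m) \<Rightarrow> ?R a m) = Some v"
    with compl show "\<forall>\<^sub>F t in sequentially. ?T n t = Suc v"
      by (simp add: case_prod_unfold)
  qed
next
  case (mu F)
  from mu.IH obtain TF where T:
    "recursive_in {} (\<lambda>_::unit. \<lambda>p. TF (pfst p) (psnd p))"
    and sound: "\<And>n t v. TF n t = Suc v \<Longrightarrow> F () n = Some v"
    and complete: "\<And>n v. F () n = Some v \<Longrightarrow> \<forall>\<^sub>F t in sequentially. TF n t = Suc v"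
    by blast
  \<comment> \<open>At most one \<open>n\<close> satisfies \<open>?c\<close>, so the sum has at most one summand that is not 0.\<close>
  let ?c = "\<lambda>a t n. TF (prod_encode (a, n)) t = 1 \<and> (\<forall>m<n. 1 < TF (prod_encode (a, m)) t)"
  let ?T = "\<lambda>a t. \<Sum>n<t. of_bool (?c a t n) * Suc n"
  have unique: "n' = n" if "?c a t n" "?c a t n'" for a t n n'
  proof (rule ccontr)
    assume "n' \<noteq> n"
    then consider "n' < n" | "n < n'" by linarith
    then show False using that by cases auto
  qed
  have T_eq: "?T a t = Suc n" if "?c a t n" "n < t" for a t n
  proof -
    have "of_bool (?c a t n') * Suc n' = (if n' = n then Suc n else 0)" for n'
    proof (cases "n' = n")
      case True
      with that(1) show ?thesis by (simp only: of_bool_eq) simp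
    next
      case False
      with unique[OF that(1)] have "\<not> ?c a t n'" by blast
      then have "(of_bool (?c a t n') :: nat) = 0" by (simp only: of_bool_eq)
      with False show ?thesis by simp
    qed
    then have "?T a t = (\<Sum>n'<t. if n' = n then Suc n else 0)" by (simp only:)
    then show ?thesis using that(2) by simp
  qed
  show ?case
  proof (intro exI[of _ ?T] conjI allI impI)
    have *: "recursive_in {} (\<lambda>_::unit. \<lambda>p. TF (prod_encode (pfst (pfst p), psnd p)) (psnd (pfst p)))"
      using recursive_compose[OF T(1), of "\<lambda>_ p. prod_encode (prod_encode (pfst (pfst p), psnd p), psnd (pfst p))"]
      by (simp add: rec_intros T)
    have **: "recursive_in {} (\<lambda>_::unit. \<lambda>p. TF (prod_encode (pfst (pfst (pfst p)), psnd p)) (psnd (pfst (pfst p))))"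
      using recursive_compose[OF T(1), of "\<lambda>_ p. prod_encode (prod_encode (pfst (pfst (pfst p)), psnd p), psnd (pfst (pfst p)))"]
      by (simp add: rec_intros T)
    show "recursive_in {} (\<lambda>_::unit. \<lambda>p. ?T (pfst p) (psnd p))"
      by (intro rec_intros * **)
  next
    fix a t v assume *: "?T a t = Suc v"
    have "\<exists>n<t. ?c a t n"
    proof (rule ccontr)
      assume none: "\<not> (\<exists>n<t. ?c a t n)"
      have "(of_bool (?c a t n) :: nat) = 0" if "n < t" for n
        using none that by (simp only: of_bool_eq_0_iff) blast
      then have "?T a t = (\<Sum>n<t. 0 * Suc n)" by (intro sum.cong refl) (simp only: lessThan_iff)
      with * show False by simp
    qed
    then obtain n where n: "n < t" "?c a t n" by blast
    then have v: "v = n" using * T_eq[OF n(2,1)] by simp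
    have "F () (prod_encode (a, n)) = Some 0" using n(2) by (intro sound[of _ t]) simp
    moreover have "\<exists>u. F () (prod_encode (a, m)) = Some (Suc u)" if "m < n" for m
    proof -
      have "1 < TF (prod_encode (a, m)) t" using n(2) that by blast
      then obtain u where "TF (prod_encode (a, m)) t = Suc (1 + u)"
        using less_imp_Suc_add by blast
      then have "TF (prod_encode (a, m)) t = Suc (Suc u)" by simp
      then show ?thesis using sound by blast
    qed
    then have "\<forall>m<n. F () (prod_encode (a, m)) \<noteq> None \<and> F () (prod_encode (a, m)) \<noteq> Some 0"
      by fastforce
    ultimately show "minimize (\<lambda>n. F () (prod_encode (a, n))) = Some v"
      unfolding minimize_def v by (auto intro!: Least_equality simp: not_less[symmetric])
  next
    fix a v assume min: "minimize (\<lambda>n. F () (prod_encode (a, n))) = Some v"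
    let ?h = "\<lambda>n. F () (prod_encode (a, n))"
    from min obtain n where n: "?h n = Some 0" "\<forall>m<n. ?h m \<noteq> None" "v = (LEAST n. ?h n = Some 0)"
      by (auto simp: minimize_def split: if_splits)
    have "?h v = Some 0" unfolding n(3) by (rule LeastI) (rule n(1))
    moreover have vn: "v \<le> n" unfolding n(3) by (rule Least_le) (rule n(1))
    moreover have "\<exists>u. ?h m = Some (Suc u)" if "m < v" for m
    proof -
      have "?h m \<noteq> Some 0" using that unfolding n(3) by (rule not_less_Least)
      moreover have "?h m \<noteq> None" using n(2) that vn by simp
      ultimately show ?thesis by (metis not0_implies_Suc option.exhaust)
    qed
    then have "\<forall>m\<in>{..<v}. \<forall>\<^sub>F t in sequentially. 1 < TF (prod_encode (a, m)) t"
      using complete by (fastforce elim: eventually_mono)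
    then have "\<forall>\<^sub>F t in sequentially. \<forall>m\<in>{..<v}. 1 < TF (prod_encode (a, m)) t"
      by (intro eventually_ball_finite) auto
    ultimately have "\<forall>\<^sub>F t in sequentially. (TF (prod_encode (a, v)) t = Suc 0 \<and>
        (\<forall>m\<in>{..<v}. 1 < TF (prod_encode (a, m)) t)) \<and> v < t"
      using complete eventually_gt_at_top by (intro eventually_conj) auto
    then show "\<forall>\<^sub>F t in sequentially. ?T a t = Suc v"
      by (rule eventually_mono) (use T_eq in auto)
  qed
qed

text \<open>
  Dovetailing: \<open>w\<close> ranges over the pairs of an argument and an amount of fuel. A recursively
  enumerable set thus becomes searchable by a total function, although the program that
  enumerates it may diverge on some arguments.
\<close>

lemma re_set_enumeration:
  assumes "re_set M"
  obtains T where "partial_recursive (\<lambda>n. Some (T n))"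
    "\<And>v. v \<in> M \<longleftrightarrow> (\<exists>w. T w = Suc v)"
proof -
  obtain f where f: "partial_recursive f" "M = ran f"
    using assms unfolding re_set_def by blast
  obtain T where T: "recursive_in {} (\<lambda>_::unit. \<lambda>p. T (pfst p) (psnd p))"
    "\<And>n t v. T n t = Suc v \<Longrightarrow> f n = Some v"
    "\<And>n v. f n = Some v \<Longrightarrow> \<forall>\<^sub>F t in sequentially. T n t = Suc v"
    using fuel_bounded_evaluation[OF f(1)[unfolded partial_recursive_def]] by auto
  show thesis
  proof
    show "partial_recursive (\<lambda>p. Some (T (pfst p) (psnd p)))"
      using T(1) by (simp add: partial_recursive_def recursive_in_def)
    show "v \<in> M \<longleftrightarrow> (\<exists>w. T (pfst w) (psnd w) = Suc v)" for v
    proof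
      assume "v \<in> M"
      then obtain n where "f n = Some v" using f(2) by (auto simp: ran_def)
      then obtain t where "T n t = Suc v"
        using T(3) by (meson eventually_happens sequentially_bot)
      then have "T (pfst (prod_encode (n, t))) (psnd (prod_encode (n, t))) = Suc v" by simp
      then show "\<exists>w. T (pfst w) (psnd w) = Suc v" by blast
    next
      assume "\<exists>w. T (pfst w) (psnd w) = Suc v"
      then show "v \<in> M" using T(2) f(2) by (auto simp: ran_def)
    qed
  qed
qed

section \<open>Rejection sampling\<close>

lemma space_coin_space [simp]: "space coin_space = UNIV"
  by (simp add: coin_space_def space_PiM)

lemma prob_space_coin_space: "prob_space coin_space"
  unfolding coin_space_def by (rule prob_space_PiM) (rule prob_space_measure_pmf)

interpretation coin: prob_space coin_space by (rule prob_space_coin_space)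

interpretation coin_product: product_prob_space "\<lambda>_. measure_pmf (bernoulli_pmf (1/2))" "UNIV :: nat set"
  by unfold_locales

lemma indep_vars_coins:
  "coin.indep_vars (\<lambda>_. measure_pmf (bernoulli_pmf (1/2))) (\<lambda>i \<omega>. \<omega> i) UNIV"
proof -
  have [measurable]: "(\<lambda>\<omega>. \<omega> i) \<in> measurable coin_space (measure_pmf (bernoulli_pmf (1/2)))" for i
    unfolding coin_space_def by measurable
  have "distr coin_space (measure_pmf (bernoulli_pmf (1/2))) (\<lambda>\<omega>. \<omega> i) = measure_pmf (bernoulli_pmf (1/2))" for i
    unfolding coin_space_def by (rule coin_product.PiM_component) simp
  moreover have "distr coin_space coin_space (\<lambda>\<omega>. \<omega>) = coin_space"
    by (rule distr_id)
  ultimately show ?thesis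
    by (subst coin.indep_vars_iff_distr_eq_PiM) (auto simp: coin_space_def restrict_UNIV)
qed

text \<open>
  The events whose occurrence is determined by the coins in \<open>I\<close>; events supported on disjoint sets
  of coins are independent.
\<close>

definition supported_on :: "nat set \<Rightarrow> (nat \<Rightarrow> bool) set \<Rightarrow> bool" where
  "supported_on I E \<longleftrightarrow> (\<forall>\<omega> \<omega>'. (\<forall>i\<in>I. \<omega> i = \<omega>' i) \<longrightarrow> \<omega> \<in> E \<longrightarrow> \<omega>' \<in> E)"

lemma measure_Int_disjoint_support:
  assumes E: "E \<in> sets coin_space" "supported_on I E"
    and F: "F \<in> sets coin_space" "supported_on J F" and disj: "I \<inter> J = {}"
  shows "measure coin_space (E \<inter> F) = measure coin_space E * measure coin_space F"
proof -
  let ?M = "\<lambda>_. measure_pmf (bernoulli_pmf (1/2))"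
  \<comment> \<open>An event supported on \<open>K\<close> can be read off the restriction to \<open>K\<close>, whatever the other coins are set to.\<close>
  let ?ext = "\<lambda>K y i. if i \<in> K then y i else False"
  have ext: "?ext K \<in> measurable (PiM K ?M) coin_space" for K :: "nat set"
    unfolding coin_space_def
  proof (rule measurable_PiM_single')
    show "(\<lambda>y. ?ext K y i) \<in> measurable (PiM K ?M) (?M i)" for i
      by (cases "i \<in> K") (simp_all add: measurable_component_singleton)
  qed auto
  have preimage: "(\<lambda>\<omega>. restrict (\<lambda>i. \<omega> i) K) -` (?ext K -` D \<inter> space (PiM K ?M)) \<inter> space coin_space = D"
    if "supported_on K D" for D K
  proof -
    have "?ext K (restrict \<omega> K) \<in> D \<longleftrightarrow> \<omega> \<in> D" for \<omega>
      using that unfolding supported_on_def by (metis (mono_tags, lifting) restrict_apply')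
    moreover have "restrict \<omega> K \<in> space (PiM K ?M)" for \<omega> by (simp add: space_PiM)
    ultimately show ?thesis
      by (simp only: set_eq_iff vimage_eq Int_iff space_coin_space UNIV_I simp_thms)
  qed
  have "coin.indep_var (PiM I ?M) (\<lambda>\<omega>. restrict (\<lambda>i. \<omega> i) I) (PiM J ?M) (\<lambda>\<omega>. restrict (\<lambda>i. \<omega> i) J)"
    by (rule coin.indep_var_restrict[OF indep_vars_coins disj]) auto
  from coin.indep_varD[OF this measurable_sets[OF ext E(1)] measurable_sets[OF ext F(1)]]
  have "measure coin_space ((\<lambda>\<omega>. (restrict \<omega> I, restrict \<omega> J)) -`
      ((?ext I -` E \<inter> space (PiM I ?M)) \<times> (?ext J -` F \<inter> space (PiM J ?M))) \<inter> space coin_space) =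
    measure coin_space E * measure coin_space F"
    unfolding preimage[OF E(2)] preimage[OF F(2)] .
  also have "(\<lambda>\<omega>. (restrict \<omega> I, restrict \<omega> J)) -`
      ((?ext I -` E \<inter> space (PiM I ?M)) \<times> (?ext J -` F \<inter> space (PiM J ?M))) \<inter> space coin_space =
    ((\<lambda>\<omega>. restrict (\<lambda>i. \<omega> i) I) -` (?ext I -` E \<inter> space (PiM I ?M)) \<inter> space coin_space) \<inter>
    ((\<lambda>\<omega>. restrict (\<lambda>i. \<omega> i) J) -` (?ext J -` F \<inter> space (PiM J ?M)) \<inter> space coin_space)"
    by blast
  finally show ?thesis unfolding preimage[OF E(2)] preimage[OF F(2)] .
qed

text \<open>
  In stage \<open>j\<close>, the attempt \<open>t\<close> reads \<open>m\<close> coins as the binary digits of a number below \<open>2 ^ m\<close>.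
  Distinct pairs of a stage and an attempt read distinct coins.
\<close>

definition draw :: "nat \<Rightarrow> (nat \<Rightarrow> bool) \<Rightarrow> nat \<Rightarrow> nat \<Rightarrow> nat" where
  "draw m \<omega> j t = set_encode {i. i < m \<and> \<omega> (prod_encode (j, prod_encode (t, i)))}"

text \<open>
  Rejection sampling from \<open>V\<close>: the first attempt that hits \<open>V\<close>. The default value keeps the function
  total; it is taken on a null event only.
\<close>

definition pick :: "nat \<Rightarrow> nat set \<Rightarrow> (nat \<Rightarrow> bool) \<Rightarrow> nat \<Rightarrow> nat" where
  "pick m V \<omega> j =
    (if \<exists>t. draw m \<omega> j t \<in> V then draw m \<omega> j (LEAST t. draw m \<omega> j t \<in> V) else (SOME v. v \<in> V))"

lemma set_decode_bounded: "v < 2 ^ m \<Longrightarrow> i \<in> set_decode v \<Longrightarrow> i < m"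
proof -
  assume "v < 2 ^ m" "i \<in> set_decode v"
  then have "2 ^ i \<le> v"
    unfolding set_decode_def by (cases "v < 2 ^ i") auto
  with \<open>v < 2 ^ m\<close> have "(2::nat) ^ i < 2 ^ m" by linarith
  then show "i < m" by simp
qed

lemma set_encode_less: "X \<subseteq> {..<m} \<Longrightarrow> set_encode X < 2 ^ m"
proof -
  assume "X \<subseteq> {..<m}"
  then have "set_encode X \<le> (\<Sum>i<m. 2 ^ i)"
    unfolding set_encode_def by (intro sum_mono2) auto
  also have "\<dots> < 2 ^ m" by (induction m) auto
  finally show ?thesis .
qed

lemma draw_less: "draw m \<omega> j t < 2 ^ m"
  unfolding draw_def by (rule set_encode_less) auto

lemma draw_eq_iff:
  assumes "v < 2 ^ m"
  shows "draw m \<omega> j t = v \<longleftrightarrow> (\<forall>i<m. \<omega> (prod_encode (j, prod_encode (t, i))) = (i \<in> set_decode v))"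
proof -
  have "draw m \<omega> j t = v \<longleftrightarrow> {i. i < m \<and> \<omega> (prod_encode (j, prod_encode (t, i)))} = set_decode v"
    unfolding draw_def using set_encode_eq[of _ "set_decode v"] by simp
  then show ?thesis using set_decode_bounded[OF assms] by blast
qed

lemma draw_event:
  "{\<omega>. draw m \<omega> j t = v} \<in> sets coin_space" (is ?meas)
  "v < 2 ^ m \<Longrightarrow> measure coin_space {\<omega>. draw m \<omega> j t = v} = 1 / 2 ^ m"
proof -
  let ?pos = "\<lambda>i. prod_encode (j, prod_encode (t, i))"
  let ?X = "\<lambda>p. {psnd (psnd p) \<in> set_decode v}"
  let ?J = "?pos ` {..<m}"
  have eq: "{\<omega>. draw m \<omega> j t = v} = {\<omega> \<in> space coin_space. \<forall>p\<in>?J. \<omega> p \<in> ?X p}" if "v < 2 ^ m"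
    using that by (auto simp: draw_eq_iff)
  show ?meas
  proof (cases "v < 2 ^ m")
    case True
    have "{\<omega> \<in> space coin_space. \<forall>p\<in>?J. \<omega> p \<in> ?X p} \<in> sets coin_space"
      unfolding coin_space_def
      by (intro sets.sets_Collect_finite_All finite_imageI finite_lessThan)
        (auto intro!: sets_Collect_single)
    then show ?thesis by (simp only: eq[OF True])
  next
    case False
    then have "{\<omega>. draw m \<omega> j t = v} = {}" using draw_less by blast
    then show ?thesis by simp
  qed
  assume v: "v < 2 ^ m"
  have "emeasure coin_space {\<omega> \<in> space coin_space. \<forall>p\<in>?J. \<omega> p \<in> ?X p} =
      (\<Prod>p\<in>?J. emeasure (measure_pmf (bernoulli_pmf (1/2))) (?X p))"
    unfolding coin_space_def by (rule coin_product.emeasure_PiM_Collect) auto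
  also have "\<dots> = (\<Prod>p\<in>?J. ennreal (1/2))"
    by (intro prod.cong refl) (auto simp: emeasure_pmf_single)
  also have "\<dots> = ennreal (1/2) ^ card ?J" by (rule prod_constant)
  also have "card ?J = m" by (simp add: card_image inj_on_def)
  also have "ennreal (1/2) ^ m = ennreal ((1/2) ^ m)" by (rule ennreal_power) simp
  finally show "measure coin_space {\<omega>. draw m \<omega> j t = v} = 1 / 2 ^ m"
    unfolding eq[OF v] measure_def by (simp add: power_divide)
qed

lemma draw_set_event [measurable]: "{\<omega>. draw m \<omega> j t \<in> V} \<in> sets coin_space"
proof -
  have "{\<omega>. draw m \<omega> j t \<in> V} = (\<Union>v\<in>V. {\<omega>. draw m \<omega> j t = v})" by auto
  then show ?thesis using draw_event(1) by (auto intro!: sets.countable_UN'')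
qed

lemma not_draw_set_event: "{\<omega>. draw m \<omega> j t \<notin> V} \<in> sets coin_space"
  using draw_set_event[of m j t "- V"] by simp

lemma rejections_event: "{\<omega>. \<forall>s<t. draw m \<omega> j s \<notin> V} \<in> sets coin_space"
proof -
  have "{\<omega>. \<forall>s<t. draw m \<omega> j s \<notin> V} = space coin_space - (\<Union>s<t. {\<omega>. draw m \<omega> j s \<in> V})" by auto
  then show ?thesis by (auto intro!: sets.finite_UN draw_set_event simp del: space_coin_space)
qed

lemma draw_cong:
  "(\<And>i. i < m \<Longrightarrow> \<omega> (prod_encode (j, prod_encode (t, i))) = \<omega>' (prod_encode (j, prod_encode (t, i)))) \<Longrightarrow>
    draw m \<omega> j t = draw m \<omega>' j t"
  unfolding draw_def by (rule arg_cong[where f = set_encode]) auto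

text \<open>
  A single attempt is accepted with probability \<open>q\<close>, and the attempts are independent.
\<close>

context
  fixes m :: nat and V :: "nat set" and q :: real
  assumes V: "V \<subseteq> {..<2 ^ m}" "V \<noteq> {}"
  defines "q \<equiv> card V / 2 ^ m"
begin

lemma finite_option_set: "finite V" using V finite_subset by blast

lemma acceptance_bounds: "0 < q" "q \<le> 1"
proof -
  show "0 < q" using V finite_option_set by (simp add: q_def card_gt_0_iff)
  have "card V \<le> 2 ^ m" using card_mono[OF _ V(1)] by simp
  then have "real (card V) \<le> real (2 ^ m)" by (rule of_nat_mono)
  then show "q \<le> 1" by (simp add: q_def)
qed

lemma measure_accept: "measure coin_space {\<omega>. draw m \<omega> j t \<in> V} = q"
proof -
  have "measure coin_space {\<omega>. draw m \<omega> j t \<in> V} = measure coin_space (\<Union>v\<in>V. {\<omega>. draw m \<omega> j t = v})"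
    by (rule arg_cong[where f = "measure coin_space"]) auto
  also have "\<dots> = (\<Sum>v\<in>V. measure coin_space {\<omega>. draw m \<omega> j t = v})"
    using finite_option_set by (intro coin.finite_measure_finite_Union)
      (auto simp: disjoint_family_on_def draw_event(1))
  also have "\<dots> = (\<Sum>v\<in>V. 1 / 2 ^ m)"
    using V by (intro sum.cong refl draw_event(2)) auto
  finally show ?thesis by (simp add: q_def)
qed

lemma measure_rejections_Int:
  assumes "F \<in> sets coin_space" "supported_on {p. pfst (psnd p) = t} F"
  shows "measure coin_space ({\<omega>. \<forall>s<t. draw m \<omega> j s \<notin> V} \<inter> F) =
    measure coin_space {\<omega>. \<forall>s<t. draw m \<omega> j s \<notin> V} * measure coin_space F"
proof (rule measure_Int_disjoint_support[OF rejections_event _ assms])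
  show "supported_on {p. pfst (psnd p) < t} {\<omega>. \<forall>s<t. draw m \<omega> j s \<notin> V}"
    unfolding supported_on_def
  proof clarsimp
    fix \<omega> \<omega>' s
    assume eq: "\<forall>i. pfst (psnd i) < t \<longrightarrow> \<omega> i = \<omega>' i" and "\<forall>s<t. draw m \<omega> j s \<notin> V" "s < t"
      and V: "draw m \<omega>' j s \<in> V"
    moreover have "draw m \<omega> j s = draw m \<omega>' j s"
      using eq \<open>s < t\<close> by (intro draw_cong) simp
    ultimately show False by metis
  qed
qed auto

lemma supported_on_draw: "supported_on {p. pfst (psnd p) = t} {\<omega>. draw m \<omega> j t \<in> W}"
  unfolding supported_on_def
proof clarsimp
  fix \<omega> \<omega>' :: "nat \<Rightarrow> bool"
  assume eq: "\<forall>i. pfst (psnd i) = t \<longrightarrow> \<omega> i = \<omega>' i" and W: "draw m \<omega> j t \<in> W"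
  have "draw m \<omega> j t = draw m \<omega>' j t" using eq by (intro draw_cong) simp
  with W show "draw m \<omega>' j t \<in> W" by simp
qed

lemma measure_rejections: "measure coin_space {\<omega>. \<forall>s<t. draw m \<omega> j s \<notin> V} = (1 - q) ^ t"
proof (induction t)
  case 0
  then show ?case using coin.prob_space by simp
next
  case (Suc t)
  have "{\<omega>. \<forall>s<Suc t. draw m \<omega> j s \<notin> V} = {\<omega>. \<forall>s<t. draw m \<omega> j s \<notin> V} \<inter> {\<omega>. draw m \<omega> j t \<in> - V}"
    by (auto simp: less_Suc_eq)
  moreover have "measure coin_space {\<omega>. draw m \<omega> j t \<in> - V} = 1 - q"
    using coin.prob_compl[OF draw_set_event[of m j t V]] measure_accept
    by (simp add: Compl_eq_Diff_UNIV[symmetric] Collect_neg_eq)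
  moreover have "measure coin_space ({\<omega>. \<forall>s<t. draw m \<omega> j s \<notin> V} \<inter> {\<omega>. draw m \<omega> j t \<in> - V}) =
      measure coin_space {\<omega>. \<forall>s<t. draw m \<omega> j s \<notin> V} * measure coin_space {\<omega>. draw m \<omega> j t \<in> - V}"
    by (rule measure_rejections_Int[OF draw_set_event supported_on_draw])
  ultimately show ?case using Suc by simp
qed

lemma rejected_forever_null: "{\<omega>. \<forall>t. draw m \<omega> j t \<notin> V} \<in> null_sets coin_space"
proof -
  let ?N = "{\<omega>. \<forall>t. draw m \<omega> j t \<notin> V}"
  have "?N = (\<Inter>t. {\<omega>. draw m \<omega> j t \<notin> V})" by auto
  then have N: "?N \<in> sets coin_space"
    using not_draw_set_event by (auto intro!: sets.countable_INT)
  have "measure coin_space ?N \<le> (1 - q) ^ t" for t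
    unfolding measure_rejections[of t j, symmetric]
    by (intro coin.finite_measure_mono rejections_event) auto
  moreover have "(\<lambda>t. (1 - q) ^ t) \<longlonglongrightarrow> 0"
    using acceptance_bounds by (intro LIMSEQ_power_zero) auto
  ultimately have "measure coin_space ?N \<le> 0"
    by (intro LIMSEQ_le_const) auto
  then have "measure coin_space ?N = 0" by (simp add: antisym)
  with N show ?thesis by (simp add: null_sets_def coin.emeasure_eq_measure)
qed

lemma AE_accepted: "AE \<omega> in coin_space. \<exists>t. draw m \<omega> j t \<in> V"
  using AE_not_in[OF rejected_forever_null[of j]] by eventually_elim simp

text \<open>
  The value \<open>v\<close> is the result iff for some \<open>t\<close> the first \<open>t\<close> attempts are rejected and the next one
  yields \<open>v\<close>. These events are disjoint and have the probabilities \<open>(1 - q) ^ t / 2 ^ m\<close>, whose sum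
  \<open>1 / (q * 2 ^ m)\<close> does not depend on \<open>v\<close>.
\<close>

lemma measure_pick:
  assumes "v \<in> V"
  shows "measure coin_space {\<omega>. pick m V \<omega> j = v} = 1 / card V"
    and "{\<omega>. pick m V \<omega> j = v} \<in> sets coin_space"
proof -
  let ?E = "\<lambda>t. {\<omega>. \<forall>s<t. draw m \<omega> j s \<notin> V} \<inter> {\<omega>. draw m \<omega> j t \<in> {v}}"
  let ?N = "{\<omega>. \<forall>t. draw m \<omega> j t \<notin> V}"
  \<comment> \<open>The default value contributes at most the null event that all attempts are rejected.\<close>
  let ?N' = "if (SOME v. v \<in> V) = v then ?N else {}"
  have N': "?N' \<in> null_sets coin_space" using rejected_forever_null by simp
  have accepted: "pick m V \<omega> j = v \<longleftrightarrow> \<omega> \<in> (\<Union>t. ?E t)" if "\<exists>t. draw m \<omega> j t \<in> V" for \<omega>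
  proof -
    let ?t = "LEAST t. draw m \<omega> j t \<in> V"
    have t: "draw m \<omega> j ?t \<in> V" "\<And>s. s < ?t \<Longrightarrow> draw m \<omega> j s \<notin> V"
      using that by (auto intro: LeastI_ex dest: not_less_Least)
    have "s = ?t" if "\<omega> \<in> ?E s" for s
    proof (cases s ?t rule: linorder_cases)
      case less
      have "draw m \<omega> j s = v" using that by simp
      with t(2)[OF less] assms show ?thesis by simp
    next
      case greater
      have "\<forall>u<s. draw m \<omega> j u \<notin> V" using that by simp
      with greater t(1) show ?thesis by blast
    qed
    moreover have "\<forall>s<?t. draw m \<omega> j s \<notin> V" using t(2) by blast
    then have "\<omega> \<in> ?E ?t \<longleftrightarrow> draw m \<omega> j ?t = v" by blast
    ultimately have "\<omega> \<in> (\<Union>t. ?E t) \<longleftrightarrow> draw m \<omega> j ?t = v" by blast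
    with that show ?thesis by (simp add: pick_def)
  qed
  have rejected: "pick m V \<omega> j = v \<longleftrightarrow> \<omega> \<in> ?N'" "\<omega> \<notin> (\<Union>t. ?E t)" if "\<not> (\<exists>t. draw m \<omega> j t \<in> V)" for \<omega>
    using that assms by (auto simp: pick_def)
  have split: "{\<omega>. pick m V \<omega> j = v} = (\<Union>t. ?E t) \<union> ?N'"
  proof (rule Set.set_eqI)
    fix \<omega> :: "nat \<Rightarrow> bool"
    show "\<omega> \<in> {\<omega>. pick m V \<omega> j = v} \<longleftrightarrow> \<omega> \<in> (\<Union>t. ?E t) \<union> ?N'"
    proof (cases "\<exists>t. draw m \<omega> j t \<in> V")
      case True
      then have "\<omega> \<notin> ?N'" by auto
      with accepted[OF True] show ?thesis by blast
    next
      case False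
      with rejected[OF False] show ?thesis by blast
    qed
  qed
  have E: "?E t \<in> sets coin_space" for t
    by (intro sets.Int rejections_event draw_set_event)
  have UE: "(\<Union>t. ?E t) \<in> sets coin_space"
    by (rule sets.countable_UN'') (simp_all only: E countableI_type)
  show "{\<omega>. pick m V \<omega> j = v} \<in> sets coin_space"
    unfolding split using UE null_setsD2[OF N'] by (rule sets.Un)
  have "v < 2 ^ m" using V assms by auto
  then have "measure coin_space {\<omega>. draw m \<omega> j t \<in> {v}} = 1 / 2 ^ m" for t
    using draw_event(2)[of v m j t] by simp
  then have "measure coin_space (?E t) = (1 - q) ^ t * (1 / 2 ^ m)" for t
    by (simp only: measure_rejections_Int[OF draw_set_event supported_on_draw] measure_rejections)
  moreover have "disjoint_family ?E"
  proof -
    have later: "?E s \<inter> ?E t = {}" if "s < t" for s t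
      using that assms by blast
    show ?thesis
      unfolding disjoint_family_on_def
    proof (intro ballI impI)
      fix s t :: nat
      assume "s \<noteq> t"
      then consider "s < t" | "t < s" by linarith
      then show "?E s \<inter> ?E t = {}" using later[of s t] later[of t s] by cases (simp_all only: Int_commute)
    qed
  qed
  then have "(\<lambda>t. measure coin_space (?E t)) sums measure coin_space (\<Union>t. ?E t)"
    by (intro coin.finite_measure_UNION image_subsetI E)
  ultimately have "(\<lambda>t. (1 - q) ^ t * (1 / 2 ^ m)) sums measure coin_space (\<Union>t. ?E t)" by simp
  moreover have "(\<lambda>t. (1 - q) ^ t * (1 / 2 ^ m)) sums (1 / (1 - (1 - q)) * (1 / 2 ^ m))"
    using acceptance_bounds by (intro sums_mult2 geometric_sums) auto
  ultimately have "measure coin_space (\<Union>t. ?E t) = 1 / q * (1 / 2 ^ m)"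
    using sums_unique2 by fastforce
  also have "\<dots> = 1 / card V" by (simp add: q_def)
  finally show "measure coin_space {\<omega>. pick m V \<omega> j = v} = 1 / card V"
    unfolding split using measure_Un_null_set[OF UE N'] by simp
qed

lemma pick_in: "pick m V \<omega> j \<in> V"
proof -
  have "(SOME v. v \<in> V) \<in> V" using V(2) some_in_eq by blast
  then show ?thesis unfolding pick_def by (auto intro: LeastI_ex)
qed

end

lemma pick_cong:
  assumes "\<And>i. \<omega> (prod_encode (j, i)) = \<omega>' (prod_encode (j, i))"
  shows "pick m V \<omega> j = pick m V \<omega>' j"
proof -
  have "draw m \<omega> j = draw m \<omega>' j" using assms by (intro ext draw_cong)
  then show ?thesis by (simp add: pick_def)
qed

text \<open>
  The Markov chain that replaces its state \<open>h\<close> in stage \<open>j\<close> by a uniformly chosen element of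
  \<open>opts j h\<close>, using the coins of stage \<open>j\<close> only.
\<close>

primrec refine :: "(nat \<Rightarrow> nat) \<Rightarrow> (nat \<Rightarrow> nat \<Rightarrow> nat set) \<Rightarrow> nat \<Rightarrow> (nat \<Rightarrow> bool) \<Rightarrow> nat \<Rightarrow> nat" where
  "refine m opts h0 \<omega> 0 = h0"
| "refine m opts h0 \<omega> (Suc j) = pick (m j) (opts j (refine m opts h0 \<omega> j)) \<omega> j"

text \<open>
  The sets \<open>L j\<close> are the levels of a tree in which all nodes of a level have the same number of
  children. Then the end point of a random descent is uniformly distributed on its level.
\<close>

locale uniform_refinement =
  fixes m :: "nat \<Rightarrow> nat" and opts :: "nat \<Rightarrow> nat \<Rightarrow> nat set" and h0 :: nat
    and L :: "nat \<Rightarrow> nat set" and c :: "nat \<Rightarrow> nat"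
  assumes start: "L 0 = {h0}"
    and bounded: "h \<in> L j \<Longrightarrow> opts j h \<subseteq> {..<2 ^ m j}"
    and count: "h \<in> L j \<Longrightarrow> card (opts j h) = c j"
    and positive: "0 < c j"
    and step: "L (Suc j) = (\<Union>h\<in>L j. opts j h)"
    and disjoint: "h \<in> L j \<Longrightarrow> h' \<in> L j \<Longrightarrow> v \<in> opts j h \<Longrightarrow> v \<in> opts j h' \<Longrightarrow> h = h'"
begin

abbreviation "state \<equiv> refine m opts h0"

lemma nonempty: "h \<in> L j \<Longrightarrow> opts j h \<noteq> {}"
  using count positive by (metis card.empty less_irrefl)

lemma state_in: "state \<omega> j \<in> L j"
proof (induction j)
  case (Suc j)
  have "state \<omega> (Suc j) \<in> opts j (state \<omega> j)"
    unfolding refine.simps by (rule pick_in[OF bounded nonempty]) (rule Suc)+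
  with Suc show ?case unfolding step by blast
qed (simp add: start)

lemma state_event_step:
  assumes "h \<in> L j" "v \<in> opts j h"
  shows "{\<omega>. state \<omega> (Suc j) = v} = {\<omega>. state \<omega> j = h} \<inter> {\<omega>. pick (m j) (opts j h) \<omega> j = v}"
proof -
  have "state \<omega> j = h" if "state \<omega> (Suc j) = v" for \<omega>
  proof -
    have "state \<omega> (Suc j) \<in> opts j (state \<omega> j)"
      unfolding refine.simps by (rule pick_in[OF bounded nonempty]) (rule state_in)+
    then show ?thesis using disjoint[OF state_in assms(1) _ assms(2)] that by blast
  qed
  then show ?thesis by auto
qed

lemma state_event_supported: "supported_on {p. pfst p < j} {\<omega>. state \<omega> j = h}"
proof -
  have agree: "state \<omega> j = state \<omega>' j" if "\<And>p. pfst p < j \<Longrightarrow> \<omega> p = \<omega>' p" for \<omega> \<omega>'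
    using that
  proof (induction j)
    case (Suc j)
    have "state \<omega> j = state \<omega>' j" by (rule Suc.IH) (simp add: Suc.prems)
    moreover have "pick (m j) V \<omega> j = pick (m j) V \<omega>' j" for V
      by (rule pick_cong) (simp add: Suc.prems)
    ultimately show ?case by simp
  qed simp
  show ?thesis
    unfolding supported_on_def
  proof (intro allI impI)
    fix \<omega> \<omega>' :: "nat \<Rightarrow> bool"
    assume "\<forall>p\<in>{p. pfst p < j}. \<omega> p = \<omega>' p" "\<omega> \<in> {\<omega>. state \<omega> j = h}"
    then show "\<omega>' \<in> {\<omega>. state \<omega> j = h}" using agree[of \<omega> \<omega>'] by simp
  qed
qed

lemma state_event: "{\<omega>. state \<omega> j = h} \<in> sets coin_space"
proof (induction j arbitrary: h)
  case 0
  show ?case using sets.top[of coin_space] by (cases "h0 = h") auto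
next
  case (Suc j)
  show ?case
  proof (cases "h \<in> L (Suc j)")
    case True
    then obtain h' where "h' \<in> L j" "h \<in> opts j h'" unfolding step by blast
    then show ?thesis unfolding state_event_step[OF \<open>h' \<in> L j\<close> \<open>h \<in> opts j h'\<close>]
      by (intro sets.Int Suc measure_pick(2) bounded nonempty)
  next
    case False
    then have "{\<omega>. state \<omega> (Suc j) = h} = {}" using state_in by blast
    then show ?thesis by simp
  qed
qed

lemma finite_states: "finite (L j)"
proof (induction j)
  case (Suc j)
  have "finite (opts j h)" if "h \<in> L j" for h
    using bounded[OF that] finite_subset by blast
  with Suc show ?case by (simp add: step)
qed (simp add: start)

lemma card_states: "card (L (Suc j)) = card (L j) * c j"
proof -
  have "finite (opts j h)" if "h \<in> L j" for h
    using bounded[OF that] finite_subset by blast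
  moreover have "opts j h \<inter> opts j h' = {}" if "h \<in> L j" "h' \<in> L j" "h \<noteq> h'" for h h'
    using disjoint that by blast
  ultimately have "card (\<Union>h\<in>L j. opts j h) = (\<Sum>h\<in>L j. card (opts j h))"
    using finite_states by (intro card_UN_disjoint) blast+
  then show ?thesis by (simp add: step count)
qed

text \<open>
  A state has a unique predecessor, and the choice in stage \<open>j\<close> is independent of the coins of the
  earlier stages, so the probabilities along the path multiply.
\<close>

theorem state_uniform:
  assumes "h \<in> L j"
  shows "measure coin_space {\<omega>. state \<omega> j = h} = 1 / card (L j)"
  using assms
proof (induction j arbitrary: h)
  case 0
  then show ?case using coin.prob_space by (simp add: start)
next
  case (Suc j)
  then obtain h' where h': "h' \<in> L j" "h \<in> opts j h'" unfolding step by blast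
  have "supported_on {p. pfst p = j} {\<omega>. pick (m j) (opts j h') \<omega> j = h}"
    unfolding supported_on_def
  proof (intro allI impI)
    fix \<omega> \<omega>' :: "nat \<Rightarrow> bool"
    assume "\<forall>p\<in>{p. pfst p = j}. \<omega> p = \<omega>' p"
      and "\<omega> \<in> {\<omega>. pick (m j) (opts j h') \<omega> j = h}"
    then show "\<omega>' \<in> {\<omega>. pick (m j) (opts j h') \<omega> j = h}"
      using pick_cong[of \<omega> j \<omega>' "m j" "opts j h'"] by simp
  qed
  then have "measure coin_space {\<omega>. state \<omega> (Suc j) = h} =
      measure coin_space {\<omega>. state \<omega> j = h'} * measure coin_space {\<omega>. pick (m j) (opts j h') \<omega> j = h}"
    unfolding state_event_step[OF h']
    by (intro measure_Int_disjoint_support[OF state_event state_event_supported]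
        measure_pick(2) bounded nonempty h') auto
  then show ?case
    using Suc.IH[OF h'(1)] measure_pick(1)[OF bounded[OF h'(1)] nonempty[OF h'(1)] h'(2)] count[OF h'(1)]
    by (simp add: card_states)
qed

lemma AE_all_accepted: "AE \<omega> in coin_space. \<forall>j. \<exists>t. draw (m j) \<omega> j t \<in> opts j (state \<omega> j)"
proof -
  have "AE \<omega> in coin_space. h \<in> L j \<longrightarrow> (\<exists>t. draw (m j) \<omega> j t \<in> opts j h)" for j h
    using AE_accepted[OF bounded nonempty] by (cases "h \<in> L j") auto
  then have "AE \<omega> in coin_space. \<forall>j h. h \<in> L j \<longrightarrow> (\<exists>t. draw (m j) \<omega> j t \<in> opts j h)"
    by (simp add: AE_all_countable)
  then show ?thesis by eventually_elim (use state_in in blast)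
qed

end

section \<open>Locally valid patterns on convex sets\<close>

locale tep_sft = group G for G :: "('g, 'm) monoid_scheme" (structure) +
  fixes \<C> :: "'g set set" and S :: "'g set" and A :: "'a set" and k :: nat
    and \<T> :: "('g \<Rightarrow> 'a) set"
  assumes convexoid: "convexoid G \<C>"
    and tep_family: "tep_family G \<C> S A k \<T>"
begin

abbreviation X :: "('g \<Rightarrow> 'a) set" where "X \<equiv> sft G S A \<T>"

text \<open>
  The patterns on \<open>D\<close> that violate no constraint inside \<open>D\<close>. In general they need not extend to
  configurations; on convex sets they do, which is proved in \<open>valid_eq_restrictions\<close>.
\<close>

definition valid :: "'g set \<Rightarrow> ('g \<Rightarrow> 'a) set" where
  "valid D = {P \<in> D \<rightarrow>\<^sub>E A. \<forall>g\<in>carrier G. g <# S \<subseteq> D \<longrightarrow> (\<lambda>s\<in>S. P (g \<otimes> s)) \<in> \<T>}"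

lemma family_facts:
  "finite S" "S \<noteq> {}" "S \<subseteq> carrier G" "ucp G S \<C>" "finite A" "A \<noteq> {}" "1 \<le> k"
  "\<T> \<subseteq> S \<rightarrow>\<^sub>E A" "tep G \<C> S A k \<T>"
  using tep_family unfolding tep_family_def by auto

lemma convex_finite: "C \<in> \<C> \<Longrightarrow> finite C"
  and convex_subset: "C \<in> \<C> \<Longrightarrow> C \<subseteq> carrier G"
  and empty_convex: "{} \<in> \<C>"
  and convex_cover: "finite F \<Longrightarrow> F \<subseteq> carrier G \<Longrightarrow> \<exists>C\<in>\<C>. F \<subseteq> C"
  and convex_step: "C \<in> \<C> \<Longrightarrow> D \<in> \<C> \<Longrightarrow> C \<subset> D \<Longrightarrow> \<exists>a\<in>D - C. insert a C \<in> \<C>"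
  using convexoid by (simp_all add: convexoid_def)

lemma translate_eq: "g <# S = (\<lambda>s. g \<otimes> s) ` S"
  by (auto simp: l_coset_def)

lemma translate_finite: "finite (g <# S)"
  unfolding translate_eq using family_facts(1) by simp

lemma translate_subset: "g \<in> carrier G \<Longrightarrow> g <# S \<subseteq> carrier G"
  unfolding translate_eq using family_facts(3) by auto

text \<open>
  The action moves \<open>S\<close> to \<open>inv g <# S\<close> and \<open>valid\<close> uses \<open>g <# S\<close>, but \<open>g\<close> runs through the whole group.
\<close>

lemma sft_eq_valid: "X = valid (carrier G)"
proof -
  have shift: "restrict (shift_action G g x) S = (\<lambda>s\<in>S. x (inv g \<otimes> s))" for g x
    using family_facts(3) by (auto simp: shift_action_def restrict_def fun_eq_iff)
  have "(\<forall>g\<in>carrier G. (\<lambda>s\<in>S. x (inv g \<otimes> s)) \<in> \<T>) \<longleftrightarrow>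
      (\<forall>g\<in>carrier G. (\<lambda>s\<in>S. x (g \<otimes> s)) \<in> \<T>)" for x
    by (metis inv_closed inv_inv)
  then show ?thesis
    unfolding sft_def valid_def shift using translate_subset by auto
qed

lemma valid_restrict:
  assumes "Q \<in> valid D" "C \<subseteq> D"
  shows "restrict Q C \<in> valid C"
  unfolding valid_def
proof (intro CollectI conjI ballI impI)
  show "restrict Q C \<in> C \<rightarrow>\<^sub>E A" using assms unfolding valid_def by auto
  fix g assume g: "g \<in> carrier G" "g <# S \<subseteq> C"
  then have "(\<lambda>s\<in>S. restrict Q C (g \<otimes> s)) = (\<lambda>s\<in>S. Q (g \<otimes> s))"
    unfolding translate_eq by (auto simp: restrict_def fun_eq_iff)
  then show "(\<lambda>s\<in>S. restrict Q C (g \<otimes> s)) \<in> \<T>"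
    using assms g unfolding valid_def by auto
qed

lemma valid_PiE: "P \<in> valid D \<Longrightarrow> P \<in> D \<rightarrow>\<^sub>E A"
  unfolding valid_def by blast

lemma finite_valid: "finite D \<Longrightarrow> finite (valid D)"
  using finite_PiE[of D "\<lambda>_. A"] family_facts(5)
  by (rule_tac finite_subset[of _ "D \<rightarrow>\<^sub>E A"]) (auto dest: valid_PiE)

lemma not_in_closure:
  assumes "C \<in> \<C>" "a \<notin> C" "B \<subseteq> C"
  shows "a \<notin> convex_closure \<C> B"
  using assms unfolding convex_closure_def by blast

text \<open>
  The point \<open>a\<close> is a lax corner of \<open>insert a C\<close>, because \<open>C\<close> is convex and does not contain it. By
  the unique corner property, at most one translate \<open>g <# S\<close> inside \<open>insert a C\<close> contains \<open>a\<close>, so at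
  most one new constraint has to be met. For this translate, \<open>a\<close> is also a lax corner of \<open>g <# S\<close>,
  whose remaining points lie in \<open>C\<close>; hence the uniform extension property leaves exactly \<open>k\<close>
  symbols. Without such a translate every symbol is admissible. The number of choices depends
  on \<open>C\<close> and \<open>a\<close> only, not on the pattern on \<open>C\<close>.
\<close>

lemma card_one_point_extensions:
  assumes C: "C \<in> \<C>" "insert a C \<in> \<C>" "a \<notin> C" and P: "P \<in> valid C"
  shows "card {b \<in> A. P(a := b) \<in> valid (insert a C)} =
    (if \<exists>g\<in>carrier G. a \<in> g <# S \<and> g <# S \<subseteq> insert a C then k else card A)"
proof -
  have away: "(\<lambda>s\<in>S. (P(a := b)) (g \<otimes> s)) \<in> \<T>"
    if g: "g \<in> carrier G" "g <# S \<subseteq> insert a C" "a \<notin> g <# S" for g b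
  proof -
    have "(\<lambda>s\<in>S. (P(a := b)) (g \<otimes> s)) = (\<lambda>s\<in>S. P (g \<otimes> s))"
      using g(3) unfolding translate_eq by (auto simp: restrict_def fun_eq_iff)
    moreover have "g <# S \<subseteq> C" using g by blast
    ultimately show ?thesis using P g(1) unfolding valid_def by auto
  qed
  have PiE: "P(a := b) \<in> insert a C \<rightarrow>\<^sub>E A" if "b \<in> A" for b
    using valid_PiE[OF P] that by (simp add: PiE_fun_upd)
  show ?thesis
  proof (cases "\<exists>g\<in>carrier G. a \<in> g <# S \<and> g <# S \<subseteq> insert a C")
    case True
    then obtain g where g: "g \<in> carrier G" "a \<in> g <# S" "g <# S \<subseteq> insert a C" by blast
    have corner: "a \<in> lax_corners \<C> (insert a C)" "a \<in> lax_corners \<C> (g <# S)"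
      using not_in_closure[OF C(1,3), of "insert a C - {a}"] not_in_closure[OF C(1,3), of "(g <# S) - {a}"] g(2,3)
      unfolding lax_corners_def by auto
    have other: "a \<notin> h <# S" if "h \<in> carrier G" "h <# S \<subseteq> insert a C" "h \<noteq> g" for h
      using family_facts(4) corner(1) g that C(2) unfolding ucp_def by blast
    obtain s where s: "s \<in> S" "a = g \<otimes> s" using g(2) unfolding translate_eq by blast
    have s_in: "s \<in> carrier G" using s family_facts(3) by blast
    have "inv g \<otimes> a = s" using s(2) s_in g(1) by (simp add: m_assoc[symmetric])
    then have "s \<in> inv g <# lax_corners \<C> (g <# S)"
      using corner(2) unfolding l_coset_def by blast
    then have uniform: "\<forall>P\<in>(S - {s}) \<rightarrow>\<^sub>E A. card {b \<in> A. P(s := b) \<in> \<T>} = k"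
      using family_facts(9) g(1) unfolding tep_def uniform_extensions_def by blast
    let ?P = "\<lambda>t\<in>S - {s}. P (g \<otimes> t)"
    have neq: "g \<otimes> t \<noteq> a" if "t \<in> S" "t \<noteq> s" for t
      using that s s_in family_facts(3) g(1) by auto
    have "?P \<in> (S - {s}) \<rightarrow>\<^sub>E A"
      using neq g(3) valid_PiE[OF P] unfolding translate_eq by (auto simp: PiE_iff)
    with uniform have "card {b \<in> A. ?P(s := b) \<in> \<T>} = k" by blast
    moreover have "P(a := b) \<in> valid (insert a C) \<longleftrightarrow> ?P(s := b) \<in> \<T>" if b: "b \<in> A" for b
    proof -
      have "(\<lambda>t\<in>S. (P(a := b)) (g \<otimes> t)) = ?P(s := b)"
        using s neq by (auto simp: fun_eq_iff restrict_def)
      then have "P(a := b) \<in> valid (insert a C) \<longleftrightarrow>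
          (\<forall>h\<in>carrier G. h \<noteq> g \<longrightarrow> h <# S \<subseteq> insert a C \<longrightarrow> (\<lambda>t\<in>S. (P(a := b)) (h \<otimes> t)) \<in> \<T>) \<and>
          ?P(s := b) \<in> \<T>"
        using PiE[OF b] g unfolding valid_def by auto
      then show ?thesis using away other by blast
    qed
    ultimately show ?thesis using True by (simp cong: conj_cong)
  next
    case False
    then have "P(a := b) \<in> valid (insert a C)" if "b \<in> A" for b
      using PiE[OF that] away unfolding valid_def by auto
    then have "{b \<in> A. P(a := b) \<in> valid (insert a C)} = A" by blast
    then show ?thesis by (simp only: if_not_P[OF False])
  qed
qed

definition extensions :: "'g set \<Rightarrow> 'g set \<Rightarrow> ('g \<Rightarrow> 'a) \<Rightarrow> ('g \<Rightarrow> 'a) set" where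
  "extensions C D P = {Q \<in> valid D. restrict Q C = P}"

text \<open>
  Between two convex sets one can pass by adding one point at a time, through convex sets only;
  the numbers of choices multiply.
\<close>

lemma extensions_uniform:
  assumes "C \<in> \<C>" "D \<in> \<C>" "C \<subseteq> D"
  shows "\<exists>m>0. \<forall>P\<in>valid C. card (extensions C D P) = m"
  using assms
proof (induction "card (D - C)" arbitrary: C rule: less_induct)
  case less
  show ?case
  proof (cases "C = D")
    case True
    have "restrict Q C = Q" if "Q \<in> valid C" for Q
      by (rule PiE_restrict[OF valid_PiE[OF that]])
    then have "extensions C C P = {P}" if "P \<in> valid C" for P
      using that unfolding extensions_def by auto
    then show ?thesis using True by (intro exI[of _ 1]) auto
  next
    case False
    then obtain a where a: "a \<in> D - C" "insert a C \<in> \<C>"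
      using convex_step less.prems by blast
    let ?C = "insert a C"
    have "card (D - ?C) < card (D - C)"
      using a convex_finite[OF less.prems(2)] by (intro psubset_card_mono) auto
    then obtain m where m: "m > 0" "\<forall>P\<in>valid ?C. card (extensions ?C D P) = m"
      using less.hyps[of ?C] a less.prems by auto
    let ?n = "if \<exists>g\<in>carrier G. a \<in> g <# S \<and> g <# S \<subseteq> insert a C then k else card A"
    have n: "?n > 0" using family_facts(5-7) by (auto simp: card_gt_0_iff)
    have "card (extensions C D P) = ?n * m" if P: "P \<in> valid C" for P
    proof -
      let ?B = "{b \<in> A. P(a := b) \<in> valid ?C}"
      have upd: "restrict (P(a := b)) C = P" for b
        using valid_PiE[OF P] a by (auto simp: fun_eq_iff restrict_def PiE_def extensional_def)
      have "extensions C D P = (\<Union>b\<in>?B. extensions ?C D (P(a := b)))"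
      proof (intro subset_antisym subsetI)
        fix Q assume "Q \<in> extensions C D P"
        then have Q: "Q \<in> valid D" "restrict Q C = P" unfolding extensions_def by auto
        have eq: "restrict Q ?C = P(a := Q a)"
          using Q(2) by (auto simp: fun_eq_iff restrict_def split: if_splits)
        moreover have "Q a \<in> A" using valid_PiE[OF Q(1)] a by auto
        moreover have "P(a := Q a) \<in> valid ?C"
          using valid_restrict[OF Q(1), of ?C] a less.prems(3) unfolding eq by auto
        ultimately show "Q \<in> (\<Union>b\<in>?B. extensions ?C D (P(a := b)))"
          using Q(1) unfolding extensions_def by auto
      next
        fix Q assume "Q \<in> (\<Union>b\<in>?B. extensions ?C D (P(a := b)))"
        then obtain b where Q: "Q \<in> valid D" "restrict Q ?C = P(a := b)"
          unfolding extensions_def by auto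
        have "restrict Q C = restrict (restrict Q ?C) C" by (auto simp: fun_eq_iff restrict_def)
        then show "Q \<in> extensions C D P" using Q upd unfolding extensions_def by simp
      qed
      then have "card (extensions C D P) = (\<Sum>b\<in>?B. card (extensions ?C D (P(a := b))))"
      proof (simp only:, intro card_UN_disjoint)
        show "\<forall>b\<in>?B. finite (extensions ?C D (P(a := b)))"
          using finite_valid[OF convex_finite[OF less.prems(2)]] unfolding extensions_def by simp
        show "\<forall>b\<in>?B. \<forall>b'\<in>?B. b \<noteq> b' \<longrightarrow>
            extensions ?C D (P(a := b)) \<inter> extensions ?C D (P(a := b')) = {}"
          unfolding extensions_def by (auto dest: fun_upd_eqD)
      qed (use family_facts(5) in simp)
      also have "\<dots> = card ?B * m" using m by simp
      also have "card ?B = ?n"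
        using card_one_point_extensions[OF less.prems(1) a(2) _ P] a by blast
      finally show ?thesis .
    qed
    then show ?thesis using n m(1) by (intro exI[of _ "?n * m"]) auto
  qed
qed

lemma valid_extends:
  assumes "C \<in> \<C>" "D \<in> \<C>" "C \<subseteq> D" "P \<in> valid C"
  obtains Q where "Q \<in> valid D" "restrict Q C = P"
proof -
  obtain m where "m > 0" "card (extensions C D P) = m"
    using extensions_uniform[OF assms(1-3)] assms(4) by blast
  then have "extensions C D P \<noteq> {}" by auto
  then show thesis using that unfolding extensions_def by blast
qed

lemma card_valid_extensions:
  assumes "C \<in> \<C>" "D \<in> \<C>" "C \<subseteq> D" "P \<in> valid C"
  shows "card (valid D) = card (valid C) * card (extensions C D P)"
proof -
  obtain m where m: "\<forall>P\<in>valid C. card (extensions C D P) = m"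
    using extensions_uniform[OF assms(1-3)] by blast
  have "valid D = (\<Union>P\<in>valid C. extensions C D P)"
    unfolding extensions_def using valid_restrict[OF _ assms(3)] by auto
  moreover have "card (\<Union>P\<in>valid C. extensions C D P) = (\<Sum>P\<in>valid C. card (extensions C D P))"
    using finite_valid[OF convex_finite] assms unfolding extensions_def
    by (intro card_UN_disjoint) auto
  ultimately show ?thesis using m assms(4) by simp
qed

lemma valid_empty: "valid {} = {\<lambda>_. undefined}"
  unfolding valid_def translate_eq using family_facts(2) by auto

section \<open>A sequence of convex sets exhausting the group\<close>

text \<open>
  Repetitions are permitted, so that finite groups need no separate treatment.
\<close>

definition exhaustion :: "(nat \<Rightarrow> 'g set) \<Rightarrow> bool" where
  "exhaustion D \<longleftrightarrow> D 0 = {} \<and> (\<forall>j. D j \<in> \<C> \<and> D j \<subseteq> D (Suc j)) \<and> (\<Union>j. D j) = carrier G"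

lemma exhaustion_exists:
  assumes "countable (carrier G)"
  obtains D where "exhaustion D"
proof -
  let ?g = "from_nat_into (carrier G)"
  have "\<exists>D. \<forall>j. (D j \<in> \<C> \<and> (j = 0 \<longrightarrow> D j = {})) \<and> insert (?g j) (D j) \<subseteq> D (Suc j)"
  proof (rule dependent_nat_choice)
    show "\<exists>D. D \<in> \<C> \<and> (0 = (0::nat) \<longrightarrow> D = {})" using empty_convex by blast
  next
    fix D and n :: nat assume "D \<in> \<C> \<and> (n = 0 \<longrightarrow> D = {})"
    moreover have "?g n \<in> carrier G" by (rule from_nat_into) blast
    ultimately show "\<exists>D'. (D' \<in> \<C> \<and> (Suc n = 0 \<longrightarrow> D' = {})) \<and> insert (?g n) D \<subseteq> D'"
      using convex_cover[of "insert (?g n) D"] convex_finite convex_subset by auto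
  qed
  then obtain D where D: "\<And>j. D j \<in> \<C>" "D 0 = {}" "\<And>j. insert (?g j) (D j) \<subseteq> D (Suc j)" by blast
  have "g \<in> (\<Union>j. D j)" if "g \<in> carrier G" for g
    using from_nat_into_surj[OF assms that] D(3) by blast
  then have "exhaustion D" unfolding exhaustion_def using D convex_subset by blast
  then show thesis by (rule that)
qed

lemma exhaustion_mono: "exhaustion D \<Longrightarrow> i \<le> j \<Longrightarrow> D i \<subseteq> D j"
  using lift_Suc_mono_le[of D i j] unfolding exhaustion_def by blast

lemma exhaustion_covers:
  assumes D: "exhaustion D" and F: "finite F" "F \<subseteq> carrier G"
  obtains j where "F \<subseteq> D j"
proof -
  have "\<exists>j. F \<subseteq> D j" using F
  proof (induction F rule: finite_induct)
    case (insert g F)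
    then obtain i where "F \<subseteq> D i" by blast
    moreover have "g \<in> (\<Union>j. D j)" using D insert.prems unfolding exhaustion_def by simp
    then obtain j where "g \<in> D j" by blast
    ultimately have "insert g F \<subseteq> D (max i j)"
      using exhaustion_mono[OF D, of i "max i j"] exhaustion_mono[OF D, of j "max i j"] by auto
    then show ?case ..
  qed simp
  then show thesis using that by blast
qed

end

section \<open>Codes of patterns\<close>

lemma set_decode_pattern_code:
  "finite C \<Longrightarrow> set_decode (pattern_code enc \<alpha> C P) = cell_code enc \<alpha> P ` C"
  by (simp add: pattern_code_def)

locale encoded_tep_sft = tep_sft G \<C> S A k \<T>
  for G :: "('g, 'm) monoid_scheme" (structure) and \<C> S and A :: "'a set" and k \<T> +
  fixes enc :: "'g \<Rightarrow> nat list" and \<alpha> :: "'a \<Rightarrow> nat"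
  assumes inj_enc: "inj_on enc (carrier G)" and inj_symbols: "inj_on \<alpha> A"
begin

lemma elem_code_eq_iff:
  "g \<in> carrier G \<Longrightarrow> h \<in> carrier G \<Longrightarrow> elem_code enc g = elem_code enc h \<longleftrightarrow> g = h"
  using inj_enc by (auto simp: elem_code_def list_encode_eq inj_on_eq_iff)

text \<open>
  Codes of patterns are graphs, so one pattern extends another iff its code, as a set, contains
  the other one.
\<close>

lemma pattern_code_subset_iff:
  assumes "finite C" "C \<subseteq> carrier G" "finite D" "D \<subseteq> carrier G"
    and P: "P \<in> C \<rightarrow>\<^sub>E A" and Q: "Q \<in> D \<rightarrow>\<^sub>E A"
  shows "set_decode (pattern_code enc \<alpha> C P) \<subseteq> set_decode (pattern_code enc \<alpha> D Q) \<longleftrightarrow>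
    C \<subseteq> D \<and> restrict Q C = P"
proof -
  have cell: "cell_code enc \<alpha> P g \<in> cell_code enc \<alpha> Q ` D \<longleftrightarrow> g \<in> D \<and> Q g = P g" if "g \<in> C" for g
  proof -
    have "g \<in> carrier G" "P g \<in> A" using that assms by auto
    moreover have "h \<in> carrier G" "Q h \<in> A" if "h \<in> D" for h using that assms by auto
    ultimately show ?thesis
      using elem_code_eq_iff inj_on_eq_iff[OF inj_symbols]
      by (auto simp: cell_code_def image_iff)
  qed
  have "restrict Q C = P \<longleftrightarrow> (\<forall>g\<in>C. Q g = P g)"
    using P by (auto simp: fun_eq_iff PiE_def extensional_def)
  then show ?thesis
    unfolding set_decode_pattern_code[OF assms(1)] set_decode_pattern_code[OF assms(3)] image_subset_iff
    using cell by blast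
qed

lemma inj_pattern_code:
  assumes "finite D" "D \<subseteq> carrier G"
  shows "inj_on (pattern_code enc \<alpha> D) (D \<rightarrow>\<^sub>E A)"
proof
  fix P Q assume *: "P \<in> D \<rightarrow>\<^sub>E A" "Q \<in> D \<rightarrow>\<^sub>E A" "pattern_code enc \<alpha> D P = pattern_code enc \<alpha> D Q"
  then have "restrict Q D = P"
    using pattern_code_subset_iff[OF assms assms, of P Q] by simp
  with *(2) show "P = Q" by (simp add: PiE_restrict)
qed

definition valid_codes :: "'g set \<Rightarrow> nat set" where
  "valid_codes D = pattern_code enc \<alpha> D ` valid D"

lemma card_valid_codes:
  assumes "D \<in> \<C>"
  shows "card (valid_codes D) = card (valid D)"
proof -
  have "valid D \<subseteq> D \<rightarrow>\<^sub>E A" using valid_PiE by auto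
  then show ?thesis
    unfolding valid_codes_def
    by (intro card_image inj_on_subset[OF inj_pattern_code[OF convex_finite convex_subset]] assms)
qed

lemma card_code_extensions:
  assumes C: "finite C" "C \<subseteq> carrier G" and D: "D \<in> \<C>" and "C \<subseteq> D" and P: "P \<in> C \<rightarrow>\<^sub>E A"
  shows "card {q \<in> valid_codes D. set_decode (pattern_code enc \<alpha> C P) \<subseteq> set_decode q} =
    card (extensions C D P)"
proof -
  have "set_decode (pattern_code enc \<alpha> C P) \<subseteq> set_decode (pattern_code enc \<alpha> D Q) \<longleftrightarrow>
      restrict Q C = P" if "Q \<in> valid D" for Q
    using pattern_code_subset_iff[OF C convex_finite[OF D] convex_subset[OF D] P valid_PiE[OF that]]
      \<open>C \<subseteq> D\<close> by simp
  then have "{q \<in> valid_codes D. set_decode (pattern_code enc \<alpha> C P) \<subseteq> set_decode q} =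
      pattern_code enc \<alpha> D ` extensions C D P"
    unfolding valid_codes_def extensions_def by blast
  moreover have "extensions C D P \<subseteq> D \<rightarrow>\<^sub>E A"
    using valid_PiE unfolding extensions_def by auto
  then have "inj_on (pattern_code enc \<alpha> D) (extensions C D P)"
    by (rule inj_on_subset[OF inj_pattern_code[OF convex_finite[OF D] convex_subset[OF D]]])
  ultimately show ?thesis by (simp add: card_image)
qed

end

section \<open>The random configuration\<close>

text \<open>
  The random configuration is built along an exhaustion by convex sets. In stage \<open>j\<close>, the pattern
  on \<open>D j\<close> is extended to a uniformly chosen valid pattern on \<open>D (Suc j)\<close>. The number \<open>m j\<close> bounds the
  codes of all cells over \<open>D (Suc j)\<close>, so that \<open>m j\<close> random bits, read as a set of cells, can produce
  each of these patterns.
\<close>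

locale exhausted_tep_sft = encoded_tep_sft G \<C> S A k \<T> enc \<alpha>
  for G :: "('g, 'm) monoid_scheme" (structure) and \<C> S and A :: "'a set" and k \<T> enc \<alpha> +
  fixes D :: "nat \<Rightarrow> 'g set" and m :: "nat \<Rightarrow> nat"
  assumes exhaustion: "exhaustion D"
    and cell_bound: "g \<in> D (Suc j) \<Longrightarrow> a \<in> A \<Longrightarrow> prod_encode (elem_code enc g, \<alpha> a) < m j"
begin

lemma D_facts: "D 0 = {}" "D j \<in> \<C>" "D j \<subseteq> D (Suc j)" "finite (D j)" "D j \<subseteq> carrier G"
  using exhaustion convex_finite convex_subset unfolding exhaustion_def by auto

definition options :: "nat \<Rightarrow> nat \<Rightarrow> nat set" where
  "options j h = {q \<in> valid_codes (D (Suc j)). set_decode h \<subseteq> set_decode q}"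

lemma options_pattern_code:
  assumes "P \<in> valid (D j)"
  shows "options j (pattern_code enc \<alpha> (D j) P) =
    pattern_code enc \<alpha> (D (Suc j)) ` extensions (D j) (D (Suc j)) P"
  unfolding options_def valid_codes_def extensions_def
  using pattern_code_subset_iff[OF D_facts(4,5) D_facts(4,5) valid_PiE[OF assms] valid_PiE] D_facts(3)
  by blast

text \<open>
  All valid patterns on \<open>D j\<close> have the same number of valid extensions to \<open>D (Suc j)\<close>, which is
  therefore the quotient of the numbers of valid patterns.
\<close>

sublocale uniform_refinement m options 0 "\<lambda>j. valid_codes (D j)"
  "\<lambda>j. card (valid (D (Suc j))) div card (valid (D j))"
proof
  show "valid_codes (D 0) = {0}"
    by (simp add: D_facts(1) valid_codes_def valid_empty pattern_code_def)
  show "options j h \<subseteq> {..<2 ^ m j}" for j h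
  proof
    fix q assume "q \<in> options j h"
    then obtain Q where Q: "Q \<in> valid (D (Suc j))" "q = pattern_code enc \<alpha> (D (Suc j)) Q"
      unfolding options_def valid_codes_def by blast
    have "cell_code enc \<alpha> Q ` D (Suc j) \<subseteq> {..<m j}"
      using valid_PiE[OF Q(1)] cell_bound by (auto simp: cell_code_def)
    then show "q \<in> {..<2 ^ m j}"
      unfolding Q(2) pattern_code_def by (simp add: set_encode_less)
  qed
  have card_eq: "card (options j h) = card (valid (D (Suc j))) div card (valid (D j)) \<and>
      0 < card (options j h)"
    if h: "h \<in> valid_codes (D j)" for j h
  proof -
    obtain P where P: "P \<in> valid (D j)" "h = pattern_code enc \<alpha> (D j) P"
      using h unfolding valid_codes_def by blast
    have "card (options j h) = card (extensions (D j) (D (Suc j)) P)"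
      unfolding options_def P(2)
      by (rule card_code_extensions[OF D_facts(4,5,2,3) valid_PiE[OF P(1)]])
    moreover have "card (valid (D (Suc j))) = card (valid (D j)) * card (extensions (D j) (D (Suc j)) P)"
      by (rule card_valid_extensions[OF D_facts(2,2,3) P(1)])
    moreover have "0 < card (valid (D j))"
      using P(1) finite_valid[OF D_facts(4)] by (auto simp: card_gt_0_iff)
    moreover have "0 < card (extensions (D j) (D (Suc j)) P)"
    proof -
      obtain n where "n > 0" "\<forall>P\<in>valid (D j). card (extensions (D j) (D (Suc j)) P) = n"
        using extensions_uniform[OF D_facts(2,2,3)] by blast
      then show ?thesis using P(1) by simp
    qed
    ultimately show ?thesis by simp
  qed
  then show "card (options j h) = card (valid (D (Suc j))) div card (valid (D j))"
    if "h \<in> valid_codes (D j)" for j h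
    using that by blast
  have inhabited: "valid (D j) \<noteq> {}" for j
    by (rule valid_extends[OF empty_convex D_facts(2), where P = "\<lambda>_. undefined"]) (auto simp: valid_empty)
  show "0 < card (valid (D (Suc j))) div card (valid (D j))" for j
    using card_eq inhabited unfolding valid_codes_def by (metis all_not_in_conv imageI)
  show "valid_codes (D (Suc j)) = (\<Union>h\<in>valid_codes (D j). options j h)" for j
  proof (intro subset_antisym subsetI)
    fix q assume q: "q \<in> valid_codes (D (Suc j))"
    then obtain Q where Q: "Q \<in> valid (D (Suc j))" "q = pattern_code enc \<alpha> (D (Suc j)) Q"
      unfolding valid_codes_def by blast
    let ?P = "restrict Q (D j)"
    have P: "?P \<in> valid (D j)" by (rule valid_restrict[OF Q(1) D_facts(3)])
    have "q \<in> options j (pattern_code enc \<alpha> (D j) ?P)"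
      unfolding options_pattern_code[OF P] using Q by (auto simp: extensions_def)
    with P show "q \<in> (\<Union>h\<in>valid_codes (D j). options j h)" unfolding valid_codes_def by blast
  qed (auto simp: options_def)
  show "h = h'" if hh: "h \<in> valid_codes (D j)" "h' \<in> valid_codes (D j)" and v: "v \<in> options j h" "v \<in> options j h'"
    for h j h' v
  proof -
    obtain P P' where P: "P \<in> valid (D j)" "h = pattern_code enc \<alpha> (D j) P"
      "P' \<in> valid (D j)" "h' = pattern_code enc \<alpha> (D j) P'"
      using hh unfolding valid_codes_def by blast
    obtain Q Q' where Q: "Q \<in> valid (D (Suc j))" "restrict Q (D j) = P" "v = pattern_code enc \<alpha> (D (Suc j)) Q"
      "Q' \<in> valid (D (Suc j))" "restrict Q' (D j) = P'" "v = pattern_code enc \<alpha> (D (Suc j)) Q'"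
      using v unfolding P(2,4) options_pattern_code[OF P(1)] options_pattern_code[OF P(3)] extensions_def
      by blast
    have "Q = Q'"
      using inj_onD[OF inj_pattern_code[OF D_facts(4,5)], of "Suc j" Q Q'] Q valid_PiE by simp
    then show "h = h'" using P Q by simp
  qed
qed

definition pattern_at :: "(nat \<Rightarrow> bool) \<Rightarrow> nat \<Rightarrow> 'g \<Rightarrow> 'a" where
  "pattern_at \<omega> j = inv_into (valid (D j)) (pattern_code enc \<alpha> (D j)) (state \<omega> j)"

lemma pattern_at: "pattern_at \<omega> j \<in> valid (D j)" "pattern_code enc \<alpha> (D j) (pattern_at \<omega> j) = state \<omega> j"
proof -
  have "state \<omega> j \<in> pattern_code enc \<alpha> (D j) ` valid (D j)"
    using state_in[of \<omega> j] unfolding valid_codes_def .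
  then show "pattern_at \<omega> j \<in> valid (D j)" "pattern_code enc \<alpha> (D j) (pattern_at \<omega> j) = state \<omega> j"
    unfolding pattern_at_def by (rule inv_into_into, rule f_inv_into_f)
qed

lemma pattern_at_restrict:
  assumes "i \<le> j"
  shows "restrict (pattern_at \<omega> j) (D i) = pattern_at \<omega> i"
proof -
  have "set_decode (state \<omega> i) \<subseteq> set_decode (state \<omega> j)"
    using assms
  proof (induction j rule: dec_induct)
    case (step n)
    have "state \<omega> (Suc n) \<in> options n (state \<omega> n)"
      unfolding refine.simps by (rule pick_in[OF bounded nonempty]) (rule state_in)+
    with step.IH show ?case unfolding options_def by blast
  qed simp
  then show ?thesis
    unfolding pattern_at(2)[symmetric]
    using pattern_code_subset_iff[OF D_facts(4,5) D_facts(4,5) valid_PiE valid_PiE, OF pattern_at(1) pattern_at(1)]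
    by blast
qed

text \<open>
  The patterns of the successive stages extend each other, so any stage that has reached \<open>g\<close>
  determines the symbol there. The definition is total on the coin sequences, also on those for
  which some stage rejects all attempts.
\<close>

definition \<xi> :: "(nat \<Rightarrow> bool) \<Rightarrow> 'g \<Rightarrow> 'a" where
  "\<xi> \<omega> = (\<lambda>g\<in>carrier G. pattern_at \<omega> (LEAST j. g \<in> D j) g)"

lemma \<xi>_restrict: "restrict (\<xi> \<omega>) (D j) = pattern_at \<omega> j"
proof
  fix g
  show "restrict (\<xi> \<omega>) (D j) g = pattern_at \<omega> j g"
  proof (cases "g \<in> D j")
    case True
    let ?i = "LEAST j. g \<in> D j"
    have "?i \<le> j" "g \<in> D ?i" using True by (auto intro: Least_le LeastI)
    then have "pattern_at \<omega> ?i g = pattern_at \<omega> j g"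
      using pattern_at_restrict[of ?i j \<omega>] by (metis restrict_apply')
    then show ?thesis using True D_facts(5) by (auto simp: \<xi>_def)
  next
    case False
    then show ?thesis using valid_PiE[OF pattern_at(1)] by (auto simp: PiE_def extensional_def)
  qed
qed

lemma \<xi>_in_sft: "\<xi> \<omega> \<in> X"
  unfolding sft_eq_valid valid_def
proof (intro CollectI conjI ballI impI)
  have "\<xi> \<omega> g \<in> A" if g: "g \<in> carrier G" for g
  proof -
    obtain j where "{g} \<subseteq> D j"
      by (rule exhaustion_covers[OF exhaustion, of "{g}"]) (use g in auto)
    then show ?thesis
      using valid_PiE[OF pattern_at(1)] \<xi>_restrict[of \<omega> j]
      by (metis PiE_mem insert_subset restrict_apply')
  qed
  then show "\<xi> \<omega> \<in> carrier G \<rightarrow>\<^sub>E A" by (auto simp: \<xi>_def)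
  fix g assume g: "g \<in> carrier G" "g <# S \<subseteq> carrier G"
  obtain j where j: "g <# S \<subseteq> D j"
    using exhaustion_covers[OF exhaustion translate_finite g(2)] .
  then have "(\<lambda>s\<in>S. \<xi> \<omega> (g \<otimes> s)) = (\<lambda>s\<in>S. restrict (\<xi> \<omega>) (D j) (g \<otimes> s))"
    unfolding translate_eq by (auto simp: restrict_def fun_eq_iff)
  then show "(\<lambda>s\<in>S. \<xi> \<omega> (g \<otimes> s)) \<in> \<T>"
    using pattern_at(1)[of \<omega> j] j g(1) unfolding \<xi>_restrict valid_def by auto
qed

lemma \<xi>_event:
  assumes "P \<in> valid (D j)"
  shows "{\<omega>. restrict (\<xi> \<omega>) (D j) = P} = {\<omega>. state \<omega> j = pattern_code enc \<alpha> (D j) P}"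
  unfolding \<xi>_restrict
  using inj_on_eq_iff[OF inj_pattern_code[OF D_facts(4,5)] valid_PiE[OF pattern_at(1)] valid_PiE[OF assms]]
  by (auto simp: pattern_at(2))

lemma measure_\<xi>_event:
  assumes "P \<in> valid (D j)"
  shows "measure coin_space {\<omega>. restrict (\<xi> \<omega>) (D j) = P} = 1 / card (valid (D j))"
  unfolding \<xi>_event[OF assms]
  using state_uniform[of _ j] assms by (simp add: valid_codes_def card_valid_codes[OF D_facts(2), unfolded valid_codes_def])

text \<open>
  A valid pattern on a convex set is the restriction of a configuration: some extension of it is
  the outcome of a stage of the random construction with positive probability, hence for some coin
  sequence, and the outcomes of the construction belong to the subshift.
\<close>

lemma valid_eq_restrictions:
  assumes C: "C \<in> \<C>"
  shows "valid C = restrictions X C"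
proof (intro subset_antisym subsetI)
  fix P assume P: "P \<in> valid C"
  obtain j where j: "C \<subseteq> D j"
    using exhaustion_covers[OF exhaustion convex_finite[OF C] convex_subset[OF C]] .
  obtain Q where Q: "Q \<in> valid (D j)" "restrict Q C = P"
    using valid_extends[OF C D_facts(2) j P] .
  have "0 < card (valid (D j))" using Q(1) finite_valid[OF D_facts(4)] by (auto simp: card_gt_0_iff)
  then have "measure coin_space {\<omega>. restrict (\<xi> \<omega>) (D j) = Q} \<noteq> 0"
    unfolding measure_\<xi>_event[OF Q(1)] by simp
  then obtain \<omega> where "restrict (\<xi> \<omega>) (D j) = Q"
    by (metis (mono_tags, lifting) Collect_empty_eq measure_empty)
  moreover have "restrict (restrict (\<xi> \<omega>) (D j)) C = restrict (\<xi> \<omega>) C"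
    using j by (simp add: Int_absorb1)
  ultimately show "P \<in> restrictions X C"
    unfolding restrictions_def using Q(2) \<xi>_in_sft by (metis imageI)
next
  fix P assume "P \<in> restrictions X C"
  then obtain x where "x \<in> valid (carrier G)" "P = restrict x C"
    unfolding restrictions_def sft_eq_valid by blast
  then show "P \<in> valid C" using valid_restrict convex_subset[OF C] by blast
qed

end

section \<open>Cylinders generate the Borel sets\<close>

context tep_sft
begin

lemma sft_PiE: "x \<in> X \<Longrightarrow> x \<in> carrier G \<rightarrow>\<^sub>E A"
  by (simp add: sft_def)

lemma restrict_sft_PiE: "x \<in> X \<Longrightarrow> C \<subseteq> carrier G \<Longrightarrow> restrict x C \<in> C \<rightarrow>\<^sub>E A"
  using sft_PiE by (auto simp: PiE_iff)

lemma topspace_config: "topspace (config_topology G A X) = X"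
  using sft_PiE by (auto simp: config_topology_def)

lemma sets_borel_sigma_config:
  "sets (borel_sigma (config_topology G A X)) = sigma_sets X {U. openin (config_topology G A X) U}"
  unfolding borel_sigma_def topspace_config
  using openin_subset[of "config_topology G A X"] by (intro sets_measure_of) (auto simp: topspace_config)

definition cylinder :: "'g set \<Rightarrow> ('g \<Rightarrow> 'a) \<Rightarrow> ('g \<Rightarrow> 'a) set" where
  "cylinder C P = {x \<in> X. restrict x C = P}"

lemma openin_cylinder:
  assumes C: "finite C" "C \<subseteq> carrier G"
  shows "openin (config_topology G A X) (cylinder C P)"
proof (cases "P \<in> C \<rightarrow>\<^sub>E A")
  case True
  let ?U = "\<lambda>g. if g \<in> C then {P g} else A"
  have "openin (product_topology (\<lambda>_. discrete_topology A) (carrier G)) (PiE (carrier G) ?U)"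
  proof -
    have "finite {g \<in> carrier G. ?U g \<noteq> A}" by (rule finite_subset[OF _ C(1)]) auto
    then show ?thesis using True C by (auto simp: openin_PiE_gen PiE_iff)
  qed
  moreover have "cylinder C P = PiE (carrier G) ?U \<inter> X"
  proof -
    have "restrict x C = P \<longleftrightarrow> x \<in> PiE (carrier G) ?U" if "x \<in> X" for x
    proof -
      have "restrict x C = P \<longleftrightarrow> (\<forall>g\<in>C. x g = P g)"
        using True by (auto simp: fun_eq_iff PiE_def extensional_def)
      then show ?thesis using sft_PiE[OF that] C(2) by (auto simp: PiE_iff)
    qed
    then show ?thesis unfolding cylinder_def by auto
  qed
  ultimately show ?thesis
    unfolding config_topology_def openin_subtopology by blast
next
  case False
  then have "cylinder C P = {}" unfolding cylinder_def using restrict_sft_PiE C(2) by blast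
  then show ?thesis by simp
qed

lemma open_cylinder_neighbourhood:
  assumes D: "exhaustion D" and U: "openin (config_topology G A X) U" and x: "x \<in> U"
  obtains j where "cylinder (D j) (restrict x (D j)) \<subseteq> U"
proof -
  obtain T where T: "openin (product_topology (\<lambda>_. discrete_topology A) (carrier G)) T" "U = T \<inter> X"
    using U unfolding config_topology_def openin_subtopology by blast
  obtain B where B: "finite {g \<in> carrier G. B g \<noteq> A}" "x \<in> PiE (carrier G) B" "PiE (carrier G) B \<subseteq> T"
    using T x unfolding openin_product_topology_alt by auto
  obtain j where j: "{g \<in> carrier G. B g \<noteq> A} \<subseteq> D j"
    using exhaustion_covers[OF D B(1)] by blast
  have "y \<in> PiE (carrier G) B" if y: "y \<in> cylinder (D j) (restrict x (D j))" for y
  proof (rule PiE_I)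
    have y': "y \<in> carrier G \<rightarrow>\<^sub>E A" "\<And>g. g \<in> D j \<Longrightarrow> y g = x g"
      using y sft_PiE unfolding cylinder_def by (auto simp: fun_eq_iff restrict_def) metis
    show "y g \<in> B g" if "g \<in> carrier G" for g
    proof (cases "g \<in> D j")
      case True
      then show ?thesis using y'(2) B(2) that by auto
    next
      case False
      then have "B g = A" using j that by blast
      then show ?thesis using y'(1) that by auto
    qed
    show "y g = undefined" if "g \<notin> carrier G" for g using y'(1) that by auto
  qed
  then have "cylinder (D j) (restrict x (D j)) \<subseteq> U"
    using B(3) T(2) unfolding cylinder_def by blast
  then show thesis by (rule that)
qed

text \<open>
  Along an exhaustion two cylinders are nested or disjoint. Together with the empty set they
  are closed under intersection, as is needed for a generator that determines a measure.
\<close>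

definition cylinders :: "(nat \<Rightarrow> 'g set) \<Rightarrow> ('g \<Rightarrow> 'a) set set" where
  "cylinders D = insert {} {cylinder (D j) P | j P. True}"

text \<open>
  There are only countably many cylinders over the sets of an exhaustion, and each open set is the
  union of the cylinders that it contains.
\<close>

lemma sets_borel_sigma_cylinders:
  assumes D: "exhaustion D"
  shows "sets (borel_sigma (config_topology G A X)) = sigma_sets X (cylinders D)"
  unfolding sets_borel_sigma_config
proof (rule sigma_sets_eqI)
  have D': "finite (D j)" "D j \<subseteq> carrier G" for j
    using D convex_finite convex_subset unfolding exhaustion_def by auto
  fix c assume "c \<in> cylinders D"
  then have "openin (config_topology G A X) c"
    unfolding cylinders_def using openin_cylinder[OF D'] by auto
  then show "c \<in> sigma_sets X {U. openin (config_topology G A X) U}" by auto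
next
  have D': "finite (D j)" "D j \<subseteq> carrier G" for j
    using D convex_finite convex_subset unfolding exhaustion_def by auto
  fix U assume "U \<in> {U. openin (config_topology G A X) U}"
  then have U: "openin (config_topology G A X) U" by simp
  let ?K = "{p \<in> (SIGMA j:UNIV. D j \<rightarrow>\<^sub>E A). cylinder (D (fst p)) (snd p) \<subseteq> U}"
  have "countable (SIGMA j:UNIV. D j \<rightarrow>\<^sub>E A)"
    by (rule countable_SIGMA, simp, intro countable_finite finite_PiE D'(1) family_facts(5))
  then have K: "countable ?K" by (rule countable_subset[rotated]) auto
  have "U = (\<Union>p\<in>?K. cylinder (D (fst p)) (snd p))"
  proof (intro subset_antisym subsetI)
    fix x assume x: "x \<in> U"
    then have "x \<in> X" using openin_subset[OF U] topspace_config by auto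
    obtain j where j: "cylinder (D j) (restrict x (D j)) \<subseteq> U"
      using open_cylinder_neighbourhood[OF D U x] .
    then have "(j, restrict x (D j)) \<in> ?K" using restrict_sft_PiE[OF \<open>x \<in> X\<close> D'(2)] by auto
    moreover have "x \<in> cylinder (D j) (restrict x (D j))" using \<open>x \<in> X\<close> by (simp add: cylinder_def)
    ultimately show "x \<in> (\<Union>p\<in>?K. cylinder (D (fst p)) (snd p))"
      by (intro UN_I[of "(j, restrict x (D j))"]) simp_all
  qed auto
  moreover have "(\<Union>p\<in>?K. cylinder (D (fst p)) (snd p)) \<in> sigma_sets X (cylinders D)"
  proof (rule sigma_sets_UNION)
    show "countable ((\<lambda>p. cylinder (D (fst p)) (snd p)) ` ?K)" using K by simp
    show "c \<in> sigma_sets X (cylinders D)" if "c \<in> (\<lambda>p. cylinder (D (fst p)) (snd p)) ` ?K" for c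
      using that unfolding cylinders_def by (auto intro!: sigma_sets.Basic)
  qed
  ultimately show "U \<in> sigma_sets X (cylinders D)" by simp
qed

lemma cylinder_in_sets:
  assumes "finite C" "C \<subseteq> carrier G"
  shows "cylinder C P \<in> sets (borel_sigma (config_topology G A X))"
  unfolding sets_borel_sigma_config using openin_cylinder[OF assms] by auto

lemma Int_stable_cylinders:
  assumes D: "exhaustion D"
  shows "Int_stable (cylinders D)"
proof -
  have nested: "cylinder (D i) P \<inter> cylinder (D j) Q \<in> cylinders D" if "i \<le> j" for i j P Q
  proof -
    have "restrict x (D i) = restrict (restrict x (D j)) (D i)" for x :: "'g \<Rightarrow> 'a"
      using exhaustion_mono[OF D that] by (auto simp: fun_eq_iff restrict_def)
    then have "cylinder (D i) P \<inter> cylinder (D j) Q = (if restrict Q (D i) = P then cylinder (D j) Q else {})"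
      unfolding cylinder_def by auto
    then show ?thesis unfolding cylinders_def by auto
  qed
  have "c \<inter> d \<in> cylinders D" if cd: "c \<in> cylinders D" "d \<in> cylinders D" for c d
  proof (cases "c = {} \<or> d = {}")
    case True
    then show ?thesis unfolding cylinders_def by auto
  next
    case False
    then obtain i P j Q where "c = cylinder (D i) P" "d = cylinder (D j) Q"
      using cd unfolding cylinders_def by blast
    then show ?thesis using nested[of i j P Q] nested[of j i Q P] by (simp add: Int_commute linear) (metis Int_commute linear)
  qed
  then show ?thesis unfolding Int_stable_def by blast
qed

text \<open>
  If the pattern on the convex set \<open>E\<close> is uniform, then the probability of a pattern on a subset is
  the proportion of the valid patterns on \<open>E\<close> that extend it. The random configuration \<open>f\<close> may live
  on any space: the lemma is used for the coin sequences and for the subshift itself.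
\<close>

lemma measure_pattern_event:
  assumes N: "finite_measure N" and f: "\<And>w. w \<in> space N \<Longrightarrow> f w \<in> X"
    and E: "E \<in> \<C>" and C: "C \<subseteq> E"
    and meas: "\<And>Q. Q \<in> valid E \<Longrightarrow> {w \<in> space N. restrict (f w) E = Q} \<in> sets N"
    and uniform: "\<And>Q. Q \<in> valid E \<Longrightarrow> measure N {w \<in> space N. restrict (f w) E = Q} = 1 / card (valid E)"
  shows "measure N {w \<in> space N. restrict (f w) C = P} = card (extensions C E P) / card (valid E)"
proof -
  interpret finite_measure N by fact
  have "restrict (f w) E \<in> valid E" if "w \<in> space N" for w
    using valid_restrict[of "f w" "carrier G" E] f[OF that] convex_subset[OF E] by (simp add: sft_eq_valid)
  moreover have "restrict (restrict (f w) E) C = restrict (f w) C" for w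
    using C by (auto simp: fun_eq_iff restrict_def)
  ultimately have "{w \<in> space N. restrict (f w) C = P} =
      (\<Union>Q\<in>extensions C E P. {w \<in> space N. restrict (f w) E = Q})"
    unfolding extensions_def by auto
  moreover have fin: "finite (extensions C E P)"
    using finite_valid[OF convex_finite[OF E]] unfolding extensions_def by simp
  then have "measure N (\<Union>Q\<in>extensions C E P. {w \<in> space N. restrict (f w) E = Q}) =
      (\<Sum>Q\<in>extensions C E P. measure N {w \<in> space N. restrict (f w) E = Q})"
    using meas unfolding extensions_def
    by (intro finite_measure_finite_Union) (auto simp: disjoint_family_on_def)
  moreover have "\<dots> = (\<Sum>Q\<in>extensions C E P. 1 / card (valid E))"
    by (intro sum.cong refl uniform) (simp add: extensions_def)
  ultimately show ?thesis by simp
qed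

end

context exhausted_tep_sft
begin

lemma \<xi>_measurable: "\<xi> \<in> measurable coin_space (borel_sigma (config_topology G A X))"
proof (rule measurable_sigma_sets[OF sets_borel_sigma_cylinders[OF exhaustion]])
  show "cylinders D \<subseteq> Pow X" unfolding cylinders_def cylinder_def by auto
  show "\<xi> \<in> space coin_space \<rightarrow> X" using \<xi>_in_sft by simp
  fix c assume "c \<in> cylinders D"
  moreover have "\<xi> -` cylinder (D j) P \<inter> space coin_space \<in> sets coin_space" for j P
  proof (cases "P \<in> valid (D j)")
    case True
    have "\<xi> -` cylinder (D j) P \<inter> space coin_space = {\<omega>. restrict (\<xi> \<omega>) (D j) = P}"
      using \<xi>_in_sft by (auto simp: cylinder_def)
    then show ?thesis unfolding \<xi>_event[OF True] using state_event by simp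
  next
    case False
    then have "\<xi> -` cylinder (D j) P \<inter> space coin_space = {}"
      using pattern_at(1) by (auto simp: cylinder_def \<xi>_restrict)
    then show ?thesis by simp
  qed
  ultimately show "\<xi> -` c \<inter> space coin_space \<in> sets coin_space" unfolding cylinders_def by auto
qed

text \<open>
  For a convex set \<open>C\<close> inside some \<open>D j\<close>, each valid pattern on \<open>C\<close> has the same number of extensions to
  \<open>D j\<close>, so the marginal on \<open>C\<close> inherits uniformity from the one on \<open>D j\<close>.
\<close>

lemma tep_measure_\<xi>:
  "tep_measure G \<C> S A \<T> (distr coin_space (borel_sigma (config_topology G A X)) \<xi>)" (is "tep_measure _ _ _ _ _ ?\<mu>")
proof -
  let ?B = "borel_sigma (config_topology G A X)"
  have space_B: "space ?B = X" by (simp add: borel_sigma_def topspace_config space_measure_of_conv)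
  have "borel_prob_on G A X ?\<mu>"
    unfolding borel_prob_on_def using coin.prob_space_distr[OF \<xi>_measurable] by (simp add: space_B)
  moreover have "uniform_marginals \<C> A X ?\<mu>"
    unfolding uniform_marginals_def
  proof (intro ballI)
    fix C P assume C: "C \<in> \<C>" and P: "P \<in> C \<rightarrow>\<^sub>E A"
    obtain j where j: "C \<subseteq> D j"
      using exhaustion_covers[OF exhaustion convex_finite[OF C] convex_subset[OF C]] .
    have "marginal ?\<mu> C P = measure ?\<mu> (cylinder C P)"
      by (simp add: marginal_def cylinder_def space_B)
    also have "\<dots> = measure coin_space (\<xi> -` cylinder C P \<inter> space coin_space)"
      by (rule measure_distr[OF \<xi>_measurable cylinder_in_sets[OF convex_finite[OF C] convex_subset[OF C]]])
    also have "\<xi> -` cylinder C P \<inter> space coin_space = {\<omega> \<in> space coin_space. restrict (\<xi> \<omega>) C = P}"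
      using \<xi>_in_sft by (auto simp: cylinder_def)
    also have "measure coin_space \<dots> = card (extensions C (D j) P) / card (valid (D j))"
    proof (rule measure_pattern_event[OF _ \<xi>_in_sft D_facts(2) j])
      show "finite_measure coin_space" by unfold_locales
    qed (use measure_\<xi>_event state_event in \<open>simp_all add: \<xi>_event\<close>)
    finally have *: "marginal ?\<mu> C P = card (extensions C (D j) P) / card (valid (D j))" .
    show "marginal ?\<mu> C P = (if P \<in> restrictions X C then 1 / real (card (restrictions X C)) else 0)"
    proof (cases "P \<in> valid C")
      case True
      have card: "card (valid (D j)) = card (valid C) * card (extensions C (D j) P)"
        by (rule card_valid_extensions[OF C D_facts(2) j True])
      obtain n where "n > 0" "\<forall>P\<in>valid C. card (extensions C (D j) P) = n"
        using extensions_uniform[OF C D_facts(2) j] by blast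
      then have "card (extensions C (D j) P) > 0" using True by simp
      then show ?thesis using True by (simp add: * card valid_eq_restrictions[OF C, symmetric])
    next
      case False
      then have "extensions C (D j) P = {}"
        using valid_restrict[OF _ j] unfolding extensions_def by blast
      then show ?thesis using False by (simp add: * valid_eq_restrictions[OF C, symmetric])
    qed
  qed
  ultimately show ?thesis unfolding tep_measure_def by blast
qed

end

section \<open>Uniqueness and invariance\<close>

locale countable_tep_sft = tep_sft G \<C> S A k \<T>
  for G :: "('g, 'm) monoid_scheme" (structure) and \<C> S and A :: "'a set" and k \<T> +
  assumes countable_group: "countable (carrier G)"
begin

text \<open>
  For the mere existence of the measure any injective codes will do, and countability provides
  some.
\<close>

lemma exhausted_codes:
  assumes D: "exhaustion D"
  obtains m where "exhausted_tep_sft G \<C> S A k \<T> (\<lambda>g. [to_nat_on (carrier G) g]) (to_nat_on A) D m"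
proof -
  let ?enc = "\<lambda>g. [to_nat_on (carrier G) g]"
  let ?\<alpha> = "to_nat_on A"
  have "\<exists>m. \<forall>n\<in>(\<lambda>p. prod_encode (elem_code ?enc (fst p), ?\<alpha> (snd p))) ` (D (Suc j) \<times> A). n < m" for j
  proof -
    have "finite (D (Suc j) \<times> A)"
      using D convex_finite family_facts(5) unfolding exhaustion_def by blast
    then show ?thesis using finite_nat_set_iff_bounded finite_imageI by blast
  qed
  from choice[OF allI, OF this] obtain m where
    m: "\<forall>j. \<forall>n\<in>(\<lambda>p. prod_encode (elem_code ?enc (fst p), ?\<alpha> (snd p))) ` (D (Suc j) \<times> A). n < m j" ..
  have "exhausted_tep_sft G \<C> S A k \<T> ?enc ?\<alpha> D m"
  proof unfold_locales
    show "inj_on ?enc (carrier G)" using inj_on_to_nat_on[OF countable_group] by (simp add: inj_on_def)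
    show "inj_on ?\<alpha> A" using family_facts(5) by (intro inj_on_to_nat_on countable_finite)
    show "exhaustion D" by (rule D)
    show "prod_encode (elem_code ?enc g, ?\<alpha> a) < m j" if "g \<in> D (Suc j)" "a \<in> A" for g j a
      using m[rule_format, of "prod_encode (elem_code ?enc g, ?\<alpha> a)" j] that by force
  qed
  then show thesis by (rule that)
qed

lemma exhausted_tep_sft_exists:
  obtains \<alpha> D m where "exhausted_tep_sft G \<C> S A k \<T> (\<lambda>g. [to_nat_on (carrier G) g]) \<alpha> D m"
  by (rule exhaustion_exists[OF countable_group]) (erule exhausted_codes)

lemma restrictions_eq_valid:
  assumes "C \<in> \<C>"
  shows "restrictions X C = valid C"
proof -
  obtain \<alpha> D m where "exhausted_tep_sft G \<C> S A k \<T> (\<lambda>g. [to_nat_on (carrier G) g]) \<alpha> D m"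
    by (rule exhausted_tep_sft_exists)
  then interpret exhausted_tep_sft G \<C> S A k \<T> "\<lambda>g. [to_nat_on (carrier G) g]" \<alpha> D m .
  show ?thesis by (rule valid_eq_restrictions[OF assms, symmetric])
qed

lemma tep_measure_exists: "\<exists>\<mu>. tep_measure G \<C> S A \<T> \<mu>"
proof -
  obtain \<alpha> D m where "exhausted_tep_sft G \<C> S A k \<T> (\<lambda>g. [to_nat_on (carrier G) g]) \<alpha> D m"
    by (rule exhausted_tep_sft_exists)
  then interpret exhausted_tep_sft G \<C> S A k \<T> "\<lambda>g. [to_nat_on (carrier G) g]" \<alpha> D m .
  show ?thesis using tep_measure_\<xi> by blast
qed

lemma tep_measure_facts:
  assumes "tep_measure G \<C> S A \<T> \<mu>"
  shows "prob_space \<mu>" "space \<mu> = X" "sets \<mu> = sets (borel_sigma (config_topology G A X))"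
    and "\<And>C P. C \<in> \<C> \<Longrightarrow> P \<in> C \<rightarrow>\<^sub>E A \<Longrightarrow>
      measure \<mu> (cylinder C P) = (if P \<in> valid C then 1 / card (valid C) else 0)"
  using assms restrictions_eq_valid
  unfolding tep_measure_def borel_prob_on_def uniform_marginals_def marginal_def cylinder_def by auto

text \<open>
  The marginals prescribe the measure on the cylinders over convex sets of an exhaustion.
\<close>

lemma tep_measure_unique:
  assumes \<mu>: "tep_measure G \<C> S A \<T> \<mu>" and \<nu>: "tep_measure G \<C> S A \<T> \<nu>"
  shows "\<mu> = \<nu>"
proof -
  obtain D where D: "exhaustion D" using exhaustion_exists[OF countable_group] .
  interpret \<mu>: prob_space \<mu> by (rule tep_measure_facts(1)[OF \<mu>])
  interpret \<nu>: prob_space \<nu> by (rule tep_measure_facts(1)[OF \<nu>])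
  have D': "D j \<in> \<C>" "D 0 = {}" for j using D unfolding exhaustion_def by auto
  show ?thesis
  proof (rule measure_eqI_generator_eq[where E = "cylinders D" and \<Omega> = X and A = "\<lambda>_. X"])
    show "Int_stable (cylinders D)" by (rule Int_stable_cylinders[OF D])
    show "cylinders D \<subseteq> Pow X" unfolding cylinders_def cylinder_def by auto
    show "sets \<mu> = sigma_sets X (cylinders D)" "sets \<nu> = sigma_sets X (cylinders D)"
      using tep_measure_facts(3) \<mu> \<nu> sets_borel_sigma_cylinders[OF D] by auto
    have "X = cylinder (D 0) (\<lambda>_. undefined)" unfolding cylinder_def D'(2) by (auto simp: restrict_def)
    then show "range (\<lambda>_. X) \<subseteq> cylinders D" unfolding cylinders_def by blast
    show "emeasure \<mu> X \<noteq> \<infinity>" by simp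
    fix c assume "c \<in> cylinders D"
    then consider "c = {}" | j P where "c = cylinder (D j) P" unfolding cylinders_def by blast
    then show "emeasure \<mu> c = emeasure \<nu> c"
    proof cases
      case 2
      show ?thesis
      proof (cases "P \<in> D j \<rightarrow>\<^sub>E A")
        case True
        then show ?thesis
          using tep_measure_facts(4)[OF \<mu> D'(1) True] tep_measure_facts(4)[OF \<nu> D'(1) True]
          by (simp add: 2 \<mu>.emeasure_eq_measure \<nu>.emeasure_eq_measure)
      next
        case False
        then have "c = {}" unfolding 2 cylinder_def using restrict_sft_PiE convex_subset[OF D'(1)] by blast
        then show ?thesis by simp
      qed
    qed simp
  qed auto
qed

lemma tep_measure_pattern:
  assumes \<mu>: "tep_measure G \<C> S A \<T> \<mu>" and E: "E \<in> \<C>" and C: "C \<subseteq> E"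
  shows "measure \<mu> (cylinder C P) = card (extensions C E P) / card (valid E)"
proof -
  interpret prob_space \<mu> by (rule tep_measure_facts(1)[OF \<mu>])
  have "measure \<mu> {x \<in> space \<mu>. restrict x C = P} = card (extensions C E P) / card (valid E)"
  proof (rule measure_pattern_event[OF _ _ E C])
    show "finite_measure \<mu>" by unfold_locales
    show "x \<in> X" if "x \<in> space \<mu>" for x using that tep_measure_facts(2)[OF \<mu>] by simp
    fix Q assume "Q \<in> valid E"
    then show "measure \<mu> {x \<in> space \<mu>. restrict x E = Q} = 1 / card (valid E)"
      using tep_measure_facts(4)[OF \<mu> E, of Q] valid_PiE unfolding tep_measure_facts(2)[OF \<mu>] cylinder_def by auto
    show "{x \<in> space \<mu>. restrict x E = Q} \<in> sets \<mu>"
      using cylinder_in_sets[OF convex_finite[OF E] convex_subset[OF E], of Q]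
      unfolding tep_measure_facts(2,3)[OF \<mu>] cylinder_def by simp
  qed
  then show ?thesis unfolding tep_measure_facts(2)[OF \<mu>] cylinder_def by simp
qed

definition translate :: "'g \<Rightarrow> 'g set \<Rightarrow> ('g \<Rightarrow> 'a) \<Rightarrow> 'g \<Rightarrow> 'a" where
  "translate u C P = (\<lambda>h\<in>u <# C. P (inv u \<otimes> h))"

lemma in_translate_iff:
  assumes "u \<in> carrier G" "C \<subseteq> carrier G" "h \<in> carrier G"
  shows "h \<in> u <# C \<longleftrightarrow> inv u \<otimes> h \<in> C"
proof
  assume "h \<in> u <# C"
  then obtain c where "c \<in> C" "h = u \<otimes> c" unfolding l_coset_def by blast
  then show "inv u \<otimes> h \<in> C" using assms by (auto simp: m_assoc[symmetric] subset_iff)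
next
  assume "inv u \<otimes> h \<in> C"
  moreover have "h = u \<otimes> (inv u \<otimes> h)" using assms by (simp add: m_assoc[symmetric])
  ultimately show "h \<in> u <# C" unfolding l_coset_def by blast
qed

lemma translate_valid:
  assumes u: "u \<in> carrier G" and C: "C \<subseteq> carrier G" and P: "P \<in> valid C"
  shows "translate u C P \<in> valid (u <# C)"
  unfolding valid_def
proof (intro CollectI conjI ballI impI)
  have sub: "u <# C \<subseteq> carrier G" by (rule l_coset_subset_G[OF C u])
  then have *: "inv u \<otimes> h \<in> C" if "h \<in> u <# C" for h
    using that in_translate_iff[OF u C] by blast
  then show "translate u C P \<in> (u <# C) \<rightarrow>\<^sub>E A"
    using valid_PiE[OF P] unfolding translate_def by auto
  fix g assume g: "g \<in> carrier G" "g <# S \<subseteq> u <# C"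
  have assoc: "inv u \<otimes> (g \<otimes> s) = (inv u \<otimes> g) \<otimes> s" if "s \<in> S" for s
    using that u g(1) family_facts(3) by (auto simp: m_assoc)
  have "(inv u \<otimes> g) <# S \<subseteq> C"
  proof
    fix h assume "h \<in> (inv u \<otimes> g) <# S"
    then obtain s where s: "s \<in> S" "h = inv u \<otimes> (g \<otimes> s)" using assoc unfolding translate_eq by auto
    then have "g \<otimes> s \<in> u <# C" using g(2) unfolding translate_eq[of g] by blast
    then show "h \<in> C" unfolding s(2) by (rule *)
  qed
  then have "(\<lambda>s\<in>S. P (inv u \<otimes> g \<otimes> s)) \<in> \<T>"
    using P u g(1) unfolding valid_def by auto
  moreover have "(\<lambda>s\<in>S. translate u C P (g \<otimes> s)) = (\<lambda>s\<in>S. P (inv u \<otimes> g \<otimes> s))"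
    using g(2) assoc unfolding translate_def translate_eq[of g] by (auto simp: fun_eq_iff restrict_def)
  ultimately show "(\<lambda>s\<in>S. translate u C P (g \<otimes> s)) \<in> \<T>" by simp
qed

lemma translate_back:
  assumes u: "u \<in> carrier G" and C: "C \<subseteq> carrier G"
  shows "inv u <# (u <# C) = C"
  using lcos_m_assoc[OF C inv_closed[OF u] u] u C by (simp add: lcos_mult_one)

lemma translate_inverse:
  assumes u: "u \<in> carrier G" and C: "C \<subseteq> carrier G" and P: "P \<in> C \<rightarrow>\<^sub>E A"
  shows "translate (inv u) (u <# C) (translate u C P) = P"
proof -
  have "u \<otimes> h \<in> u <# C \<and> inv u \<otimes> (u \<otimes> h) = h" if "h \<in> C" for h
    using that u C unfolding l_coset_def by (auto simp: m_assoc[symmetric] subset_iff)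
  then show ?thesis
    unfolding translate_def translate_back[OF u C]
    using u P by (auto simp: fun_eq_iff restrict_def PiE_def extensional_def)
qed

lemma card_valid_translate:
  assumes u: "u \<in> carrier G" and C: "C \<subseteq> carrier G"
  shows "card (valid (u <# C)) = card (valid C)"
proof -
  have sub: "u <# C \<subseteq> carrier G" by (rule l_coset_subset_G[OF C u])
  have iu: "inv u \<in> carrier G" using u by simp
  have "bij_betw (translate u C) (valid C) (valid (u <# C))"
  proof (rule bij_betw_byWitness[where f' = "translate (inv u) (u <# C)"])
    show "\<forall>P\<in>valid C. translate (inv u) (u <# C) (translate u C P) = P"
      using translate_inverse[OF u C] valid_PiE by blast
    show "\<forall>P\<in>valid (u <# C). translate u C (translate (inv u) (u <# C) P) = P"
      using translate_inverse[OF iu sub valid_PiE] unfolding translate_back[OF u C] inv_inv[OF u] by blast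
    show "translate u C ` valid C \<subseteq> valid (u <# C)" using translate_valid[OF u C] by blast
    show "translate (inv u) (u <# C) ` valid (u <# C) \<subseteq> valid C"
      using translate_valid[OF iu sub] unfolding translate_back[OF u C] by blast
  qed
  then show ?thesis by (simp add: bij_betw_same_card)
qed

lemma shift_in_sft:
  assumes g: "g \<in> carrier G" and x: "x \<in> X"
  shows "shift_action G g x \<in> X"
proof -
  have "g <# carrier G = carrier G"
    using in_translate_iff[OF g subset_refl] l_coset_subset_G[OF subset_refl g] g by auto
  then have "shift_action G g x = translate g (carrier G) x"
    unfolding shift_action_def translate_def by simp
  then show ?thesis
    using translate_valid[OF g subset_refl, of x] x \<open>g <# carrier G = carrier G\<close>
    unfolding sft_eq_valid by simp
qed

lemma cylinder_vimage_shift: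
  assumes g: "g \<in> carrier G" and C: "C \<subseteq> carrier G" and P: "P \<in> C \<rightarrow>\<^sub>E A"
  shows "shift_action G g -` cylinder C P \<inter> X = cylinder (inv g <# C) (translate (inv g) C P)"
proof -
  have "restrict (shift_action G g x) C = P \<longleftrightarrow> restrict x (inv g <# C) = translate (inv g) C P" for x
  proof -
    have "restrict (shift_action G g x) C = P \<longleftrightarrow> (\<forall>h\<in>C. x (inv g \<otimes> h) = P h)"
      using P C unfolding shift_action_def
      by (auto simp: fun_eq_iff restrict_def PiE_def extensional_def subset_iff)
    also have "\<dots> \<longleftrightarrow> (\<forall>h\<in>C. x (inv g \<otimes> h) = P (g \<otimes> (inv g \<otimes> h)))"
      using g C by (auto simp: m_assoc[symmetric] subset_iff)
    also have "\<dots> \<longleftrightarrow> (\<forall>h\<in>inv g <# C. x h = P (g \<otimes> h))"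
      unfolding l_coset_def by auto
    also have "\<dots> \<longleftrightarrow> restrict x (inv g <# C) = translate (inv g) C P"
      unfolding translate_def inv_inv[OF g] by (auto simp: fun_eq_iff restrict_def)
    finally show ?thesis .
  qed
  then show ?thesis using shift_in_sft[OF g] unfolding cylinder_def by auto
qed

text \<open>
  The image of the measure under \<open>g\<close> has the marginals of the original measure on the translates
  \<open>inv g <# C\<close>. These are convex as well, and translation is a bijection between the valid patterns
  on \<open>C\<close> and on \<open>inv g <# C\<close>. So the image has uniform marginals, too, and uniqueness applies.
\<close>

lemma tep_measure_invariant:
  assumes inv: "invariant_convexoid G \<C>" and \<mu>: "tep_measure G \<C> S A \<T> \<mu>"
  shows "shift_invariant G \<mu>"
  unfolding shift_invariant_def
proof (intro ballI conjI)
  fix g assume g: "g \<in> carrier G"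
  obtain D where D: "exhaustion D" using exhaustion_exists[OF countable_group] .
  have D': "D j \<in> \<C>" for j using D unfolding exhaustion_def by auto
  have preimage: "shift_action G g -` cylinder C P \<inter> X \<in> sets \<mu>" if C: "C \<in> \<C>" and P: "P \<in> C \<rightarrow>\<^sub>E A" for C P
  proof -
    have "inv g <# C \<in> \<C>" using inv g C unfolding invariant_convexoid_def by simp
    then show ?thesis
      unfolding cylinder_vimage_shift[OF g convex_subset[OF C] P] tep_measure_facts(3)[OF \<mu>]
      by (intro cylinder_in_sets convex_finite convex_subset)
  qed
  have sets_\<mu>: "sets \<mu> = sigma_sets X (cylinders D)"
    using tep_measure_facts(3)[OF \<mu>] sets_borel_sigma_cylinders[OF D] by simp
  show meas: "shift_action G g \<in> measurable \<mu> \<mu>"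
  proof (rule measurable_sigma_sets[OF sets_\<mu>])
    show "cylinders D \<subseteq> Pow X" unfolding cylinders_def cylinder_def by auto
    show "shift_action G g \<in> space \<mu> \<rightarrow> X" using shift_in_sft[OF g] tep_measure_facts(2)[OF \<mu>] by auto
    fix c assume "c \<in> cylinders D"
    then consider "c = {}" | j P where "c = cylinder (D j) P" unfolding cylinders_def by blast
    then show "shift_action G g -` c \<inter> space \<mu> \<in> sets \<mu>"
    proof cases
      case 2
      show ?thesis
      proof (cases "P \<in> D j \<rightarrow>\<^sub>E A")
        case True
        then show ?thesis unfolding 2 tep_measure_facts(2)[OF \<mu>] by (rule preimage[OF D'])
      next
        case False
        then have "c = {}" unfolding 2 cylinder_def using restrict_sft_PiE convex_subset[OF D'] by blast
        then show ?thesis by simp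
      qed
    qed simp
  qed
  interpret prob_space \<mu> by (rule tep_measure_facts(1)[OF \<mu>])
  have "tep_measure G \<C> S A \<T> (distr \<mu> \<mu> (shift_action G g))"
    unfolding tep_measure_def borel_prob_on_def uniform_marginals_def
  proof (intro conjI ballI)
    show "prob_space (distr \<mu> \<mu> (shift_action G g))" by (rule prob_space_distr[OF meas])
    show "space (distr \<mu> \<mu> (shift_action G g)) = X"
      "sets (distr \<mu> \<mu> (shift_action G g)) = sets (borel_sigma (config_topology G A X))"
      using tep_measure_facts(2,3)[OF \<mu>] by simp_all
    fix C P assume C: "C \<in> \<C>" and P: "P \<in> C \<rightarrow>\<^sub>E A"
    note C' = convex_finite[OF C] convex_subset[OF C]
    have ig: "inv g \<in> carrier G" using g by simp
    have gC: "inv g <# C \<in> \<C>" using inv ig C unfolding invariant_convexoid_def by blast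
    have tP: "translate (inv g) C P \<in> (inv g <# C) \<rightarrow>\<^sub>E A"
      unfolding translate_def restrict_PiE_iff
    proof
      fix h assume h: "h \<in> inv g <# C"
      then have "inv (inv g) \<otimes> h \<in> C" using in_translate_iff[OF ig C'(2)] convex_subset[OF gC] by blast
      then show "P (inv (inv g) \<otimes> h) \<in> A" using P by (rule PiE_mem[rotated])
    qed
    have valid_iff: "translate (inv g) C P \<in> valid (inv g <# C) \<longleftrightarrow> P \<in> valid C"
    proof
      assume "translate (inv g) C P \<in> valid (inv g <# C)"
      from translate_valid[OF inv_closed[OF ig] convex_subset[OF gC] this]
      show "P \<in> valid C" unfolding translate_inverse[OF ig C'(2) P] translate_back[OF ig C'(2)] .
    qed (rule translate_valid[OF ig C'(2)])
    have "marginal (distr \<mu> \<mu> (shift_action G g)) C P = measure (distr \<mu> \<mu> (shift_action G g)) (cylinder C P)"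
      unfolding marginal_def cylinder_def by (simp add: tep_measure_facts(2)[OF \<mu>])
    also have "\<dots> = measure \<mu> (shift_action G g -` cylinder C P \<inter> space \<mu>)"
      using cylinder_in_sets[OF C'] by (intro measure_distr[OF meas]) (simp add: tep_measure_facts(3)[OF \<mu>])
    also have "\<dots> = measure \<mu> (cylinder (inv g <# C) (translate (inv g) C P))"
      unfolding tep_measure_facts(2)[OF \<mu>] cylinder_vimage_shift[OF g C'(2) P] ..
    also have "\<dots> = (if P \<in> restrictions X C then 1 / real (card (restrictions X C)) else 0)"
      using tep_measure_facts(4)[OF \<mu> gC tP] card_valid_translate[OF ig C'(2)]
      by (simp add: valid_iff restrictions_eq_valid[OF C])
    finally show "marginal (distr \<mu> \<mu> (shift_action G g)) C P =
        (if P \<in> restrictions X C then 1 / real (card (restrictions X C)) else 0)" .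
  qed
  then show "distr \<mu> \<mu> (shift_action G g) = \<mu>" using tep_measure_unique \<mu> by blast
qed

end

section \<open>Deciding validity of pattern codes\<close>

text \<open>
  Validity of a pattern in terms of codes: \<open>d\<close> describes the alphabet, the shape and the allowed
  patterns, \<open>D\<close> codes the domain. The first three conditions say that \<open>q\<close> codes the graph of a function
  from the domain to the alphabet. In the last one, the group elements \<open>g\<close> with \<open>g <# S \<subseteq> D\<close> are
  written as \<open>u \<otimes> inv s\<close> with \<open>u\<close> in the domain and \<open>s\<close> in the shape, so that all quantifiers range
  over coded finite sets.
\<close>

definition is_valid_code :: "(nat \<Rightarrow> nat) \<Rightarrow> (nat \<Rightarrow> nat) \<Rightarrow> nat \<Rightarrow> nat \<Rightarrow> nat \<Rightarrow> bool" where
  "is_valid_code mul inv_code d D q \<longleftrightarrow>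
    (\<forall>c\<in>set_decode q. pfst c \<in> set_decode D \<and> psnd c \<in> set_decode (pfst d)) \<and>
    (\<forall>u\<in>set_decode D. \<exists>c\<in>set_decode q. pfst c = u) \<and>
    (\<forall>c\<in>set_decode q. \<forall>c'\<in>set_decode q. pfst c = pfst c' \<longrightarrow> c = c') \<and>
    (\<forall>u\<in>set_decode D. \<forall>s\<in>set_decode (pfst (psnd d)).
      (\<forall>t\<in>set_decode (pfst (psnd d)).
        mul (prod_encode (mul (prod_encode (u, inv_code s)), t)) \<in> set_decode D) \<longrightarrow>
      (\<exists>r\<in>set_decode (psnd (psnd d)). \<forall>t\<in>set_decode (pfst (psnd d)). \<exists>a\<in>set_decode (pfst d).
        prod_encode (t, a) \<in> set_decode r \<and>
        prod_encode (mul (prod_encode (mul (prod_encode (u, inv_code s)), t)), a) \<in> set_decode q))"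

lemma decidable_is_valid_code:
  assumes "recursive_in Q (\<lambda>\<omega>. mul)" "recursive_in Q (\<lambda>\<omega>. inv_code)"
    and "recursive_in Q d" "recursive_in Q D" "recursive_in Q q"
  shows "decidable_in Q (\<lambda>\<omega> n. is_valid_code mul inv_code (d \<omega> n) (D \<omega> n) (q \<omega> n))"
proof -
  have "decidable_in Q (\<lambda>\<omega> p. is_valid_code mul inv_code (pfst p) (pfst (psnd p)) (psnd (psnd p)))"
    unfolding is_valid_code_def
    by (intro rec_intros recursive_compose[OF assms(1)] recursive_compose[OF assms(2)])
  then have "decidable_in Q (\<lambda>\<omega> n. (\<lambda>p. is_valid_code mul inv_code (pfst p) (pfst (psnd p)) (psnd (psnd p)))
      (prod_encode (d \<omega> n, prod_encode (D \<omega> n, q \<omega> n))))"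
    by (rule decidable_compose) (intro rec_intros assms)
  then show ?thesis by simp
qed

lemma triangle_mono: "m \<le> n \<Longrightarrow> triangle m \<le> triangle n"
  unfolding triangle_def by (intro div_le_mono mult_le_mono) auto

lemma prod_encode_strict_mono: "a < c \<Longrightarrow> b < d \<Longrightarrow> prod_encode (a, b) < prod_encode (c, d)"
  using triangle_mono[of "a + b" "c + d"] by (simp add: prod_encode_def)

lemma set_decode_finset_code: "finite C \<Longrightarrow> set_decode (finset_code enc C) = elem_code enc ` C"
  by (simp add: finset_code_def)

text \<open>
  The codes of the elements are decidable, and the operations of the group and the enumeration of
  the convexoid have been made total; \<open>enum w = 0\<close> stands for a step of the enumeration without
  result.
\<close>

locale coded_convexoid = group G for G :: "('g, 'm) monoid_scheme" (structure) +
  fixes \<C> :: "'g set set" and enc :: "'g \<Rightarrow> nat list" and mul inv_code enum :: "nat \<Rightarrow> nat"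
  assumes convexoid_coded: "convexoid G \<C>"
    and decidable_codes: "decidable_set (elem_code enc ` carrier G)"
    and recursive_mul: "partial_recursive (\<lambda>n. Some (mul n))"
    and recursive_inv_code: "partial_recursive (\<lambda>n. Some (inv_code n))"
    and recursive_enum: "partial_recursive (\<lambda>n. Some (enum n))"
    and mul_code: "g \<in> carrier G \<Longrightarrow> h \<in> carrier G \<Longrightarrow>
      mul (prod_encode (elem_code enc g, elem_code enc h)) = elem_code enc (g \<otimes> h)"
    and inv_code_eq: "g \<in> carrier G \<Longrightarrow> inv_code (elem_code enc g) = elem_code enc (inv g)"
    and enum_convexoid: "v \<in> finset_code enc ` \<C> \<longleftrightarrow> (\<exists>w. enum w = Suc v)"
begin

abbreviation codes :: "nat set" where "codes \<equiv> elem_code enc ` carrier G"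

lemmas [rec_intros] = recursive_compose[OF recursive_in_lift[OF recursive_mul]]
  recursive_compose[OF recursive_in_lift[OF recursive_inv_code]]
  recursive_compose[OF recursive_in_lift[OF recursive_enum]]
  decidable_compose[OF decidable_set_lift[OF decidable_codes]]

lemmas [rec_intros] = decidable_is_valid_code[OF recursive_in_lift[OF recursive_mul] recursive_in_lift[OF recursive_inv_code]]

text \<open>
  Numbers that are not codes of group elements are ignored, so that a covering set exists for every
  finite set of numbers and the search for it is total.
\<close>

definition covers :: "nat set \<Rightarrow> nat \<Rightarrow> bool" where
  "covers U w \<longleftrightarrow> enum w \<noteq> 0 \<and> (\<forall>u\<in>U. u \<in> codes \<longrightarrow> u \<in> set_decode (enum w - 1))"

lemma convexoid_finite: "C \<in> \<C> \<Longrightarrow> finite C"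
  and convexoid_cover: "finite F \<Longrightarrow> F \<subseteq> carrier G \<Longrightarrow> \<exists>C\<in>\<C>. F \<subseteq> C"
  using convexoid_coded by (simp_all add: convexoid_def)

lemma covers_exists:
  assumes "finite U"
  shows "\<exists>w. covers U w"
proof -
  have "finite (U \<inter> codes)" using assms by simp
  from finite_subset_image[OF this Int_lower2]
  obtain F where F: "F \<subseteq> carrier G" "finite F" "U \<inter> codes = elem_code enc ` F"
    by (elim exE conjE) (rule that)
  obtain C where C: "C \<in> \<C>" "F \<subseteq> C" using convexoid_cover[OF F(2,1)] by blast
  have "finite C" by (rule convexoid_finite[OF C(1)])
  obtain w where w: "enum w = Suc (finset_code enc C)" using enum_convexoid C(1) by blast
  have "u \<in> elem_code enc ` C" if "u \<in> U" "u \<in> codes" for u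
    using F(3) C(2) that by blast
  then have "covers U w"
    unfolding covers_def by (simp add: w set_decode_finset_code[OF \<open>finite C\<close>])
  then show ?thesis ..
qed

lemma least_cover:
  assumes "finite U" and "w = (LEAST w. covers U w)"
  obtains C where "C \<in> \<C>" "enum w - 1 = finset_code enc C"
    "\<And>u. u \<in> U \<Longrightarrow> u \<in> codes \<Longrightarrow> u \<in> elem_code enc ` C"
proof -
  have w: "covers U w" unfolding assms(2) by (rule LeastI_ex[OF covers_exists[OF assms(1)]])
  then obtain v where v: "enum w = Suc v" unfolding covers_def by (auto simp: gr0_conv_Suc)
  then obtain C where C: "C \<in> \<C>" "v = finset_code enc C" using enum_convexoid by blast
  then have "finite C" using convexoid_finite by blast
  with w show thesis
    by (intro that[OF C(1)]) (auto simp: v C(2) covers_def set_decode_finset_code)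
qed

text \<open>
  The code of a convex set that contains the domain, if \<open>n\<close> is the code of a pattern.
\<close>

definition covering :: "nat \<Rightarrow> nat" where
  "covering n = enum (LEAST w. covers (pfst ` set_decode n) w) - 1"

text \<open>
  Codes of the sets of an exhaustion. The step \<open>j\<close> adds the group element with code \<open>j\<close> if there is
  one, hence every group element is reached.
\<close>

definition chain :: "nat \<Rightarrow> nat" where
  "chain = rec_nat 0 (\<lambda>j D. enum (LEAST w. covers (insert j (set_decode D)) w) - 1)"

lemma recursive_covering: "recursive_in Q (\<lambda>\<omega>. covering)"
proof -
  have "recursive_in Q (\<lambda>\<omega> n. LEAST w. covers (pfst ` set_decode n) w)"
  proof (rule recursive_Least)
    show "\<exists>w. covers (pfst ` set_decode n) w" for n by (rule covers_exists) simp
    have "covers (pfst ` set_decode n) w \<longleftrightarrow> \<not> enum w = 0 \<and>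
        (\<forall>c\<in>set_decode n. pfst c \<in> codes \<longrightarrow> pfst c \<in> set_decode (enum w - 1))" for n w
      unfolding covers_def by simp
    moreover have "decidable_in Q (\<lambda>\<omega> p. \<not> enum (psnd p) = 0 \<and>
        (\<forall>c\<in>set_decode (pfst p). pfst c \<in> codes \<longrightarrow> pfst c \<in> set_decode (enum (psnd p) - 1)))"
      by (intro rec_intros)
    ultimately show "decidable_in Q (\<lambda>\<omega> p. covers (pfst ` set_decode (pfst p)) (psnd p))" by simp
  qed
  then show ?thesis unfolding covering_def by (intro rec_intros)
qed

lemma recursive_chain: "recursive_in Q (\<lambda>\<omega>. chain)"
proof -
  have "recursive_in Q (\<lambda>\<omega> n. LEAST w. covers (insert (pfst n) (set_decode (psnd n))) w)"
  proof (rule recursive_Least)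
    show "\<exists>w. covers (insert (pfst n) (set_decode (psnd n))) w" for n by (rule covers_exists) simp
    have "covers (insert (pfst n) (set_decode (psnd n))) w \<longleftrightarrow> \<not> enum w = 0 \<and>
        (pfst n \<in> codes \<longrightarrow> pfst n \<in> set_decode (enum w - 1)) \<and>
        (\<forall>u\<in>set_decode (psnd n). u \<in> codes \<longrightarrow> u \<in> set_decode (enum w - 1))" for n w
      unfolding covers_def by simp
    moreover have "decidable_in Q (\<lambda>\<omega> p. \<not> enum (psnd p) = 0 \<and>
        (pfst (pfst p) \<in> codes \<longrightarrow> pfst (pfst p) \<in> set_decode (enum (psnd p) - 1)) \<and>
        (\<forall>u\<in>set_decode (psnd (pfst p)). u \<in> codes \<longrightarrow> u \<in> set_decode (enum (psnd p) - 1)))"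
      by (intro rec_intros)
    ultimately show "decidable_in Q (\<lambda>\<omega> p. covers (insert (pfst (pfst p)) (set_decode (psnd (pfst p)))) (psnd p))"
      by simp
  qed
  from recursive_compose[OF this recursive_psnd[OF recursive_id]]
  have "recursive_in Q (\<lambda>\<omega> n. rec_nat 0 (\<lambda>j D. enum (LEAST w. covers (insert j (set_decode D)) w) - 1) n)"
    by (intro rec_intros)
  then show ?thesis unfolding chain_def .
qed

lemmas [rec_intros] = recursive_compose[OF recursive_covering] recursive_compose[OF recursive_chain]

text \<open>
  A bound for the codes of the cells over \<open>D\<close>, so that patterns on \<open>D\<close> have codes below
  \<open>2 ^ cell_limit d D\<close> and can be found and counted by exhaustive search.
\<close>

definition cell_limit :: "nat \<Rightarrow> nat \<Rightarrow> nat" where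
  "cell_limit d D = prod_encode (D, pfst d)"

abbreviation matches :: "nat \<Rightarrow> nat \<Rightarrow> nat \<Rightarrow> nat \<Rightarrow> bool" where
  "matches d D n q \<equiv> is_valid_code mul inv_code d D q \<and> (\<forall>c\<in>set_decode n. c \<in> set_decode q)"

section \<open>Computing the language and the measure\<close>

definition language_test :: "nat \<Rightarrow> nat" where
  "language_test p = of_bool (\<exists>q<2 ^ cell_limit (pfst p) (covering (psnd p)). matches (pfst p) (covering (psnd p)) (psnd p) q)"

definition matches_count :: "nat \<Rightarrow> nat \<Rightarrow> nat" where
  "matches_count d n = (\<Sum>q<2 ^ cell_limit d (covering n). of_bool (matches d (covering n) n q))"

definition valid_count :: "nat \<Rightarrow> nat \<Rightarrow> nat" where
  "valid_count d n = (\<Sum>q<2 ^ cell_limit d (covering n). of_bool (is_valid_code mul inv_code d (covering n) q))"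

text \<open>
  The program returns the exact value of the measure, whatever precision is requested. In
  \<open>rat_of_code\<close>, the code \<open>2 * n\<close> of the numerator stands for the integer \<open>n\<close>, and the denominator
  is stored as its predecessor.
\<close>

definition measure_code :: "nat \<Rightarrow> nat" where
  "measure_code p = prod_encode (2 * matches_count (pfst p) (pfst (psnd p)), valid_count (pfst p) (pfst (psnd p)) - 1)"

lemma recursive_language_test: "partial_recursive (\<lambda>p. Some (language_test p))"
proof -
  have "recursive_in {} (\<lambda>_::unit. language_test)"
    unfolding language_test_def cell_limit_def by (intro rec_intros)
  then show ?thesis by (simp add: recursive_in_def partial_recursive_def)
qed

lemma recursive_measure_code: "partial_recursive (\<lambda>p. Some (measure_code p))"
proof -
  have "recursive_in {} (\<lambda>_::unit. measure_code)"
    unfolding measure_code_def matches_count_def valid_count_def cell_limit_def by (intro rec_intros)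
  then show ?thesis by (simp add: recursive_in_def partial_recursive_def)
qed

end

locale coded_tep_sft = coded_convexoid G \<C> enc mul inv_code enum + countable_tep_sft G \<C> S A k \<T>
    + encoded_tep_sft G \<C> S A k \<T> enc \<alpha>
  for G :: "('g, 'm) monoid_scheme" (structure) and \<C> enc mul inv_code enum S and A :: "'a set" and k \<T> \<alpha>
begin

abbreviation descr :: nat where "descr \<equiv> description enc \<alpha> S A \<T>"

lemma finite_allowed: "finite \<T>"
  by (rule finite_subset[OF family_facts(8) finite_PiE[OF family_facts(1,5)]])

lemma descr_parts:
  "set_decode (pfst descr) = \<alpha> ` A"
  "set_decode (pfst (psnd descr)) = elem_code enc ` S"
  "set_decode (psnd (psnd descr)) = pattern_code enc \<alpha> S ` \<T>"
  using family_facts(1,5) finite_allowed by (simp_all add: description_def set_decode_finset_code)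

text \<open>
  A functional and total set of cells is the graph of exactly one pattern. If \<open>g <# S \<subseteq> D\<close>, then
  \<open>g = u \<otimes> inv s\<close> for \<open>u = g \<otimes> s\<close> and any \<open>s\<close> in the nonempty set \<open>S\<close>, so the local condition on
  codes covers all constraints inside \<open>D\<close>.
\<close>

lemma is_valid_code_iff:
  assumes D: "D \<in> \<C>"
  shows "is_valid_code mul inv_code descr (finset_code enc D) q \<longleftrightarrow> q \<in> valid_codes D"
proof -
  let ?e = "elem_code enc"
  have D': "finite D" "D \<subseteq> carrier G" using convex_finite[OF D] convex_subset[OF D] .
  note parts = descr_parts set_decode_finset_code[OF D'(1)]
  have S_in: "t \<in> carrier G" if "t \<in> S" for t using that family_facts(3) by blast
  have e_image: "?e g \<in> ?e ` D \<longleftrightarrow> g \<in> D" if "g \<in> carrier G" for g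
    using elem_code_eq_iff that D'(2) by (auto simp: image_iff subset_iff)
  have quotient: "mul (prod_encode (?e h, inv_code (?e s))) = ?e (h \<otimes> inv s)" if "h \<in> D" "s \<in> S" for h s
    using that D'(2) S_in by (auto simp: inv_code_eq mul_code subset_iff)
  have product: "mul (prod_encode (?e g, ?e t)) = ?e (g \<otimes> t)" if "g \<in> carrier G" "t \<in> S" for g t
    using that S_in by (simp add: mul_code)
  \<comment> \<open>The local condition, stated for group elements and symbols instead of their codes.\<close>
  let ?local = "\<forall>h\<in>D. \<forall>s\<in>S. (h \<otimes> inv s) <# S \<subseteq> D \<longrightarrow> (\<exists>r\<in>\<T>. \<forall>t\<in>S. \<exists>a\<in>A.
      prod_encode (?e t, \<alpha> a) \<in> cell_code enc \<alpha> r ` S \<and>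
      prod_encode (?e (h \<otimes> inv s \<otimes> t), \<alpha> a) \<in> set_decode q)"
  have code: "is_valid_code mul inv_code descr (finset_code enc D) q \<longleftrightarrow>
    (\<forall>c\<in>set_decode q. pfst c \<in> ?e ` D \<and> psnd c \<in> \<alpha> ` A) \<and>
    (\<forall>h\<in>D. \<exists>c\<in>set_decode q. pfst c = ?e h) \<and>
    (\<forall>c\<in>set_decode q. \<forall>c'\<in>set_decode q. pfst c = pfst c' \<longrightarrow> c = c') \<and> ?local"
  proof -
    have "(\<forall>t\<in>?e ` S. mul (prod_encode (mul (prod_encode (?e h, inv_code (?e s))), t)) \<in> ?e ` D) \<longleftrightarrow>
        (h \<otimes> inv s) <# S \<subseteq> D" if hs: "h \<in> D" "s \<in> S" for h s
    proof -
      have g: "h \<otimes> inv s \<in> carrier G" using hs D'(2) S_in by auto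
      have "?e (h \<otimes> inv s \<otimes> t) \<in> ?e ` D \<longleftrightarrow> h \<otimes> inv s \<otimes> t \<in> D" if "t \<in> S" for t
        by (rule e_image) (use g S_in[OF that] in simp)
      then show ?thesis
        unfolding quotient[OF hs] translate_eq image_subset_iff ball_simps using product[OF g] by simp
    qed
    moreover have "(\<exists>r\<in>pattern_code enc \<alpha> S ` \<T>. \<forall>t\<in>?e ` S. \<exists>a\<in>\<alpha> ` A. prod_encode (t, a) \<in> set_decode r \<and>
        prod_encode (mul (prod_encode (mul (prod_encode (?e h, inv_code (?e s))), t)), a) \<in> set_decode q) \<longleftrightarrow>
      (\<exists>r\<in>\<T>. \<forall>t\<in>S. \<exists>a\<in>A. prod_encode (?e t, \<alpha> a) \<in> cell_code enc \<alpha> r ` S \<and>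
        prod_encode (?e (h \<otimes> inv s \<otimes> t), \<alpha> a) \<in> set_decode q)" if hs: "h \<in> D" "s \<in> S" for h s
    proof -
      have g: "h \<otimes> inv s \<in> carrier G" using hs D'(2) S_in by auto
      show ?thesis
        unfolding quotient[OF hs] ball_simps bex_simps set_decode_pattern_code[OF family_facts(1)]
        using product[OF g] by (simp add: set_decode_pattern_code[OF family_facts(1)] cong: ball_cong)
    qed
    ultimately show ?thesis
      unfolding is_valid_code_def parts by (simp cong: ball_cong)
  qed
  show ?thesis
  proof
    assume "is_valid_code mul inv_code descr (finset_code enc D) q"
    then have cells: "\<forall>c\<in>set_decode q. pfst c \<in> ?e ` D \<and> psnd c \<in> \<alpha> ` A"
      and total: "\<forall>h\<in>D. \<exists>c\<in>set_decode q. pfst c = ?e h"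
      and functional: "\<forall>c\<in>set_decode q. \<forall>c'\<in>set_decode q. pfst c = pfst c' \<longrightarrow> c = c'"
      and local: ?local
      unfolding code by blast+
    have "\<forall>h\<in>D. \<exists>a. a \<in> A \<and> prod_encode (?e h, \<alpha> a) \<in> set_decode q"
    proof
      fix h assume "h \<in> D"
      then obtain c where c: "c \<in> set_decode q" "pfst c = ?e h" using total by blast
      then obtain a where "a \<in> A" "psnd c = \<alpha> a" using cells by blast
      then have "prod_encode (?e h, \<alpha> a) = c" using c(2) by (metis prod.collapse prod_decode_inverse)
      with c(1) \<open>a \<in> A\<close> show "\<exists>a. a \<in> A \<and> prod_encode (?e h, \<alpha> a) \<in> set_decode q" by auto
    qed
    from bchoice[OF this] obtain P0 where P0: "\<forall>h\<in>D. P0 h \<in> A \<and> prod_encode (?e h, \<alpha> (P0 h)) \<in> set_decode q" ..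
    let ?P = "restrict P0 D"
    have PiE: "?P \<in> D \<rightarrow>\<^sub>E A" using P0 by auto
    have P: "cell_code enc \<alpha> ?P h \<in> set_decode q" if "h \<in> D" for h
      using P0 that by (simp add: cell_code_def)
    have decoded: "set_decode q = cell_code enc \<alpha> ?P ` D"
    proof (intro subset_antisym subsetI)
      fix c assume c: "c \<in> set_decode q"
      then obtain h where h: "h \<in> D" "pfst c = ?e h" using cells by blast
      then have "pfst c = pfst (cell_code enc \<alpha> ?P h)" by (simp add: cell_code_def)
      then have "c = cell_code enc \<alpha> ?P h" using functional c P[OF h(1)] by blast
      with h(1) show "c \<in> cell_code enc \<alpha> ?P ` D" by blast
    qed (use P in auto)
    have "q = pattern_code enc \<alpha> D ?P"
      unfolding pattern_code_def decoded[symmetric] by simp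
    note q = this decoded
    have "?P \<in> valid D"
      unfolding valid_def
    proof (intro CollectI conjI ballI impI PiE)
      fix g assume g: "g \<in> carrier G" "g <# S \<subseteq> D"
      obtain s where s: "s \<in> S" using family_facts(2) by blast
      have "g \<otimes> s \<in> D" using g(2) s unfolding translate_eq by blast
      moreover have gs: "g \<otimes> s \<otimes> inv s = g" using g(1) S_in[OF s] by (simp add: m_assoc)
      ultimately obtain r where r: "r \<in> \<T>" "\<forall>t\<in>S. \<exists>a\<in>A.
          prod_encode (?e t, \<alpha> a) \<in> cell_code enc \<alpha> r ` S \<and>
          prod_encode (?e (g \<otimes> t), \<alpha> a) \<in> set_decode q"
        using local[rule_format, of "g \<otimes> s" s] s g(2) unfolding gs by blast
      have r_PiE: "r \<in> S \<rightarrow>\<^sub>E A" using r(1) family_facts(8) by blast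
      have "?P (g \<otimes> t) = r t" if t: "t \<in> S" for t
      proof -
        obtain a where a: "a \<in> A" "prod_encode (?e t, \<alpha> a) \<in> cell_code enc \<alpha> r ` S"
          "prod_encode (?e (g \<otimes> t), \<alpha> a) \<in> cell_code enc \<alpha> ?P ` D"
          using r(2) t unfolding q(2) by blast
        obtain t' where t': "t' \<in> S" "?e t = ?e t'" "\<alpha> a = \<alpha> (r t')"
          using a(2) unfolding cell_code_def by auto
        then have "t' = t" using elem_code_eq_iff S_in t by blast
        obtain h where h: "h \<in> D" "?e (g \<otimes> t) = ?e h" "\<alpha> a = \<alpha> (?P h)"
          using a(3) unfolding cell_code_def by auto
        then have "h = g \<otimes> t" using elem_code_eq_iff[of "g \<otimes> t" h] g(1) S_in[OF t] D'(2) by auto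
        have "\<alpha> (?P (g \<otimes> t)) = \<alpha> (r t)" using t'(3) h(3) \<open>t' = t\<close> \<open>h = g \<otimes> t\<close> by simp
        moreover have "?P (g \<otimes> t) \<in> A" using PiE h(1) \<open>h = g \<otimes> t\<close> by blast
        moreover have "r t \<in> A" using r_PiE t by blast
        ultimately show ?thesis using inj_symbols by (simp add: inj_on_eq_iff)
      qed
      then have "(\<lambda>t\<in>S. ?P (g \<otimes> t)) = r"
        using r_PiE by (auto simp: fun_eq_iff restrict_def PiE_def extensional_def)
      then show "(\<lambda>t\<in>S. ?P (g \<otimes> t)) \<in> \<T>" using r(1) by simp
    qed
    then show "q \<in> valid_codes D" unfolding valid_codes_def q(1) by blast
  next
    assume "q \<in> valid_codes D"
    then obtain P where P: "P \<in> valid D" "q = pattern_code enc \<alpha> D P" unfolding valid_codes_def by blast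
    have q: "set_decode q = cell_code enc \<alpha> P ` D" unfolding P(2) by (rule set_decode_pattern_code[OF D'(1)])
    have PA: "P h \<in> A" if "h \<in> D" for h using valid_PiE[OF P(1)] that by blast
    have "?local"
    proof (intro ballI impI)
      fix h s assume hs: "h \<in> D" "s \<in> S" "(h \<otimes> inv s) <# S \<subseteq> D"
      let ?g = "h \<otimes> inv s"
      let ?r = "\<lambda>t\<in>S. P (?g \<otimes> t)"
      have "?g \<in> carrier G" using hs D'(2) S_in by auto
      then have "?r \<in> \<T>" using P(1) hs(3) unfolding valid_def by blast
      moreover have "P (?g \<otimes> t) \<in> A \<and> prod_encode (?e t, \<alpha> (P (?g \<otimes> t))) \<in> cell_code enc \<alpha> ?r ` S \<and>
          prod_encode (?e (?g \<otimes> t), \<alpha> (P (?g \<otimes> t))) \<in> set_decode q" if t: "t \<in> S" for t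
      proof -
        have gt: "?g \<otimes> t \<in> D" using hs(3) t unfolding translate_eq by blast
        have "prod_encode (?e t, \<alpha> (P (?g \<otimes> t))) = cell_code enc \<alpha> ?r t" using t by (simp add: cell_code_def)
        moreover have "prod_encode (?e (?g \<otimes> t), \<alpha> (P (?g \<otimes> t))) = cell_code enc \<alpha> P (?g \<otimes> t)"
          by (simp add: cell_code_def)
        ultimately show ?thesis using PA[OF gt] gt t unfolding q by blast
      qed
      ultimately show "\<exists>r\<in>\<T>. \<forall>t\<in>S. \<exists>a\<in>A. prod_encode (?e t, \<alpha> a) \<in> cell_code enc \<alpha> r ` S \<and>
          prod_encode (?e (?g \<otimes> t), \<alpha> a) \<in> set_decode q"
        by blast
    qed
    moreover have "c = c'" if cc: "c \<in> set_decode q" "c' \<in> set_decode q" "pfst c = pfst c'" for c c'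
    proof -
      obtain h h' where "h \<in> D" "h' \<in> D" "c = cell_code enc \<alpha> P h" "c' = cell_code enc \<alpha> P h'"
        using cc unfolding q by blast
      moreover from this cc(3) have "h = h'"
        using elem_code_eq_iff D'(2) by (auto simp: cell_code_def)
      ultimately show ?thesis by simp
    qed
    ultimately show "is_valid_code mul inv_code descr (finset_code enc D) q"
      unfolding code using PA by (auto simp: q cell_code_def)
  qed
qed

lemma cell_below_limit:
  assumes D: "D \<in> \<C>" and g: "g \<in> D" and a: "a \<in> A"
  shows "prod_encode (elem_code enc g, \<alpha> a) < cell_limit descr (finset_code enc D)"
  unfolding cell_limit_def
proof (rule prod_encode_strict_mono)
  show "elem_code enc g < finset_code enc D"
    using g by (intro elem_set_decode_less) (simp add: set_decode_finset_code[OF convex_finite[OF D]])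
  show "\<alpha> a < pfst descr" using a by (intro elem_set_decode_less) (simp add: descr_parts)
qed

lemma valid_codes_bounded:
  assumes D: "D \<in> \<C>" and q: "q \<in> valid_codes D"
  shows "q < 2 ^ cell_limit descr (finset_code enc D)"
proof -
  obtain P where P: "P \<in> valid D" "q = pattern_code enc \<alpha> D P" using q unfolding valid_codes_def by blast
  have "cell_code enc \<alpha> P ` D \<subseteq> {..<cell_limit descr (finset_code enc D)}"
    using valid_PiE[OF P(1)] cell_below_limit[OF D] by (auto simp: cell_code_def)
  then show ?thesis unfolding P(2) pattern_code_def by (rule set_encode_less)
qed

lemma covering_convex:
  obtains D where "D \<in> \<C>" "covering n = finset_code enc D"
    "\<forall>g\<in>carrier G. elem_code enc g \<in> pfst ` set_decode n \<longrightarrow> g \<in> D"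
proof -
  have "finite (pfst ` set_decode n)" by simp
  from least_cover[OF this refl]
  obtain D where D: "D \<in> \<C>" "covering n = finset_code enc D"
    "\<And>u. u \<in> pfst ` set_decode n \<Longrightarrow> u \<in> codes \<Longrightarrow> u \<in> elem_code enc ` D"
    unfolding covering_def by blast
  have "g \<in> D" if g: "g \<in> carrier G" "elem_code enc g \<in> pfst ` set_decode n" for g
  proof -
    have "elem_code enc g \<in> elem_code enc ` D" using D(3)[OF g(2)] g(1) by blast
    then obtain h where "h \<in> D" "elem_code enc g = elem_code enc h" by blast
    then show ?thesis using elem_code_eq_iff[of g h] g(1) convex_subset[OF D(1)] by auto
  qed
  with D(1,2) show thesis by (intro that) blast+
qed

text \<open>
  A number belongs to the language iff, as a set of cells, it is contained in the code of a valid
  pattern on a convex set that covers its domain: valid patterns on convex sets extend to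
  configurations, and every subset of the graph of a pattern is the graph of a restriction of it.
\<close>

lemma language_test_correct:
  "decides (\<lambda>n. Some (language_test (prod_encode (descr, n)))) (language_codes G enc \<alpha> X)"
  unfolding decides_def
proof
  fix n
  obtain D where D: "D \<in> \<C>" "covering n = finset_code enc D"
    "\<forall>g\<in>carrier G. elem_code enc g \<in> pfst ` set_decode n \<longrightarrow> g \<in> D"
    by (rule covering_convex[of n])
  note D' = convex_finite[OF D(1)] convex_subset[OF D(1)]
  have "language_test (prod_encode (descr, n)) = of_bool (\<exists>q\<in>valid_codes D. set_decode n \<subseteq> set_decode q)"
    unfolding language_test_def using valid_codes_bounded[OF D(1)]
    by (auto simp: D(2) is_valid_code_iff[OF D(1)] subset_iff)
  also have "(\<exists>q\<in>valid_codes D. set_decode n \<subseteq> set_decode q) \<longleftrightarrow> n \<in> language_codes G enc \<alpha> X"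
  proof
    assume "\<exists>q\<in>valid_codes D. set_decode n \<subseteq> set_decode q"
    then obtain Q where Q: "Q \<in> valid D" "set_decode n \<subseteq> cell_code enc \<alpha> Q ` D"
      unfolding valid_codes_def by (auto simp: set_decode_pattern_code[OF D'(1)])
    let ?C = "{g \<in> D. cell_code enc \<alpha> Q g \<in> set_decode n}"
    have C: "finite ?C" "?C \<subseteq> carrier G" using D' by auto
    have "set_decode n = cell_code enc \<alpha> (restrict Q ?C) ` ?C"
      using Q(2) by (auto simp: cell_code_def)
    then have "n = pattern_code enc \<alpha> ?C (restrict Q ?C)"
      unfolding pattern_code_def by (metis set_decode_inverse)
    moreover have "restrict Q ?C \<in> restrictions X ?C"
    proof -
      obtain x where "x \<in> X" "Q = restrict x D"
        using Q(1) unfolding restrictions_eq_valid[OF D(1), symmetric] restrictions_def by blast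
      moreover have "restrict (restrict x D) ?C = restrict x ?C" by (auto simp: fun_eq_iff restrict_def)
      ultimately show ?thesis unfolding restrictions_def by auto
    qed
    ultimately show "n \<in> language_codes G enc \<alpha> X" unfolding language_codes_def using C by blast
  next
    assume "n \<in> language_codes G enc \<alpha> X"
    then obtain C x where C: "finite C" "C \<subseteq> carrier G" and x: "x \<in> X"
      and n: "n = pattern_code enc \<alpha> C (restrict x C)"
      unfolding language_codes_def restrictions_def by blast
    have "g \<in> D" if "g \<in> C" for g
      using that C(2) by (intro D(3)[rule_format]) (auto simp: n set_decode_pattern_code[OF C(1)] cell_code_def image_image)
    then have CD: "C \<subseteq> D" by blast
    have valid: "restrict x D \<in> valid D"
      using x unfolding restrictions_eq_valid[OF D(1), symmetric] restrictions_def by blast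
    have "restrict (restrict x D) C = restrict x C" using CD by (auto simp: fun_eq_iff restrict_def)
    then have "set_decode n \<subseteq> set_decode (pattern_code enc \<alpha> D (restrict x D))"
      unfolding n using pattern_code_subset_iff[OF C D' restrict_sft_PiE[OF x C(2)] valid_PiE[OF valid]] CD by simp
    then show "\<exists>q\<in>valid_codes D. set_decode n \<subseteq> set_decode q" using valid unfolding valid_codes_def by blast
  qed
  finally show "Some (language_test (prod_encode (descr, n))) = Some (if n \<in> language_codes G enc \<alpha> X then 1 else 0)"
    by simp
qed

lemma rat_of_count_code:
  assumes "0 < t"
  shows "rat_of_code (prod_encode (2 * n, t - 1)) = of_nat n / of_nat t"
proof -
  have "int_encode (int n) = 2 * n" by (simp add: int_encode_def sum_encode_def)
  then have "int_decode (2 * n) = int n" by (metis int_encode_inverse)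
  then show ?thesis using assms by (simp add: rat_of_code_def)
qed

text \<open>
  The measure of a pattern is the proportion of the valid patterns on a covering convex set that
  extend it, and both numbers are found by counting codes.
\<close>

lemma measure_code_correct:
  assumes \<mu>: "tep_measure G \<C> S A \<T> \<mu>"
  shows "approximates G enc \<alpha> X \<mu> (\<lambda>n. Some (measure_code (prod_encode (descr, n))))"
  unfolding approximates_def
proof (intro allI impI)
  fix C P e
  assume "finite C \<and> C \<subseteq> carrier G \<and> P \<in> restrictions X C \<and> 0 < rat_of_code e"
  then have C: "finite C" "C \<subseteq> carrier G" and P: "P \<in> restrictions X C" and e: "0 < rat_of_code e" by auto
  have P_PiE: "P \<in> C \<rightarrow>\<^sub>E A" using P restrict_sft_PiE C(2) unfolding restrictions_def by blast
  define n where "n = pattern_code enc \<alpha> C P"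
  obtain D where D: "D \<in> \<C>" "covering n = finset_code enc D"
    "\<forall>g\<in>carrier G. elem_code enc g \<in> pfst ` set_decode n \<longrightarrow> g \<in> D"
    by (rule covering_convex[of n])
  have "g \<in> D" if "g \<in> C" for g
    using that C(2) by (intro D(3)[rule_format]) (auto simp: n_def set_decode_pattern_code[OF C(1)] cell_code_def image_image)
  then have CD: "C \<subseteq> D" by blast
  have count: "(\<Sum>q<2 ^ cell_limit descr (covering n). of_bool (R q)) = card {q \<in> valid_codes D. R' q}"
    if "\<And>q. R q \<longleftrightarrow> q \<in> valid_codes D \<and> R' q" for R R' :: "nat \<Rightarrow> bool"
  proof -
    have "{q \<in> valid_codes D. R' q} = {q \<in> {..<2 ^ cell_limit descr (covering n)}. R q}"
      using that valid_codes_bounded[OF D(1)] by (auto simp: D(2))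
    then show ?thesis by (simp add: of_bool_def sum.If_cases Int_def)
  qed
  have "matches_count descr n = card {q \<in> valid_codes D. set_decode n \<subseteq> set_decode q}"
    unfolding matches_count_def by (rule count) (auto simp: D(2) is_valid_code_iff[OF D(1)])
  also have "\<dots> = card (extensions C D P)"
    unfolding n_def by (rule card_code_extensions[OF C D(1) CD P_PiE])
  finally have m: "matches_count descr n = card (extensions C D P)" .
  have "valid_count descr n = card {q \<in> valid_codes D. True}"
    unfolding valid_count_def by (rule count) (auto simp: D(2) is_valid_code_iff[OF D(1)])
  then have v: "valid_count descr n = card (valid D)" by (simp add: card_valid_codes[OF D(1)])
  obtain x where "x \<in> X" using P unfolding restrictions_def by blast
  then have "restrict x D \<in> valid D" unfolding restrictions_eq_valid[OF D(1), symmetric] restrictions_def by blast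
  then have "0 < card (valid D)" using finite_valid[OF convex_finite[OF D(1)]] by (auto simp: card_gt_0_iff)
  then have "rat_of_code (measure_code (prod_encode (descr, prod_encode (n, e)))) =
      of_nat (card (extensions C D P)) / of_nat (card (valid D))"
    unfolding measure_code_def by (simp add: m v rat_of_count_code[simplified])
  then have "real_of_rat (rat_of_code (measure_code (prod_encode (descr, prod_encode (n, e))))) =
      measure \<mu> {x \<in> X. restrict x C = P}"
    using tep_measure_pattern[OF \<mu> D(1) CD, of P] by (simp add: cylinder_def of_rat_divide)
  then show "\<exists>q. Some (measure_code (prod_encode (descr, prod_encode (pattern_code enc \<alpha> C P, e)))) = Some q \<and>
      \<bar>real_of_rat (rat_of_code q) - measure \<mu> {x \<in> X. restrict x C = P}\<bar> \<le> real_of_rat (rat_of_code e)"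
    using e unfolding n_def by simp
qed

section \<open>The sampling algorithm\<close>

lemma chain_exhaustion:
  obtains D where "exhaustion D" "\<And>j. finset_code enc (D j) = chain j"
proof -
  have step: "\<exists>C\<in>\<C>. chain (Suc j) = finset_code enc C \<and>
      (\<forall>u. u = j \<or> u \<in> set_decode (chain j) \<longrightarrow> u \<in> codes \<longrightarrow> u \<in> elem_code enc ` C)" for j
  proof -
    have "finite (insert j (set_decode (chain j)))" by simp
    from least_cover[OF this refl] obtain C where "C \<in> \<C>"
      "enum (LEAST w. covers (insert j (set_decode (chain j))) w) - 1 = finset_code enc C"
      "\<And>u. u \<in> insert j (set_decode (chain j)) \<Longrightarrow> u \<in> codes \<Longrightarrow> u \<in> elem_code enc ` C" by blast
    then show ?thesis by (intro bexI[of _ C]) (auto simp: chain_def)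
  qed
  have "\<exists>C. C \<in> \<C> \<and> chain j = finset_code enc C" for j
  proof (cases j)
    case 0
    have "finset_code enc {} = 0" by (simp add: finset_code_def)
    with 0 empty_convex show ?thesis by (intro exI[of _ "{}"]) (simp add: chain_def)
  next
    case (Suc i)
    then show ?thesis using step[of i] by blast
  qed
  from choice[OF allI, OF this] obtain D where "\<forall>j. D j \<in> \<C> \<and> chain j = finset_code enc (D j)" ..
  then have D: "D j \<in> \<C>" "chain j = finset_code enc (D j)" for j by auto
  have D': "finite (D j)" "D j \<subseteq> carrier G" for j using convex_finite convex_subset D(1) by auto
  have grows: "g \<in> D (Suc j)" if g: "g \<in> carrier G" "elem_code enc g = j \<or> g \<in> D j" for g j
  proof -
    obtain C where C: "C \<in> \<C>" "chain (Suc j) = finset_code enc C"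
      "\<And>u. u = j \<or> u \<in> set_decode (chain j) \<Longrightarrow> u \<in> codes \<Longrightarrow> u \<in> elem_code enc ` C"
      using step[of j] by blast
    have "elem_code enc g \<in> elem_code enc ` C"
      using g by (intro C(3)) (auto simp: D(2) set_decode_finset_code[OF D'(1)])
    also have "elem_code enc ` C = elem_code enc ` D (Suc j)"
      using C(2) D(2)[of "Suc j"] set_decode_finset_code[OF convex_finite[OF C(1)], of enc]
        set_decode_finset_code[OF D'(1), of enc "Suc j"] by simp
    finally obtain h where "h \<in> D (Suc j)" "elem_code enc g = elem_code enc h" by blast
    then show ?thesis using elem_code_eq_iff[of g h] g(1) D'(2) by auto
  qed
  have "D 0 = {}"
    using D(2)[of 0] set_decode_finset_code[OF D'(1), of enc 0] by (simp add: chain_def)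
  moreover have "D j \<subseteq> D (Suc j)" for j using grows D'(2) by blast
  moreover have "(\<Union>j. D j) = carrier G" using grows D'(2) by blast
  ultimately have "exhaustion D" unfolding exhaustion_def using D(1) by blast
  then show thesis using D(2) by (intro that) auto
qed

text \<open>
  The random configuration of \<open>exhausted_tep_sft\<close> is computable if the exhaustion is. On the input
  \<open>prod_encode (c, j)\<close>, the program runs the stages before \<open>j\<close> and outputs \<open>c\<close> if \<open>c\<close> is the code of a
  cell of the pattern found, and diverges otherwise. The union of these patterns is the graph of the
  configuration. The program agrees with the construction unless some stage rejects all attempts,
  which has probability 0; and the distribution of the configuration is the given measure by
  uniqueness.
\<close>

lemma sampled_perfectly_tep_measure:
  assumes \<mu>: "tep_measure G \<C> S A \<T> \<mu>"
  shows "sampled_perfectly G enc \<alpha> \<mu>"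
proof -
  obtain D where D: "exhaustion D" "\<And>j. finset_code enc (D j) = chain j"
    using chain_exhaustion by blast
  have D': "D j \<in> \<C>" for j using D(1) unfolding exhaustion_def by blast
  define m where "m = (\<lambda>j. cell_limit descr (chain (Suc j)))"
  interpret exhausted_tep_sft G \<C> S A k \<T> enc \<alpha> D m
  proof unfold_locales
    show "prod_encode (elem_code enc g, \<alpha> a) < m j" if "g \<in> D (Suc j)" "a \<in> A" for g j a
      using cell_below_limit[OF D' that] by (simp add: m_def D(2))
  qed (rule D(1))
  define Q :: "((nat \<Rightarrow> bool) \<Rightarrow> nat \<Rightarrow> nat option) set"
    where "Q = {\<lambda>\<omega> n. Some (if \<omega> n then 1 else 0)}"
  have options_iff: "v \<in> options j h \<longleftrightarrow> matches descr (chain (Suc j)) h v" for j h v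
    using is_valid_code_iff[OF D', of "Suc j" v] unfolding options_def D(2) by auto
  have bit: "recursive_in Q (\<lambda>\<omega> n. of_bool (\<omega> n))"
    unfolding recursive_in_def of_bool_def by (rule partial_recursive_in.basic) (simp add: Q_def)
  have "decidable_in Q (\<lambda>\<omega>. \<omega>)" unfolding decidable_in_def by (rule bit)
  note bit = decidable_compose[OF this]
  have draw: "draw (m j) \<omega> j t =
      (\<Sum>i<m j. of_bool (\<omega> (prod_encode (j, prod_encode (t, i)))) * 2 ^ i)" for j \<omega> t
  proof -
    have "draw (m j) \<omega> j t = (\<Sum>i\<in>{i \<in> {..<m j}. \<omega> (prod_encode (j, prod_encode (t, i)))}. 2 ^ i)"
      unfolding draw_def set_encode_def by (rule sum.cong) auto
    also have "\<dots> = (\<Sum>i<m j. if \<omega> (prod_encode (j, prod_encode (t, i))) then 2 ^ i else 0)"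
      by (rule sum.inter_filter) simp
    finally show ?thesis by (simp add: of_bool_def if_distrib[of "\<lambda>x. x * _"] cong: if_cong)
  qed
  have draw_rec: "recursive_in Q (\<lambda>\<omega> n. draw (m (j \<omega> n)) \<omega> (j \<omega> n) (t \<omega> n))"
    if "recursive_in Q j" "recursive_in Q t" for j t
  proof -
    have "recursive_in Q (\<lambda>\<omega> p. draw (m (pfst p)) \<omega> (pfst p) (psnd p))"
      unfolding draw unfolding m_def cell_limit_def by (intro rec_intros bit)
    from recursive_compose[OF this recursive_pair[OF that]] show ?thesis by simp
  qed
  \<comment> \<open>The argument \<open>p\<close> is the pair of the stage and of the state that it starts from.\<close>
  let ?accepts = "\<lambda>\<omega> p t. draw (m (pfst p)) \<omega> (pfst p) t \<in> options (pfst p) (psnd p)"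
  define advance where "advance = (\<lambda>\<omega> p. Option.bind
    (if \<exists>t. ?accepts \<omega> p t then Some (LEAST t. ?accepts \<omega> p t) else None)
    (\<lambda>t. Some (draw (m (pfst p)) \<omega> (pfst p) t)))"
  have advance: "advance \<omega> p = (if \<exists>t. ?accepts \<omega> p t
      then Some (pick (m (pfst p)) (options (pfst p) (psnd p)) \<omega> (pfst p)) else None)" for \<omega> p
    by (simp add: advance_def pick_def)
  have "decidable_in Q (\<lambda>\<omega> p. ?accepts \<omega> (pfst p) (psnd p))"
    unfolding options_iff by (intro rec_intros draw_rec)
  then have "partial_recursive_in Q (\<lambda>\<omega> p. if \<exists>t. ?accepts \<omega> p t then Some (LEAST t. ?accepts \<omega> p t) else None)"
    by (rule partial_recursive_Least)
  moreover have "recursive_in Q (\<lambda>\<omega> p. draw (m (pfst (pfst p))) \<omega> (pfst (pfst p)) (psnd p))"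
    by (intro rec_intros draw_rec)
  ultimately have advance_rec: "partial_recursive_in Q advance"
    unfolding recursive_in_def advance_def by (rule partial_recursive_bind)
  let ?run = "\<lambda>\<omega> j. rec_nat (Some 0) (\<lambda>y r. Option.bind r (\<lambda>i. advance \<omega> (prod_encode (y, i)))) j"
  have "partial_recursive_in Q (\<lambda>\<omega> p. advance \<omega> (psnd p))"
    using partial_recursive_in.comp[OF advance_rec partial_recursive_in.right] by simp
  from partial_recursive_in.prim_rec[OF partial_recursive_in.zero this]
  have run: "partial_recursive_in Q (\<lambda>\<omega> p. ?run \<omega> (psnd p))" by (simp add: case_prod_unfold)
  let ?F = "\<lambda>\<omega> p. Option.bind (?run \<omega> (psnd p)) (\<lambda>h. if pfst p \<in> set_decode h then Some (pfst p) else None)"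
  have "partial_recursive_in Q (\<lambda>\<omega> p. if pfst (pfst p) \<in> set_decode (psnd p) then Some (pfst (pfst p)) else None)"
    by (intro partial_recursive_guard rec_intros)
  from partial_recursive_bind[OF run this] have F: "bit_recursive ?F"
    unfolding bit_recursive_def Q_def .
  have ran: "ran (?F \<omega>) = cell_code enc \<alpha> (\<xi> \<omega>) ` carrier G"
    if success: "\<forall>j. \<exists>t. draw (m j) \<omega> j t \<in> options j (state \<omega> j)" for \<omega>
  proof -
    have "?run \<omega> j = Some (state \<omega> j)" for j
    proof (induction j)
      case (Suc j)
      then show ?case using success by (simp add: advance)
    qed simp
    then have F_eq: "?F \<omega> p = (if pfst p \<in> set_decode (state \<omega> (psnd p)) then Some (pfst p) else None)" for p
      by simp
    have "ran (?F \<omega>) = (\<Union>j. set_decode (state \<omega> j))"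
    proof (intro subset_antisym subsetI)
      fix c assume "c \<in> ran (?F \<omega>)"
      then obtain p where "?F \<omega> p = Some c" unfolding ran_def by blast
      then show "c \<in> (\<Union>j. set_decode (state \<omega> j))" unfolding F_eq by (auto split: if_splits)
    next
      fix c assume "c \<in> (\<Union>j. set_decode (state \<omega> j))"
      then obtain j where "c \<in> set_decode (state \<omega> j)" by blast
      then have "?F \<omega> (prod_encode (c, j)) = Some c" unfolding F_eq by simp
      then show "c \<in> ran (?F \<omega>)" by (rule ranI)
    qed
    also have "\<dots> = (\<Union>j. cell_code enc \<alpha> (\<xi> \<omega>) ` D j)"
    proof (intro SUP_cong refl)
      fix j
      have "set_decode (state \<omega> j) = cell_code enc \<alpha> (pattern_at \<omega> j) ` D j"
        unfolding pattern_at(2)[symmetric] by (rule set_decode_pattern_code[OF D_facts(4)])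
      also have "\<dots> = cell_code enc \<alpha> (\<xi> \<omega>) ` D j"
        unfolding \<xi>_restrict[symmetric] by (auto simp: cell_code_def)
      finally show "set_decode (state \<omega> j) = cell_code enc \<alpha> (\<xi> \<omega>) ` D j" .
    qed
    also have "\<dots> = cell_code enc \<alpha> (\<xi> \<omega>) ` carrier G"
      using D(1) unfolding exhaustion_def by blast
    finally show ?thesis .
  qed
  have AE: "AE \<omega> in coin_space. ran (?F \<omega>) = cell_code enc \<alpha> (\<xi> \<omega>) ` carrier G"
    using AE_all_accepted by eventually_elim (rule ran)
  have "distr coin_space (borel_sigma (config_topology G A X)) \<xi> = distr coin_space \<mu> \<xi>"
    using tep_measure_facts(3)[OF \<mu>] by (intro distr_cong) auto
  with tep_measure_unique[OF tep_measure_\<xi> \<mu>] have "distr coin_space \<mu> \<xi> = \<mu>" by simp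
  moreover have "\<xi> \<in> measurable coin_space \<mu>"
    using \<xi>_measurable measurable_cong_sets[OF refl tep_measure_facts(3)[OF \<mu>]] by blast
  ultimately show ?thesis
    unfolding sampled_perfectly_def using F AE by blast
qed

end

section \<open>Programs for the group and the convexoid\<close>

lemma coded_convexoid_exists:
  assumes "group G" "convexoid G \<C>" "encoded_group G enc" "decidable_word_problem G enc" "re_convexoid enc \<C>"
  obtains mul inv_code enum where "coded_convexoid G \<C> enc mul inv_code enum"
proof -
  interpret group G by fact
  let ?e = "elem_code enc"
  let ?E = "?e ` carrier G"
  have E: "decidable_set ?E" using assms(4) unfolding decidable_word_problem_def by blast
  have inj: "?e g = ?e h \<longleftrightarrow> g = h" if "g \<in> carrier G" "h \<in> carrier G" for g h
    using assms(3) that by (auto simp: encoded_group_def elem_code_def list_encode_eq inj_on_eq_iff)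
  define d where "d = inv_into (carrier G) ?e"
  have d: "d (?e g) = g" if "g \<in> carrier G" for g
    unfolding d_def using inj that by (intro inv_into_f_f inj_onI) auto
  have E_dec: "decidable_in {} (\<lambda>_::unit. \<lambda>n. n \<in> ?E)" by (rule decidable_set_lift[OF E])
  obtain fm where fm: "partial_recursive fm" "\<And>g h. g \<in> carrier G \<Longrightarrow> h \<in> carrier G \<Longrightarrow>
      fm (prod_encode (?e g, ?e h)) = Some (?e (g \<otimes>\<^bsub>G\<^esub> h))"
    using assms(4) unfolding decidable_word_problem_def by blast
  obtain fi where fi: "partial_recursive fi" "\<And>g. g \<in> carrier G \<Longrightarrow> fi (?e g) = Some (?e (inv\<^bsub>G\<^esub> g))"
    using assms(4) unfolding decidable_word_problem_def by blast
  obtain mul where mul: "partial_recursive (\<lambda>n. Some (mul n))"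
    "\<And>n. pfst n \<in> ?E \<and> psnd n \<in> ?E \<Longrightarrow> mul n = ?e (d (pfst n) \<otimes>\<^bsub>G\<^esub> d (psnd n))"
  proof (rule total_extension[OF fm(1), where P = "\<lambda>n. pfst n \<in> ?E \<and> psnd n \<in> ?E"
        and v = "\<lambda>n. ?e (d (pfst n) \<otimes>\<^bsub>G\<^esub> d (psnd n))" and m = "prod_encode (?e \<one>\<^bsub>G\<^esub>, ?e \<one>\<^bsub>G\<^esub>)"])
    show "decidable_in {} (\<lambda>_::unit. \<lambda>n. pfst n \<in> ?E \<and> psnd n \<in> ?E)"
      by (intro rec_intros decidable_compose[OF E_dec])
    show "fm n = Some (?e (d (pfst n) \<otimes>\<^bsub>G\<^esub> d (psnd n)))" if n: "pfst n \<in> ?E \<and> psnd n \<in> ?E" for n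
    proof -
      obtain g h where gh: "g \<in> carrier G" "h \<in> carrier G" "pfst n = ?e g" "psnd n = ?e h"
        using n by blast
      have "n = prod_encode (pfst n, psnd n)" by simp
      then have "fm n = Some (?e (g \<otimes>\<^bsub>G\<^esub> h))" unfolding gh(3,4) using fm(2)[OF gh(1,2)] by simp
      then show ?thesis unfolding gh(3,4) d[OF gh(1)] d[OF gh(2)] .
    qed
  qed auto
  obtain inv_code where inv_code: "partial_recursive (\<lambda>n. Some (inv_code n))"
    "\<And>n. n \<in> ?E \<Longrightarrow> inv_code n = ?e (inv\<^bsub>G\<^esub> (d n))"
  proof (rule total_extension[OF fi(1) E_dec, where v = "\<lambda>n. ?e (inv\<^bsub>G\<^esub> (d n))" and m = "?e \<one>\<^bsub>G\<^esub>"])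
    show "fi n = Some (?e (inv\<^bsub>G\<^esub> (d n)))" if "n \<in> ?E" for n using that fi(2) d by auto
  qed auto
  obtain enum where enum: "partial_recursive (\<lambda>n. Some (enum n))"
    "\<And>v. v \<in> finset_code enc ` \<C> \<longleftrightarrow> (\<exists>w. enum w = Suc v)"
    using re_set_enumeration assms(5) unfolding re_convexoid_def by blast
  have "coded_convexoid G \<C> enc mul inv_code enum"
    by unfold_locales (use assms(2) E mul inv_code enum d in auto)
  then show thesis by (rule that)
qed

theorem theorem20:
  fixes G :: "('g, 'm) monoid_scheme"
    and \<C> :: "'g set set"
    and S :: "'g set" and A :: "'a set" and k :: nat and \<T> :: "('g \<Rightarrow> 'a) set"
    and enc :: "'g \<Rightarrow> nat list"
  assumes "group G" and "countable (carrier G)" and "convexoid G \<C>"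
    and "tep_family G \<C> S A k \<T>"
  shows "(\<exists>!\<mu>. tep_measure G \<C> S A \<T> \<mu>) \<and>
    (invariant_convexoid G \<C> \<longrightarrow>
      (\<forall>\<mu>. tep_measure G \<C> S A \<T> \<mu> \<longrightarrow> shift_invariant G \<mu>)) \<and>
    (encoded_group G enc \<and> decidable_word_problem G enc \<and> re_convexoid enc \<C> \<longrightarrow>
      (\<exists>l f. partial_recursive l \<and> partial_recursive f \<and>
        (\<forall>S' (A' :: 'a set) k' \<T>' (\<alpha> :: 'a \<Rightarrow> nat) \<mu>.
          tep_family G \<C> S' A' k' \<T>' \<and> inj_on \<alpha> A' \<and> tep_measure G \<C> S' A' \<T>' \<mu> \<longrightarrow>
          computes_measure G enc \<alpha> (sft G S' A' \<T>') \<mu>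
            (\<lambda>n. l (prod_encode (description enc \<alpha> S' A' \<T>', n)))
            (\<lambda>n. f (prod_encode (description enc \<alpha> S' A' \<T>', n))))) \<and>
      (\<forall>(\<alpha> :: 'a \<Rightarrow> nat) \<mu>. inj_on \<alpha> A \<and> tep_measure G \<C> S A \<T> \<mu> \<longrightarrow>
        sampled_perfectly G enc \<alpha> \<mu>))"
proof (intro conjI impI)
  have sft: "countable_tep_sft G \<C> S' A' k' \<T>'" if "tep_family G \<C> S' A' k' \<T>'"
    for S' and A' :: "'a set" and k' \<T>'
    using assms(1-3) that
    by (simp add: countable_tep_sft_def tep_sft_def tep_sft_axioms_def countable_tep_sft_axioms_def)
  interpret countable_tep_sft G \<C> S A k \<T> by (rule sft[OF assms(4)])
  show "\<exists>!\<mu>. tep_measure G \<C> S A \<T> \<mu>" using tep_measure_exists tep_measure_unique by blast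
  show "\<forall>\<mu>. tep_measure G \<C> S A \<T> \<mu> \<longrightarrow> shift_invariant G \<mu>" if "invariant_convexoid G \<C>"
    using tep_measure_invariant[OF that] by blast
  assume enc: "encoded_group G enc \<and> decidable_word_problem G enc \<and> re_convexoid enc \<C>"
  then obtain mul inv_code enum where coded: "coded_convexoid G \<C> enc mul inv_code enum"
    using coded_convexoid_exists[OF assms(1,3)] by blast
  have coded_sft: "coded_tep_sft G \<C> enc mul inv_code enum S' A' k' \<T>' \<alpha>"
    if "tep_family G \<C> S' A' k' \<T>'" "inj_on \<alpha> A'" for S' and A' :: "'a set" and k' \<T>' \<alpha>
  proof -
    have "encoded_tep_sft G \<C> S' A' k' \<T>' enc \<alpha>"
      using countable_tep_sft.axioms(1)[OF sft[OF that(1)]] enc that(2)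
      by (simp add: encoded_tep_sft_def encoded_tep_sft_axioms_def encoded_group_def)
    then show ?thesis using coded sft[OF that(1)] by (simp add: coded_tep_sft_def)
  qed
  show "\<forall>(\<alpha> :: 'a \<Rightarrow> nat) \<mu>. inj_on \<alpha> A \<and> tep_measure G \<C> S A \<T> \<mu> \<longrightarrow> sampled_perfectly G enc \<alpha> \<mu>"
    using coded_tep_sft.sampled_perfectly_tep_measure[OF coded_sft[OF assms(4)]] by blast
  show "\<exists>l f. partial_recursive l \<and> partial_recursive f \<and>
      (\<forall>S' (A' :: 'a set) k' \<T>' (\<alpha> :: 'a \<Rightarrow> nat) \<mu>.
        tep_family G \<C> S' A' k' \<T>' \<and> inj_on \<alpha> A' \<and> tep_measure G \<C> S' A' \<T>' \<mu> \<longrightarrow>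
        computes_measure G enc \<alpha> (sft G S' A' \<T>') \<mu>
          (\<lambda>n. l (prod_encode (description enc \<alpha> S' A' \<T>', n)))
          (\<lambda>n. f (prod_encode (description enc \<alpha> S' A' \<T>', n))))"
  proof (intro exI conjI allI impI)
    interpret coded: coded_convexoid G \<C> enc mul inv_code enum by (rule coded)
    show "partial_recursive (\<lambda>p. Some (coded.language_test p))"
      by (rule coded.recursive_language_test)
    show "partial_recursive (\<lambda>p. Some (coded.measure_code p))"
      by (rule coded.recursive_measure_code)
    fix S' and A' :: "'a set" and k' \<T>' and \<alpha> :: "'a \<Rightarrow> nat" and \<mu>
    assume *: "tep_family G \<C> S' A' k' \<T>' \<and> inj_on \<alpha> A' \<and> tep_measure G \<C> S' A' \<T>' \<mu>"
    then interpret coded': coded_tep_sft G \<C> enc mul inv_code enum S' A' k' \<T>' \<alpha>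
      using coded_sft by blast
    show "computes_measure G enc \<alpha> (sft G S' A' \<T>') \<mu>
        (\<lambda>n. Some (coded.language_test (prod_encode (description enc \<alpha> S' A' \<T>', n))))
        (\<lambda>n. Some (coded.measure_code (prod_encode (description enc \<alpha> S' A' \<T>', n))))"
      unfolding computes_measure_def
      using coded'.language_test_correct coded'.measure_code_correct * by blast
  qed
qed

end
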